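(* Let $s,t$ be coprime integers greater than $1$, let $\sigma,\tau$ be $(s,t)$-cores and $n\ge0$ an integer. Then the set of partitions of $n$ with $s$-core $\sigma$ and $t$-core $\tau$ contains exactly one self-conjugate partition if and only if $\sigma'=\sigma$, $\tau'=\tau$ and one of the following holds: (C1) $\sigma=\tau$ and $n=|\sigma|$; (C2) $t$ is odd, $\sigma\rightharpoondown_{s,t}\tau$, and $n=|\tau|+t$; (C3) $s$ is odd, $\tau\rightharpoondown_{t,s}\sigma$, and $n=|\sigma|+s$; (C4) $s$ and $t$ are both odd, $\sigma\leftrightharpoons_{s,t}\tau$, and $n=|\sigma\star\tau|+s+t$; (C5) $s$ and $t$ are both odd, $\sigma=\tau=\kappa_{s,t}$, and $n=|\kappa_{s,t}|+st$.
   Context: Partitions, size $|\lambda|$; beta-set $\mathcal B(\lambda)=\{\lambda_r-r:r\ge1\}$. The conjugate $\lambda'$ is given by $\lambda'_r=|\{c:\lambda_c\ge r\}|$; $\lambda$ is self-conjugate if $\lambda'=\lambda$. A rim $s$-hook is a connected set of $s$ nodes of the rim of the Young diagram (nodes $(r,c)$ with $(r+1,c+1)$ not a node) whose removal leaves a partition's diagram; $\lambda$ is an $s$-core if it has no rim $s$-hook, and the $s$-core of $\lambda$ is obtained by repeatedly removing rim $s$-hooks. An $(s,t)$-core is both an $s$-core and a $t$-core; $\kappa_{s,t}$ denotes the unique $(s,t)$-core of largest size. For $b\in\mathbb Z$ write $\bar b=-1-b$. For partitions $\alpha,\beta$ and positive integers $p,q$, write $\alpha\rightharpoondown_{p,q}\beta$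 if there is an integer $b\in\mathcal B(\beta)\setminus\mathcal B(\alpha)$ with $\bar b-b\equiv q\pmod{2p}$ and $\mathcal B(\alpha)=(\mathcal B(\beta)\setminus\{b\})\cup\{\bar b\}$. Write $\sigma\leftrightharpoons_{s,t}\tau$ if there are distinct integers $b,c\in\mathcal B(\tau)\setminus\mathcal B(\sigma)$ with $\bar b-b\equiv t\pmod{2s}$, $\bar c-c\equiv -s\pmod{2t}$ and $\mathcal B(\sigma)=(\mathcal B(\tau)\setminus\{b,c\})\cup\{\bar b,\bar c\}$; in that case $\sigma\star\tau$ denotes the partition with beta-set $(\mathcal B(\tau)\setminus\{c\})\cup\{\bar c\}$. *)

theory Defs
  imports "HOL-Number_Theory.Cong"
begin

text \<open>
  A partition is a weakly decreasing, finitely supported function. Rows and columns are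
  numbered from 0, so \<open>l r\<close> is the part usually written \<open>\<lambda>\<^bsub>r+1\<^esub>\<close>.
\<close>

definition is_partition :: "(nat \<Rightarrow> nat) \<Rightarrow> bool" where
  "is_partition l \<longleftrightarrow> antimono l \<and> finite {r. l r \<noteq> 0}"

definition psize :: "(nat \<Rightarrow> nat) \<Rightarrow> nat" where
  "psize l = (\<Sum>r | l r \<noteq> 0. l r)"

definition conjugate :: "(nat \<Rightarrow> nat) \<Rightarrow> nat \<Rightarrow> nat" where
  "conjugate l = (\<lambda>r. card {c. l c \<ge> Suc r})"

text \<open>The shift by \<open>r + 1\<close> compensates for counting rows from 0.\<close>

definition beta_set :: "(nat \<Rightarrow> nat) \<Rightarrow> int set" where
  "beta_set l = {int (l r) - (int r + 1) | r. True}"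

definition diagram :: "(nat \<Rightarrow> nat) \<Rightarrow> (nat \<times> nat) set" where
  "diagram l = {(r, c). c < l r}"

definition rim :: "(nat \<Rightarrow> nat) \<Rightarrow> (nat \<times> nat) set" where
  "rim l = {(r, c). (r, c) \<in> diagram l \<and> (Suc r, Suc c) \<notin> diagram l}"

text \<open>Two nodes are adjacent if they share an edge.\<close>

definition adjacent :: "nat \<times> nat \<Rightarrow> nat \<times> nat \<Rightarrow> bool" where
  "adjacent x y \<longleftrightarrow>
     fst x = fst y \<and> (snd x = Suc (snd y) \<or> snd y = Suc (snd x)) \<or>
     snd x = snd y \<and> (fst x = Suc (fst y) \<or> fst y = Suc (fst x))"

definition connected_nodes :: "(nat \<times> nat) set \<Rightarrow> bool" where
  "connected_nodes H \<longleftrightarrow>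
     (\<forall>x\<in>H. \<forall>y\<in>H. (x, y) \<in> {(u, v). u \<in> H \<and> v \<in> H \<and> adjacent u v}\<^sup>*)"

definition rim_hook :: "nat \<Rightarrow> (nat \<Rightarrow> nat) \<Rightarrow> (nat \<times> nat) set \<Rightarrow> bool" where
  "rim_hook s l H \<longleftrightarrow> H \<subseteq> rim l \<and> card H = s \<and> connected_nodes H \<and>
     (\<exists>m. is_partition m \<and> diagram m = diagram l - H)"

definition removes_rim_hook :: "nat \<Rightarrow> (nat \<Rightarrow> nat) \<Rightarrow> (nat \<Rightarrow> nat) \<Rightarrow> bool" where
  "removes_rim_hook s l m \<longleftrightarrow>
     is_partition m \<and> (\<exists>H. rim_hook s l H \<and> diagram m = diagram l - H)"

definition is_core :: "nat \<Rightarrow> (nat \<Rightarrow> nat) \<Rightarrow> bool" where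
  "is_core s l \<longleftrightarrow> is_partition l \<and> \<not> (\<exists>H. rim_hook s l H)"

definition core_of :: "nat \<Rightarrow> (nat \<Rightarrow> nat) \<Rightarrow> (nat \<Rightarrow> nat)" where
  "core_of s l = (THE m. (removes_rim_hook s)\<^sup>*\<^sup>* l m \<and> is_core s m)"

definition is_core2 :: "nat \<Rightarrow> nat \<Rightarrow> (nat \<Rightarrow> nat) \<Rightarrow> bool" where
  "is_core2 s t l \<longleftrightarrow> is_core s l \<and> is_core t l"

definition kappa :: "nat \<Rightarrow> nat \<Rightarrow> (nat \<Rightarrow> nat)" where
  "kappa s t = (THE k. is_core2 s t k \<and> (\<forall>l. is_core2 s t l \<longrightarrow> psize l \<le> psize k))"

definition bar :: "int \<Rightarrow> int" where
  "bar b = - 1 - b"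

text \<open>\<open>harpoon p q \<alpha> \<beta>\<close> is \<open>\<alpha> \<rightharpoondown>\<^bsub>p,q\<^esub> \<beta>\<close>.\<close>

definition harpoon :: "nat \<Rightarrow> nat \<Rightarrow> (nat \<Rightarrow> nat) \<Rightarrow> (nat \<Rightarrow> nat) \<Rightarrow> bool" where
  "harpoon p q \<alpha> \<beta> \<longleftrightarrow>
     (\<exists>b. b \<in> beta_set \<beta> - beta_set \<alpha> \<and>
          [bar b - b = int q] (mod (2 * int p)) \<and>
          beta_set \<alpha> = (beta_set \<beta> - {b}) \<union> {bar b})"

definition double_harpoon_witness ::
    "nat \<Rightarrow> nat \<Rightarrow> (nat \<Rightarrow> nat) \<Rightarrow> (nat \<Rightarrow> nat) \<Rightarrow> int \<Rightarrow> int \<Rightarrow> bool" where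
  "double_harpoon_witness s t \<sigma> \<tau> b c \<longleftrightarrow>
     b \<noteq> c \<and> b \<in> beta_set \<tau> - beta_set \<sigma> \<and> c \<in> beta_set \<tau> - beta_set \<sigma> \<and>
     [bar b - b = int t] (mod (2 * int s)) \<and>
     [bar c - c = - int s] (mod (2 * int t)) \<and>
     beta_set \<sigma> = (beta_set \<tau> - {b, c}) \<union> {bar b, bar c}"

text \<open>\<open>double_harpoon s t \<sigma> \<tau>\<close> is \<open>\<sigma> \<leftrightharpoons>\<^bsub>s,t\<^esub> \<tau>\<close>.\<close>

definition double_harpoon :: "nat \<Rightarrow> nat \<Rightarrow> (nat \<Rightarrow> nat) \<Rightarrow> (nat \<Rightarrow> nat) \<Rightarrow> bool" where
  "double_harpoon s t \<sigma> \<tau> \<longleftrightarrow> (\<exists>b c. double_harpoon_witness s t \<sigma> \<tau> b c)"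

text \<open>
  This is \<open>\<sigma> \<star> \<tau>\<close>. If \<open>s\<close>, \<open>t\<close> are odd and coprime and \<open>\<sigma>\<close>, \<open>\<tau>\<close> are cores for both \<open>s\<close> and \<open>t\<close>,
  no single integer can play the roles of both \<open>b\<close> and \<open>c\<close>, so the
  ordered pair \<open>(b, c)\<close>, and hence the resulting partition, is determined by \<open>\<sigma>\<close> and \<open>\<tau>\<close>.
\<close>

definition star :: "nat \<Rightarrow> nat \<Rightarrow> (nat \<Rightarrow> nat) \<Rightarrow> (nat \<Rightarrow> nat) \<Rightarrow> (nat \<Rightarrow> nat)" where
  "star s t \<sigma> \<tau> = (THE m. is_partition m \<and>
     (\<exists>b c. double_harpoon_witness s t \<sigma> \<tau> b c \<and>
            beta_set m = (beta_set \<tau> - {c}) \<union> {bar c}))"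

end

theory Submission
  imports Defs
begin

text \<open>
  A partition is replaced by its beta-set and self-conjugate partitions become sets \<open>X\<close> with
  \<open>b \<in> X \<longleftrightarrow> bar b \<notin> X\<close>. The \<open>s\<close>-core of \<open>X\<close> is determined by the number of beads in each residue class
  modulo \<open>s\<close>, and passing from one self-conjugate set to another means flipping a finite set
  \<open>F \<subseteq> X\<close>, that is, replacing each \<open>b \<in> F\<close> by \<open>bar b\<close>. So uniqueness of \<open>X\<close> says that no nonempty
  \<open>F\<close> preserves both the class counts and the size; we call such \<open>X\<close> rigid.

  If \<open>X\<close> is rigid, \<open>b \<in> X\<close>, \<open>b - t \<notin> X\<close> (a rise), \<open>c \<notin> X\<close>, \<open>c - t \<in> X\<close> (a drop) and \<open>b \<equiv> c\<close> modulo \<open>s\<close>, then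
  \<open>{b, bar (b - t), c - t, bar c}\<close> would be such an \<open>F\<close> unless two of its elements coincide. As \<open>\<sigma>\<close> is a
  \<open>t\<close>-core, every class modulo \<open>s\<close> has at least as many drops as rises, so rises occur only in the
  degenerate positions. Analysing these, for \<open>s\<close> and for \<open>t\<close>, leaves exactly the five cases.

  Conversely, each of the five sets minimises a potential of the form
  \<open>a z + f (z mod s) + g (z mod t)\<close>, whose total over \<open>X\<close> depends only on the size and the two cores of \<open>X\<close>.
\<close>

section \<open>Sets of beads with finite differences\<close>

text \<open>Flipping \<open>b\<close> changes the size by \<open>- (2 * b + 1)\<close> and is
  invisible modulo \<open>m\<close> exactly when \<open>m dvd 2 * b + 1\<close>. Hence the special
  beads \<open>p\<close>, \<open>r\<close>, \<open>q\<close> with \<open>2 * p + 1 = s\<close>,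
  \<open>2 * r + 1 = t\<close>, \<open>2 * q + 1 = s * t\<close>: putting one of them in place of
  its mirror image adds \<open>s\<close>, \<open>t\<close> or \<open>s * t\<close> to the size, and
  such a bead exists only if that number is odd. Each modulus admits at most one exceptional rise
  (\<open>exc_rise\<close>). The five cases are: none, \<open>p\<close> alone, \<open>r\<close>
  alone, \<open>p\<close> and \<open>r\<close>, or one common to both moduli, which has to be
  \<open>q\<close>. With \<open>p\<close> and \<open>r\<close> both present, flipping both back
  gives a simultaneous core \<open>M\<close>, the beta-set of
  \<open>star s t \<sigma> \<tau>\<close>, and each of the two cores is one flip away from
  \<open>M\<close>. One more bead matters, \<open>d\<close> with
  \<open>2 * d + 1 = s * t - s - t\<close>, where \<open>s * t - s - t\<close> is the largest
  integer not of the form \<open>a * s + b * t\<close> with \<open>a, b \<ge> 0\<close>. Rigidity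
  forces \<open>d\<close> into the core in the common case, where it generates the largest core; its
  absence from \<open>M\<close> is what the uniqueness proof for two flips rests on.\<close>

definition dsum :: "(int \<Rightarrow> int) \<Rightarrow> int set \<Rightarrow> int set \<Rightarrow> int" where
  "dsum f A B = sum f (A - B) - sum f (B - A)"

definition near :: "int set \<Rightarrow> int set \<Rightarrow> bool" where
  "near A B \<longleftrightarrow> finite (A - B) \<and> finite (B - A)"

definition core_set :: "int \<Rightarrow> int set \<Rightarrow> bool" where
  "core_set m A \<longleftrightarrow> (\<forall>b\<in>A. b - m \<in> A)"

text \<open>Quantifying over all \<open>m\<close>-periodic test functions says that \<open>A\<close>
  and \<open>B\<close> have equally many beads in every residue class modulo \<open>m\<close>, which
  for beta-sets means equal \<open>m\<close>-cores. Indicators of classes recover the counts;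
  arbitrary \<open>h\<close> let the relation be checked by substituting congruent
  arguments.\<close>

definition eqv :: "int \<Rightarrow> int set \<Rightarrow> int set \<Rightarrow> bool" where
  "eqv m A B \<longleftrightarrow> near A B \<and> (\<forall>h. (\<forall>b. h (b + m) = h b) \<longrightarrow> dsum h A B = 0)"

definition self_conj :: "int set \<Rightarrow> bool" where
  "self_conj A \<longleftrightarrow> (\<forall>b. b \<in> A \<longleftrightarrow> bar b \<notin> A)"

lemma bar_bar [simp]: "bar (bar b) = b"
  by (simp add: bar_def)

lemma near_refl [simp]: "near A A"
  by (simp add: near_def)

lemma near_sym: "near A B \<Longrightarrow> near B A"
  by (simp add: near_def)

lemma near_trans: "near A B \<Longrightarrow> near B C \<Longrightarrow> near A C"
proof -
  have "A - C \<subseteq> (A - B) \<union> (B - C)" "C - A \<subseteq> (C - B) \<union> (B - A)" by auto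
  then show "near A B \<Longrightarrow> near B C \<Longrightarrow> near A C"
    unfolding near_def by (meson finite_UnI finite_subset)
qed

lemma dsum_window:
  assumes "finite U" "A - B \<subseteq> U" "B - A \<subseteq> U"
  shows "dsum f A B = (\<Sum>x\<in>U. f x * (of_bool (x \<in> A) - of_bool (x \<in> B)))"
proof -
  have "(\<Sum>x\<in>U. f x * (of_bool (x \<in> A) - of_bool (x \<in> B)))
      = (\<Sum>x\<in>U. (if x \<in> A - B then f x else 0) - (if x \<in> B - A then f x else 0))"
    by (intro sum.cong) auto
  also have "\<dots> = sum f (U \<inter> (A - B)) - sum f (U \<inter> (B - A))"
    using assms(1) by (simp only: sum_subtractf sum.inter_restrict)
  also have "U \<inter> (A - B) = A - B" using assms by blast
  also have "U \<inter> (B - A) = B - A" using assms by blast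
  finally show ?thesis by (simp add: dsum_def)
qed

lemma dsum_refl [simp]: "dsum f A A = 0"
  by (simp add: dsum_def)

lemma dsum_sym: "dsum f A B = - dsum f B A"
  by (simp add: dsum_def)

lemma dsum_trans:
  assumes "near A B" "near B C"
  shows "dsum f A C = dsum f A B + dsum f B C"
proof -
  define U where "U = (A - B) \<union> (B - A) \<union> (B - C) \<union> (C - B)"
  have "finite U" using assms by (simp add: U_def near_def)
  have *: "dsum f A C = (\<Sum>x\<in>U. f x * (of_bool (x \<in> A) - of_bool (x \<in> C)))"
    "dsum f A B = (\<Sum>x\<in>U. f x * (of_bool (x \<in> A) - of_bool (x \<in> B)))"
    "dsum f B C = (\<Sum>x\<in>U. f x * (of_bool (x \<in> B) - of_bool (x \<in> C)))"
    by (rule dsum_window; use \<open>finite U\<close> in \<open>auto simp: U_def\<close>)+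
  show ?thesis unfolding * sum.distrib [symmetric]
    by (intro sum.cong) (auto simp: algebra_simps)
qed

lemma dsum_add: "dsum (\<lambda>x. f x + g x) A B = dsum f A B + dsum g A B"
  by (simp add: dsum_def sum.distrib)

lemma dsum_scale: "dsum (\<lambda>x. c * f x) A B = c * dsum f A B"
  by (simp add: dsum_def sum_distrib_left algebra_simps)

lemma dsum_exchange:
  assumes "finite F" "finite G" "F \<subseteq> A" "A \<inter> G = {}"
  shows "dsum f ((A - F) \<union> G) A = sum f G - sum f F" "near ((A - F) \<union> G) A"
proof -
  have "(A - F) \<union> G - A = G" "A - ((A - F) \<union> G) = F" using assms by auto
  then show "dsum f ((A - F) \<union> G) A = sum f G - sum f F" "near ((A - F) \<union> G) A"
    using assms by (auto simp: dsum_def near_def)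
qed

lemma eqv_refl [simp]: "eqv m A A"
  by (simp add: eqv_def)

lemma eqv_sym: "eqv m A B \<Longrightarrow> eqv m B A"
  unfolding eqv_def by (metis add.inverse_neutral dsum_sym near_sym)

lemma eqv_trans: "eqv m A B \<Longrightarrow> eqv m B C \<Longrightarrow> eqv m A C"
  unfolding eqv_def by (metis add_0 dsum_trans near_trans)

text \<open>Comparison through a common reference \<open>M\<close> avoids computing the differences
  of \<open>A\<close> and \<open>B\<close> themselves.\<close>

lemma eqv_common:
  assumes "near A M" "near B M" "\<And>h. \<forall>b. h (b + m) = h b \<Longrightarrow> dsum h A M = dsum h B M"
  shows "eqv m A B"
  unfolding eqv_def
proof (intro conjI allI impI)
  show "near A B" using near_trans[OF assms(1) near_sym[OF assms(2)]] .
  fix h :: "int \<Rightarrow> int" assume "\<forall>b. h (b + m) = h b"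
  then show "dsum h A B = 0"
    using dsum_trans[OF assms(1) near_sym[OF assms(2)], of h] dsum_sym[of h M B] assms(3)[of h] by simp
qed

lemma periodic_cong:
  fixes h :: "int \<Rightarrow> 'a"
  assumes "\<forall>b. h (b + m) = h b" "[a = b] (mod m)"
  shows "h a = h b"
proof -
  have N: "h (b + int k * m) = h b" for k b
  proof (induction k)
    case (Suc k)
    have "b + int (Suc k) * m = (b + int k * m) + m" by (simp add: algebra_simps)
    then show ?case using assms(1) Suc by metis
  qed simp
  obtain k where k: "a = b + k * m"
    using assms(2) by (metis cong_iff_lin cong_sym mult.commute)
  show ?thesis
  proof (cases "k \<ge> 0")
    case True
    then show ?thesis using N[of b "nat k"] k by simp
  next
    case False
    then have "h (a + int (nat (-k)) * m) = h a" using N by blast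
    then show ?thesis using k False by (simp add: algebra_simps)
  qed
qed

lemma core_set_iter:
  assumes "core_set m A" "b \<in> A" "0 \<le> k"
  shows "b - k * m \<in> A"
proof -
  have "b - int n * m \<in> A" for n
  proof (induction n)
    case (Suc n)
    then have "b - int n * m - m \<in> A" using assms(1) by (auto simp: core_set_def)
    then show ?case by (simp add: algebra_simps)
  qed (use assms in simp)
  from this[of "nat k"] show ?thesis using assms(3) by simp
qed

lemma core_set_le:
  assumes "core_set m A" "b \<in> A" "c \<le> b" "[c = b] (mod m)" "m > 0"
  shows "c \<in> A"
proof -
  obtain k where k: "b = c + m * k" using assms(4) by (metis cong_iff_lin)
  have "0 \<le> m * k" using assms(3) k by simp
  then have "0 \<le> k" using assms(5) by (simp add: zero_le_mult_iff)
  from core_set_iter[OF assms(1,2) this] show ?thesis using k by (simp add: mult.commute)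
qed

lemma core_set_below_gap:
  assumes "core_set m A" "m > 0" "z \<in> A" "q \<notin> A" "[z = q] (mod m)"
  shows "z \<le> q - m"
proof -
  obtain k where k: "q = z + m * k" using assms(5) by (metis cong_iff_lin)
  have "\<not> q \<le> z" using core_set_le[OF assms(1,3) _ _ assms(2), of q] assms(4,5) by (auto simp: cong_sym)
  then have "m * k > 0" using k by simp
  then have "k \<ge> 1" using assms(2) by (simp add: zero_less_mult_iff)
  then have "m * 1 \<le> m * k" using assms(2) by (intro mult_left_mono) auto
  then show ?thesis using k by simp
qed

lemma core_set_less_gap:
  assumes "core_set m A" "m > 0" "q \<notin> A" "q - m \<in> A" "[z = q] (mod m)"
  shows "z \<in> A \<longleftrightarrow> z < q"
proof
  show "z \<in> A \<Longrightarrow> z < q" using core_set_below_gap[OF assms(1,2) _ assms(3,5)] assms(2) by simp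
  assume "z < q"
  obtain k where k: "q = z + m * k" using assms(5) by (metis cong_iff_lin)
  then have "m * k > 0" using \<open>z < q\<close> by simp
  then have "k - 1 \<ge> 0" using assms(2) by (simp add: zero_less_mult_iff)
  from core_set_iter[OF assms(1,4) this] show "z \<in> A" using k by (simp add: algebra_simps)
qed

lemma core_set_gap_unique:
  assumes "core_set m A" "m > 0" "c \<notin> A" "c - m \<in> A" "c' \<notin> A" "c' - m \<in> A" "[c = c'] (mod m)"
  shows "c = c'"
  using core_set_less_gap[OF assms(1-4) cong_sym[OF assms(7)]] core_set_less_gap[OF assms(1,2,5-7)]
    assms(3,5) by simp

text \<open>Within the class of \<open>i\<close> both sets are closed under subtracting
  \<open>m\<close>, hence nested; equal counts then force equality. The closure of \<open>X\<close>
  concerns this one class, so \<open>X\<close> may have \<open>m\<close>-rises elsewhere.\<close>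

lemma eqv_no_rise_agree:
  assumes "eqv m X S" "core_set m S" "m > 0"
    and nr: "\<And>b. b \<in> X \<Longrightarrow> [b = i] (mod m) \<Longrightarrow> b - m \<in> X"
    and "[z = i] (mod m)"
  shows "z \<in> X \<longleftrightarrow> z \<in> S"
proof -
  define C where "C = {b. [b = i] (mod m)}"
  have core: "core_set m (X \<inter> C)" "core_set m (S \<inter> C)"
    using nr assms(2)
    by (auto simp: core_set_def C_def cong_diff_iff_cong_0 cong_iff_dvd_diff)
       (metis add_diff_cancel_left' diff_diff_eq2 dvd_add_triv_left_iff add.commute dvd_diff_commute diff_right_commute dvd_refl dvd_diff)+
  have near: "finite (X - S)" "finite (S - X)" using assms(1) by (auto simp: eqv_def near_def)
  have "dsum (\<lambda>b. of_bool (b \<in> C)) X S = 0"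
  proof -
    have "\<forall>b. (of_bool (b + m \<in> C) :: int) = of_bool (b \<in> C)"
      by (auto simp: C_def cong_def)
    then show ?thesis using assms(1) by (simp add: eqv_def)
  qed
  then have c: "card ((X - S) \<inter> C) = card ((S - X) \<inter> C)"
    using near by (simp add: dsum_def of_bool_def sum.If_cases)
  have "X \<inter> C \<subseteq> S \<inter> C \<or> S \<inter> C \<subseteq> X \<inter> C"
  proof (rule ccontr)
    assume "\<not> ?thesis"
    then obtain a b where ab: "a \<in> X \<inter> C" "a \<notin> S \<inter> C" "b \<in> S \<inter> C" "b \<notin> X \<inter> C" by blast
    then have "[a = b] (mod m)" unfolding C_def by (auto intro: cong_trans cong_sym)
    then show False
      using core_set_le[OF core(1), of a b] core_set_le[OF core(2), of b a] ab assms(3)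
      by (metis cong_sym linear)
  qed
  then have "(X - S) \<inter> C = {} \<or> (S - X) \<inter> C = {}" by blast
  then have "(X - S) \<inter> C = {} \<and> (S - X) \<inter> C = {}" using c near
    by (metis card_0_eq card.empty finite_Int)
  then show ?thesis using assms(5) by (auto simp: C_def)
qed

lemma eqv_core_eq:
  assumes "eqv m X S" "core_set m X" "core_set m S" "m > 0"
  shows "X = S"
proof -
  have "z \<in> X \<longleftrightarrow> z \<in> S" for z
    by (rule eqv_no_rise_agree[OF assms(1,3,4), of z]) (use assms(2) in \<open>auto simp: core_set_def\<close>)
  then show ?thesis by blast
qed

section \<open>Rises and drops\<close>

definition balanced :: "int \<Rightarrow> int set \<Rightarrow> bool" where
  "balanced m F \<longleftrightarrow> (\<forall>h::int\<Rightarrow>int. (\<forall>b. h (b + m) = h b) \<longrightarrow> (\<Sum>b\<in>F. h (bar b) - h b) = 0)"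

text \<open>As \<open>bar b - b = - (2 * b + 1)\<close>, the vanishing sum says that flipping
  \<open>F\<close> keeps the size; \<open>balanced\<close> says that it keeps the class
  counts.\<close>

definition rigid :: "int \<Rightarrow> int \<Rightarrow> int set \<Rightarrow> bool" where
  "rigid s t X \<longleftrightarrow> (\<forall>F. finite F \<longrightarrow> F \<subseteq> X \<longrightarrow> balanced s F \<longrightarrow> balanced t F \<longrightarrow>
     (\<Sum>b\<in>F. 2 * b + 1) = 0 \<longrightarrow> F = {})"

lemma rigid_sym: "rigid s t X \<Longrightarrow> rigid t s X"
  unfolding rigid_def by blast

lemma self_conj_bar: "self_conj X \<Longrightarrow> bar b \<in> X \<longleftrightarrow> b \<notin> X"
  unfolding self_conj_def by blast

lemma inj_bar: "inj_on bar A"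
  by (auto simp: inj_on_def bar_def)

lemma flip:
  assumes "self_conj X" "F \<subseteq> X" "finite F"
  defines "Y \<equiv> (X - F) \<union> bar ` F"
  shows "self_conj Y" "near Y X" "dsum f Y X = (\<Sum>b\<in>F. f (bar b) - f b)"
    "F \<noteq> {} \<Longrightarrow> Y \<noteq> X"
proof -
  have d: "X \<inter> bar ` F = {}" using assms by (auto simp: self_conj_bar)
  have "b \<in> Y \<longleftrightarrow> bar b \<notin> Y" for b
  proof -
    have "bar b \<in> bar ` F \<longleftrightarrow> b \<in> F" using inj_bar[of UNIV] by (simp add: inj_image_mem_iff)
    moreover have "b \<in> bar ` F \<longleftrightarrow> bar b \<in> F" by (metis bar_bar image_iff)
    moreover have "\<not> (b \<in> F \<and> bar b \<in> F)" using assms(1,2) self_conj_bar by blast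
    ultimately show ?thesis using assms by (auto simp: self_conj_bar)
  qed
  then show "self_conj Y" unfolding self_conj_def by blast
  show "near Y X" using dsum_exchange(2)[OF assms(3) _ assms(2) d] assms(3) by (simp add: Y_def)
  show "dsum f Y X = (\<Sum>b\<in>F. f (bar b) - f b)"
    using dsum_exchange(1)[OF assms(3) _ assms(2) d, of f] assms(3)
    by (simp add: Y_def sum.reindex[OF inj_bar] sum_subtractf)
  show "F \<noteq> {} \<Longrightarrow> Y \<noteq> X" unfolding Y_def using d by blast
qed

lemma balanced_eqv:
  assumes "self_conj X" "F \<subseteq> X" "finite F" "balanced m F"
  shows "eqv m ((X - F) \<union> bar ` F) X"
  using assms(4) by (simp add: eqv_def flip[OF assms(1-3)] balanced_def)

lemma sum4:
  fixes f :: "'a \<Rightarrow> int"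
  assumes "distinct [a, b, c, d]"
  shows "(\<Sum>x\<in>{a, b, c, d}. f x) = f a + f b + f c + f d"
  using assms by simp

lemma rigidD4:
  assumes "rigid s t X" "a \<in> X" "b \<in> X" "c \<in> X" "d \<in> X"
    and "distinct [a, b, c, d]" "a + b + c + d = -2"
    and "\<And>h::int\<Rightarrow>int. \<forall>b. h (b + s) = h b \<Longrightarrow>
           h (bar a) + h (bar b) + h (bar c) + h (bar d) = h a + h b + h c + h d"
    and "\<And>h::int\<Rightarrow>int. \<forall>b. h (b + t) = h b \<Longrightarrow>
           h (bar a) + h (bar b) + h (bar c) + h (bar d) = h a + h b + h c + h d"
  shows False
proof -
  have "balanced s {a, b, c, d}" "balanced t {a, b, c, d}"
    using assms(8,9) by (auto simp: balanced_def sum4[OF assms(6)] algebra_simps)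
  moreover have "(\<Sum>b\<in>{a, b, c, d}. 2 * b + 1) = 0"
    using assms(7) by (simp only: sum4[OF assms(6)])
  ultimately have "{a, b, c, d} = {}" using assms(1-5)
    by (metis rigid_def empty_subsetI finite.emptyI finite.insertI insert_subset)
  then show False by simp
qed

text \<open>The alternatives are coincidences among the four beads, in this order:
  \<open>b = bar (b - t)\<close>, \<open>c - t = bar c\<close>, \<open>b = bar c\<close>,
  \<open>bar (b - t) = c - t\<close>. The remaining ones, \<open>b = c - t\<close> and
  \<open>bar (b - t) = bar c\<close>, contradict \<open>\<not> s dvd t\<close>, because
  \<open>b\<close> and \<open>c\<close> are congruent modulo \<open>s\<close>. Balance holds modulo
  \<open>t\<close> since subtracting \<open>t\<close> is invisible, and modulo \<open>s\<close>
  since \<open>b\<close> and \<open>c\<close> are interchangeable.\<close>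

lemma rise_drop:
  fixes s t :: int
  assumes "rigid s t X" "self_conj X" "\<not> s dvd t"
    and b: "b \<in> X" "b - t \<notin> X" and c: "c \<notin> X" "c - t \<in> X" and bc: "[b = c] (mod s)"
  shows "2 * b + 1 = t \<or> 2 * c + 1 = t \<or> b + c = -1 \<or> b + c = 2 * t - 1"
proof (rule ccontr)
  assume n: "\<not> ?thesis"
  have nd: "b \<noteq> c - t" "c \<noteq> b - t"
    using bc assms(3) by (auto simp: cong_iff_dvd_diff)
  have "distinct [b, bar (b - t), c - t, bar c]"
    using n nd by (auto simp: bar_def)
  moreover have "bar (b - t) \<in> X" "bar c \<in> X" using assms by (auto simp: self_conj_bar)
  moreover have "h (bar b) + h (bar (bar (b - t))) + h (bar (c - t)) + h (bar (bar c))
      = h b + h (bar (b - t)) + h (c - t) + h (bar c)" if "\<forall>b. h (b + s) = h b" for h :: "int \<Rightarrow> int"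
  proof -
    have "h b = h c" "h (b - t) = h (c - t)" "h (bar b) = h (bar c)" "h (bar (b - t)) = h (bar (c - t))"
      by (rule periodic_cong[OF that], use bc in \<open>auto simp: bar_def cong_iff_dvd_diff dvd_diff_commute\<close>)+
    then show ?thesis by simp
  qed
  moreover have "h (bar b) + h (bar (bar (b - t))) + h (bar (c - t)) + h (bar (bar c))
      = h b + h (bar (b - t)) + h (c - t) + h (bar c)" if "\<forall>b. h (b + t) = h b" for h :: "int \<Rightarrow> int"
  proof -
    have "h b = h (b - t)" "h c = h (c - t)" "h (bar b) = h (bar (b - t))" "h (bar c) = h (bar (c - t))"
      by (rule periodic_cong[OF that], auto simp: bar_def cong_iff_dvd_diff)+
    then show ?thesis by simp
  qed
  ultimately show False
    using rigidD4[OF assms(1), of b "bar (b - t)" "c - t" "bar c"] b c by (simp add: bar_def)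
qed

lemma near_shift:
  assumes "near X {..<0::int}"
  shows "near {b. b - t \<in> X} X"
proof -
  have img: "{b. b - t \<in> A} - {b. b - t \<in> B} = (\<lambda>b. b + t) ` (A - B)" for A B :: "int set"
    by (auto simp: image_iff) (metis Diff_iff diff_add_cancel)
  have "near {b. b - t \<in> X} {b. b - t \<in> {..<0}}"
    using assms by (simp only: near_def img finite_imageI)
  moreover have "near {b. b - t \<in> {..<0}} {..<0::int}"
  proof -
    have "{b. b - t \<in> {..<0}} - {..<0::int} \<subseteq> {0..t}" "{..<0::int} - {b. b - t \<in> {..<0}} \<subseteq> {t..0}"
      by auto
    then show ?thesis unfolding near_def using finite_subset by blast
  qed
  ultimately show ?thesis using assms near_trans near_sym by blast
qed

text \<open>Drops minus rises in a class is the change of its count when \<open>X\<close> is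
  replaced by its translate by \<open>t\<close>. Translation permutes the classes modulo
  \<open>s\<close>, so this change is the same for \<open>S\<close>, and a \<open>t\<close>-core is
  contained in its translate.\<close>

lemma card_rise_le_drop:
  fixes s t i :: int
  assumes "eqv s X S" "core_set t S" "near X {..<0}"
  defines "Ri \<equiv> {b. b \<in> X \<and> b - t \<notin> X \<and> [b = i] (mod s)}"
    and "Dr \<equiv> {b. b \<notin> X \<and> b - t \<in> X \<and> [b = i] (mod s)}"
  shows "finite Ri" "finite Dr" "card Ri \<le> card Dr"
proof -
  define sh where "sh A = {b. b - t \<in> A}" for A :: "int set"
  define C where "C = {b. [b = i] (mod s)}"
  define h :: "int \<Rightarrow> int" where "h b = of_bool (b \<in> C)" for b
  have near: "near X S" using assms by (simp add: eqv_def)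
  have img: "sh A - sh B = (\<lambda>b. b + t) ` (A - B)" for A B
    by (auto simp: sh_def image_iff) (metis Diff_iff diff_add_cancel)
  have near': "near (sh X) (sh S)" using near by (simp add: near_def img)
  have nX: "near (sh X) X" unfolding sh_def using near_shift[OF assms(3)] .
  have nS: "near (sh S) S" using near near' nX near_sym near_trans by blast
  have per: "\<forall>b. h (b + s) = h b" by (auto simp: h_def C_def cong_def)
  have Ri: "Ri = (X - sh X) \<inter> C" and Dr: "Dr = (sh X - X) \<inter> C"
    by (auto simp: Ri_def Dr_def sh_def C_def)
  show fin: "finite Ri" "finite Dr" using nX by (auto simp: near_def Ri Dr)
  have inj: "inj_on (\<lambda>b. b + t) A" for A by (simp add: inj_on_def)
  have "dsum h (sh X) (sh S) = dsum (\<lambda>b. h (b + t)) X S"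
    unfolding dsum_def img by (simp add: sum.reindex[OF inj])
  also have "\<dots> = 0"
  proof -
    have "h (b + s + t) = h (b + t)" for b
      using per[rule_format, of "b + t"] by (simp add: ac_simps)
    then show ?thesis using assms(1) by (simp add: eqv_def)
  qed
  finally have 1: "dsum h (sh X) (sh S) = 0" .
  have 2: "dsum h S X = 0" using eqv_sym[OF assms(1)] per by (simp add: eqv_def)
  have "S - sh S = {}" using assms(2) by (auto simp: core_set_def sh_def)
  then have 3: "dsum h (sh S) S \<ge> 0" unfolding dsum_def by (simp only:) (simp add: h_def sum_nonneg)
  have "dsum h (sh X) X = dsum h (sh X) (sh S) + (dsum h (sh S) S + dsum h S X)"
    using dsum_trans[OF near' near_trans[OF nS near_sym[OF near]]] dsum_trans[OF nS near_sym[OF near]]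
    by simp
  moreover have "dsum h (sh X) X = int (card Dr) - int (card Ri)"
    using nX by (simp add: dsum_def h_def of_bool_def sum.If_cases near_def Ri Dr)
  ultimately show "card Ri \<le> card Dr" using 1 2 3 by linarith
qed

text \<open>The equivalence says that \<open>b0\<close> is the only rise and \<open>bar b0\<close> the only drop in the class of \<open>b0\<close>.\<close>

definition exc_rise :: "int \<Rightarrow> int \<Rightarrow> int set \<Rightarrow> int \<Rightarrow> bool" where
  "exc_rise s t X b0 \<longleftrightarrow> s dvd 2 * b0 + 1 \<and> b0 \<in> X \<and>
     (\<forall>z. [z = b0] (mod s) \<longrightarrow> (z - t \<in> X \<longleftrightarrow> z \<in> X \<and> z \<noteq> b0 \<or> z = bar b0))"

text \<open>The reflection taking \<open>z\<close> to \<open>bar (z - t) = t - 1 - z\<close>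
  permutes the rises and fixes only \<open>2 * z + 1 = t\<close>. For any other rise
  \<open>b\<close>, some drop \<open>c\<close> of its class also avoids
  \<open>2 * c + 1 = t\<close>, and \<open>rise_drop\<close> leaves two positions for it:
  \<open>bar b\<close>, making \<open>b\<close> exceptional, or the position that makes the
  reflected rise exceptional.\<close>

lemma rise_structure:
  fixes s t :: int
  assumes rig: "rigid s t X" and sc: "self_conj X" and nd: "\<not> s dvd t" and "s > 0"
    and core: "eqv s X S" "core_set t S" "near X {..<0}"
    and b: "b \<in> X" "b - t \<notin> X"
  shows "2 * b + 1 = t \<or> exc_rise s t X b \<or> exc_rise s t X (t - 1 - b)"
proof -
  have dual: "b \<in> X \<and> b - t \<notin> X \<longleftrightarrow> t - 1 - b \<in> X \<and> t - 1 - b - t \<notin> X" for b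
    using self_conj_bar[OF sc, of b] self_conj_bar[OF sc, of "b - t"] by (auto simp: bar_def algebra_simps)
  have A: "exc_rise s t X b" if b: "b \<in> X" "b - t \<notin> X" "2 * b + 1 \<noteq> t"
    and c: "c \<notin> X" "c - t \<in> X" "[c = b] (mod s)" "b + c = -1" for b c
  proof -
    have d: "s dvd 2 * b + 1"
    proof -
      have "s dvd (c - b)" using c(3) by (simp add: cong_iff_dvd_diff)
      moreover have "c - b = - (2 * b + 1)" using c(4) by simp
      ultimately show ?thesis by (metis dvd_minus_iff)
    qed
    have cb: "c = bar b" using c(4) by (simp add: bar_def)
    have n2: "\<not> s dvd 2 * t" 
    proof
      assume "s dvd 2 * t"
      moreover have "odd s" using d by (metis dvd_trans dvd_triv_left even_plus_one_iff)
      ultimately show False using nd by (metis coprime_commute coprime_dvd_mult_right_iff coprime_left_2_iff_odd)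
    qed
    \<comment> \<open>Once \<open>s dvd 2 * b + 1\<close>, the other three coincidences of
      \<open>rise_drop\<close> would give \<open>s dvd t\<close> or \<open>s dvd 2 * t\<close> in
      this class. So each rise is the mirror image of each drop, which leaves only one of
      both.\<close>
    have e: "b' + c' = -1" if "b' \<in> X" "b' - t \<notin> X" "c' \<notin> X" "c' - t \<in> X" "[b' = b] (mod s)" "[c' = b] (mod s)" for b' c'
    proof -
      have nt: "2 * z + 1 \<noteq> t" if "[z = b] (mod s)" for z
      proof
        assume "2 * z + 1 = t"
        then have "t = (2 * b + 1) + 2 * (z - b)" by simp
        then show False using d that nd unfolding cong_iff_dvd_diff by (metis dvd_add dvd_mult)
      qed
      have "b' + c' \<noteq> 2 * t - 1"
      proof
        assume "b' + c' = 2 * t - 1"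
        then have "2 * t = (2 * b + 1) + (b' - b) + (c' - b)" by simp
        then show False using d that n2 unfolding cong_iff_dvd_diff by (metis dvd_add)
      qed
      then show ?thesis
        using rise_drop[OF rig sc nd that(1-4)] nt that(5,6) by (metis cong_sym cong_trans)
    qed
    have "z - t \<in> X \<longleftrightarrow> z \<in> X \<and> z \<noteq> b \<or> z = bar b" if z: "[z = b] (mod s)" for z
    proof (cases "z \<in> X")
      case True
      have "z - t \<notin> X \<Longrightarrow> z = b" using e[OF True _ c(1,2) z c(3)] c(4) by simp
      then show ?thesis using True b(2) cb c(1) by blast
    next
      case False
      have "z - t \<in> X \<Longrightarrow> z = bar b" using e[OF b(1,2) False _ _ z] by (simp add: bar_def)
      then show ?thesis using False cb c(2) by blast
    qed
    then show ?thesis using d b by (simp add: exc_rise_def)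
  qed
  show ?thesis
  proof (cases "2 * b + 1 = t")
    case False
    define Ri where "Ri = {z. z \<in> X \<and> z - t \<notin> X \<and> [z = b] (mod s)}"
    define Dr where "Dr = {z. z \<notin> X \<and> z - t \<in> X \<and> [z = b] (mod s)}"
    have cd: "finite Ri" "finite Dr" "card Ri \<le> card Dr"
      unfolding Ri_def Dr_def using card_rise_le_drop[OF core] by blast+
    have "b \<in> Ri" using b by (simp add: Ri_def)
    then have "card Ri > 0" using cd card_gt_0_iff by blast
    then have "Dr \<noteq> {}" using cd by auto
    \<comment> \<open>If every drop sat at \<open>2 * c + 1 = t\<close>, there would be one drop,
      hence one rise; but then \<open>b\<close> and \<open>t - 1 - b\<close> are both rises of this
      class and must be equal.\<close>
    have "\<exists>c\<in>Dr. 2 * c + 1 \<noteq> t"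
    proof (rule ccontr)
      assume "\<not> ?thesis"
      then have all: "\<And>c. c \<in> Dr \<Longrightarrow> 2 * c + 1 = t" by blast
      obtain c where c: "c \<in> Dr" using \<open>Dr \<noteq> {}\<close> by blast
      have "z = c" if "z \<in> Dr" for z using all[OF that] all[OF c] by simp
      then have "Dr \<subseteq> {c}" by blast
      then have "card Dr \<le> 1" using card_mono[of "{c}" Dr] by simp
      then have one: "card Ri = 1" using cd \<open>card Ri > 0\<close> by linarith
      have "t - 1 - b \<in> Ri"
      proof -
        have "t - 1 - b - b = t - (2 * c + 1) + 2 * (c - b)" by simp
        moreover have "s dvd 2 * (c - b)" using c by (intro dvd_mult) (simp add: Dr_def cong_iff_dvd_diff)
        ultimately have "[t - 1 - b = b] (mod s)" using all[OF c] unfolding cong_iff_dvd_diff by (metis add_0 diff_self)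
        then show ?thesis using dual b by (auto simp: Ri_def)
      qed
      then have "t - 1 - b = b" using one \<open>b \<in> Ri\<close> by (metis card_1_singletonE singletonD)
      then show False using False by simp
    qed
    then obtain c where c: "c \<in> Dr" "2 * c + 1 \<noteq> t" by blast
    then have "b + c = -1 \<or> b + c = 2 * t - 1"
      using rise_drop[OF rig sc nd b, of c] False by (auto simp: Dr_def cong_sym)
    then show ?thesis
    proof
      assume "b + c = -1"
      then show ?thesis using A[OF b False, of c] c by (auto simp: Dr_def)
    next
      assume bc: "b + c = 2 * t - 1"
      have dd: "t - 1 - c \<notin> X \<and> t - 1 - c - t \<in> X"
        using c self_conj_bar[OF sc, of c] self_conj_bar[OF sc, of "c - t"] by (auto simp: bar_def algebra_simps Dr_def)
      have cg: "[t - 1 - c = t - 1 - b] (mod s)" using c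
        by (auto simp: Dr_def cong_iff_dvd_diff dvd_diff_commute)
      have "exc_rise s t X (t - 1 - b)"
        by (rule A[of _ "t - 1 - c"]) (use dual b False bc dd cg in auto)
      then show ?thesis by blast
    qed
  qed simp
qed

lemma near_negatives_bound:
  assumes "near A {..<0::int}"
  obtains N where "N > 0" "\<And>b. b \<ge> N \<Longrightarrow> b \<notin> A" "\<And>b. b < - N \<Longrightarrow> b \<in> A"
proof -
  have "finite (A - {..<0})" "finite ({..<0} - A)" using assms by (auto simp: near_def)
  then have "finite (insert 0 (abs ` ((A - {..<0}) \<union> ({..<0} - A))))" by simp
  then obtain M where M: "\<And>b. b \<in> (A - {..<0}) \<union> ({..<0} - A) \<Longrightarrow> \<bar>b\<bar> \<le> M"
    using Max_ge by (metis imageI insertI2)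
  show ?thesis
  proof (rule that[of "\<bar>M\<bar> + 1"])
    fix b
    show "b \<notin> A" if b: "b \<ge> \<bar>M\<bar> + 1"
    proof
      assume "b \<in> A"
      moreover have "\<not> b < 0" using b by linarith
      ultimately have "\<bar>b\<bar> \<le> M" by (intro M) simp
      then show False using b by linarith
    qed
    show "b \<in> A" if b: "b < - (\<bar>M\<bar> + 1)"
    proof (rule ccontr)
      assume "b \<notin> A"
      moreover have "b < 0" using b by linarith
      ultimately have "\<bar>b\<bar> \<le> M" by (intro M) simp
      then show False using b by linarith
    qed
  qed simp
qed

lemma first_gap:
  assumes "near S {..<0::int}" "t > 0"
  obtains c where "[c = p] (mod t)" "c \<notin> S" "c - t \<in> S"
proof -
  obtain N where N: "N > 0" "\<And>b. b \<ge> N \<Longrightarrow> b \<notin> S" "\<And>b. b < - N \<Longrightarrow> b \<in> S"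
    using near_negatives_bound[OF assms(1)] by blast
  define a where "a = p - (\<bar>p\<bar> + N + 1) * t"
  have le: "x \<le> x * t" if "x \<ge> 0" for x using that assms(2) by (simp add: mult_le_cancel_left1)
  have "a \<in> S" unfolding a_def using le[of "\<bar>p\<bar> + N + 1"] N(1) by (intro N(3)) linarith
  define P where "P n \<longleftrightarrow> a + int n * t \<notin> S" for n
  have "P (nat (N + \<bar>a\<bar>))"
    unfolding P_def using le[of "N + \<bar>a\<bar>"] N(1) by (intro N(2)) auto
  then have L: "P (Least P)" by (rule LeastI)
  have nz: "Least P \<noteq> 0" using L \<open>a \<in> S\<close> unfolding P_def by (metis add.right_neutral mult_zero_left of_nat_0)
  define c where "c = a + int (Least P) * t"
  have c1: "[c = p] (mod t)" by (simp add: c_def a_def cong_iff_dvd_diff)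
  have c2: "c \<notin> S" using L by (simp add: P_def c_def)
  have "\<not> P (Least P - 1)" using nz by (intro not_less_Least) simp
  then have c3: "c - t \<in> S" using nz by (simp add: P_def c_def of_nat_diff algebra_simps)
  show ?thesis using that c1 c2 c3 by blast
qed

text \<open>\<open>c\<close> is the first gap of its class and, by self-conjugacy,
  \<open>bar c\<close> is the last bead of its class. Filling the one and removing the other leaves
  both classes initial segments; the assumption on \<open>p\<close> keeps the two classes apart, so
  that the moves do not interfere.\<close>

lemma add_bead:
  assumes "core_set t S" "self_conj S" "near S {..<0::int}" "t > 0" "\<not> [p = bar p] (mod t)"
  obtains c where "[c = p] (mod t)" "c \<notin> S" "c - t \<in> S" "core_set t ((S - {bar c}) \<union> {c})"
proof -
  obtain c where c1: "[c = p] (mod t)" and c2: "c \<notin> S" and c3: "c - t \<in> S"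
    using first_gap[OF assms(3,4)] by blast
  have ncb: "\<not> [c = bar c] (mod t)"
  proof
    assume a: "[c = bar c] (mod t)"
    have "[bar c = bar p] (mod t)" using c1 by (simp add: bar_def cong_iff_dvd_diff dvd_diff_commute)
    then show False using a c1 assms(5) by (metis cong_sym cong_trans)
  qed
  have "core_set t ((S - {bar c}) \<union> {c})"
    unfolding core_set_def
  proof
    fix b assume b: "b \<in> (S - {bar c}) \<union> {c}"
    show "b - t \<in> (S - {bar c}) \<union> {c}"
    proof (cases "b = c")
      case True
      have "c - t \<noteq> bar c" 
      proof
        assume "c - t = bar c"
        then have "c - bar c = t" by simp
        then show False using ncb by (simp add: cong_iff_dvd_diff)
      qed
      then show ?thesis using True c3 by blast
    next
      case False
      then have "b \<in> S" "b \<noteq> bar c" using b by auto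
      have "b - t \<noteq> bar c"
      proof
        assume "b - t = bar c"
        then have "bar b = c - t" by (simp add: bar_def)
        then show False using \<open>b \<in> S\<close> c3 assms(2) self_conj_bar by metis
      qed
      then show ?thesis using \<open>b \<in> S\<close> assms(1) by (auto simp: core_set_def)
    qed
  qed
  then show ?thesis using that c1 c2 c3 by blast
qed

text \<open>As \<open>s\<close> is odd, \<open>s dvd 2 * b + 1\<close> describes a single class,
  that of \<open>p\<close>: the one class modulo \<open>s\<close> that \<open>bar\<close> maps to
  itself.\<close>

lemma self_dual_class:
  fixes s :: int
  assumes "2 * p + 1 = s" "s dvd 2 * b + 1"
  obtains k where "b = p + k * s"
proof -
  have "2 * b + 1 = s + 2 * (b - p)" using assms(1) by simp
  then have "s dvd 2 * (b - p)" using assms(2) by (metis dvd_add_triv_left_iff)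
  moreover have "odd s" using assms(1) by presburger
  ultimately have "s dvd b - p"
    by (metis coprime_commute coprime_dvd_mult_right_iff coprime_left_2_iff_odd)
  then obtain k where "b - p = s * k" by (elim dvdE)
  then show ?thesis by (intro that[of k]) (simp add: algebra_simps)
qed

lemma bar_neq [simp]: "bar b \<noteq> b" "b \<noteq> bar b"
  by (auto simp: bar_def) presburger+

text \<open>Here \<open>q - m\<close> is the mirror image of \<open>q\<close>, so a core cannot
  contain \<open>q\<close> without containing both.\<close>

lemma half_notin_core:
  assumes "core_set m A" "self_conj A" "2 * q + 1 = m"
  shows "q \<notin> A"
proof
  assume "q \<in> A"
  then have "q - m \<in> A" using assms by (auto simp: core_set_def)
  moreover have "q - m = bar q" using assms(3) by (simp add: bar_def)
  ultimately show False using assms(2) \<open>q \<in> A\<close> self_conj_bar by metis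
qed

section \<open>Exceptional rises of a rigid set\<close>

locale coprime_pair =
  fixes s t :: int
  assumes s1: "s > 1" and t1: "t > 1" and cop: "coprime s t"

locale core_pair = coprime_pair +
  fixes S T :: "int set"
  assumes scS: "self_conj S" and scT: "self_conj T"
    and sS: "core_set s S" and tS: "core_set t S" and sT: "core_set s T" and tT: "core_set t T"
    and nS: "near S {..<0}" and nT: "near T {..<0}"
begin

lemma nst: "\<not> s dvd t" and nts: "\<not> t dvd s"
proof -
  show "\<not> s dvd t"
  proof
    assume "s dvd t"
    then have "is_unit s" using cop coprime_absorb_left by blast
    then show False using s1 by simp
  qed
  show "\<not> t dvd s"
  proof
    assume "t dvd s"
    then have "is_unit t" using cop coprime_absorb_right by blast
    then show False using t1 by simp
  qed
qed

lemma swap: "core_pair t s T S"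
  using s1 t1 cop scS scT sS tS sT tT nS nT
  by (simp add: core_pair_def core_pair_axioms_def coprime_pair_def coprime_commute)

lemma not_in_core: "2 * p + 1 = s \<Longrightarrow> p \<notin> S" "2 * p + 1 = s \<Longrightarrow> p \<notin> T"
  "2 * r + 1 = t \<Longrightarrow> r \<notin> S" "2 * r + 1 = t \<Longrightarrow> r \<notin> T"
  using half_notin_core sS sT tS tT scS scT by blast+

end

text \<open>The assumptions are symmetric under exchanging \<open>s\<close> with \<open>t\<close>
  and \<open>S\<close> with \<open>T\<close>; through \<open>swap_rigid\<close> every lemma below is
  available for either modulus.\<close>

locale rigid_pair = core_pair s t S T for s t :: int and X S T :: "int set" +
  assumes rig: "rigid s t X" and scX: "self_conj X" and XS: "eqv s X S" and XT: "eqv t X T"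
    and nX: "near X {..<0}"
begin

lemma swap_rigid: "rigid_pair t s X T S"
  using swap rigid_sym[OF rig] scX XS XT nX by (simp add: rigid_pair_def rigid_pair_axioms_def)

lemma t_rise:
  assumes "b \<in> X" "b - t \<notin> X"
  shows "2 * b + 1 = t \<or> exc_rise s t X b \<or> exc_rise s t X (t - 1 - b)"
  using rise_structure[OF rig scX nst _ XS tS nX assms] s1 by simp

lemmas s_rise = rigid_pair.t_rise[OF swap_rigid]

lemma exc_odd: "exc_rise s t X b \<Longrightarrow> \<exists>p. 2 * p + 1 = s"
  unfolding exc_rise_def by (metis dvd_trans dvd_triv_left even_plus_one_iff oddE)

text \<open>Exceptional rises lie in the self-dual class, and the equivalence in
  \<open>exc_rise\<close> leaves no other rise there.\<close>

lemma exc_unique: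
  assumes "exc_rise s t X b" "exc_rise s t X c"
  shows "b = c"
proof -
  obtain p where p: "2 * p + 1 = s" using exc_odd assms by blast
  obtain k l where k: "b = p + k * s" "c = p + l * s"
    using self_dual_class[OF p] assms unfolding exc_rise_def by metis
  have "[c = b] (mod s)" using k by (simp add: cong_iff_dvd_diff)
  moreover have "c \<in> X" "c - t \<notin> X" using assms(2) by (auto simp: exc_rise_def)
  ultimately show ?thesis using assms(1) by (auto simp: exc_rise_def)
qed

text \<open>Indexing the self-dual class by \<open>j\<close> turns \<open>bar\<close> into
  \<open>j\<close> to \<open>- 1 - j\<close>. The row of \<open>p - t\<close> is not a self-dual
  class, but it differs from the row of \<open>p\<close> only by moving the bead at \<open>k\<close>
  to \<open>- 1 - k\<close>, and so inherits the same symmetry in \<open>j\<close>.\<close>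

lemma exc_row:
  assumes exc: "exc_rise s t X b" and p: "2 * p + 1 = s"
  obtains k where "b = p + k * s" "p + k * s \<in> X" "p + (- 1 - k) * s \<notin> X"
    "\<And>j. p + j * s - t \<in> X \<longleftrightarrow> p + j * s \<in> X \<and> j \<noteq> k \<or> j = -1 - k"
    "\<And>j. p + (- 1 - j) * s - t \<in> X \<longleftrightarrow> p + j * s - t \<notin> X"
proof -
  obtain k where k: "b = p + k * s" using self_dual_class[OF p] exc unfolding exc_rise_def by metis
  have barj: "bar (p + j * s) = p + (- 1 - j) * s" for j using p by (simp add: bar_def algebra_simps)
  have inj: "p + i * s = p + j * s \<longleftrightarrow> i = j" for i j using s1 by simp
  have cl: "[p + j * s = b] (mod s)" for j by (simp add: k cong_iff_dvd_diff)
  have Q: "p + j * s - t \<in> X \<longleftrightarrow> p + j * s \<in> X \<and> j \<noteq> k \<or> j = -1 - k" for j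
    using exc cl[of j] unfolding exc_rise_def by (metis barj inj k)
  have P: "p + (- 1 - j) * s \<in> X \<longleftrightarrow> p + j * s \<notin> X" for j
    using self_conj_bar[OF scX, of "p + j * s"] barj by simp
  have Pk: "p + k * s \<in> X" using exc k by (simp add: exc_rise_def)
  have Pk': "p + (- 1 - k) * s \<notin> X" using P[of k] Pk by simp
  have Qsc: "p + (- 1 - j) * s - t \<in> X \<longleftrightarrow> p + j * s - t \<notin> X" for j
  proof -
    have "- 1 - j \<noteq> k \<longleftrightarrow> j \<noteq> - 1 - k" "- 1 - j = - 1 - k \<longleftrightarrow> j = k" "k \<noteq> - 1 - k" by presburger+
    then show ?thesis unfolding Q P using Pk Pk' by metis
  qed
  show ?thesis using that k Pk Pk' Q Qsc by blast
qed

text \<open>If the row of \<open>p - t\<close> failed to be an initial segment, it would contain an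
  \<open>s\<close>-rise and, by its symmetry, a second one, while at most one exceptional rise is
  available for both. Hence this row is \<open>j < 0\<close>, and the row of \<open>p\<close> arises
  from it by moving the bead at \<open>- 1 - k\<close> to \<open>k\<close>.\<close>

lemma row_shape:
  assumes exc: "exc_rise s t X b" and p: "2 * p + 1 = s"
  obtains k where "b = p + k * s" "k \<ge> 0" "\<And>j. p + j * s - t \<in> X \<longleftrightarrow> j < 0"
    "\<And>j. p + j * s \<in> X \<longleftrightarrow> j = k \<or> j < 0 \<and> j \<noteq> -1 - k"
proof -
  obtain k where k: "b = p + k * s" and Pk: "p + k * s \<in> X" "p + (- 1 - k) * s \<notin> X"
    and Q: "\<And>j. p + j * s - t \<in> X \<longleftrightarrow> p + j * s \<in> X \<and> j \<noteq> k \<or> j = -1 - k"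
    and Qsc: "\<And>j. p + (- 1 - j) * s - t \<in> X \<longleftrightarrow> p + j * s - t \<notin> X"
    using exc_row[OF exc p] by blast
  have step: "p + (j - 1) * s - t \<in> X" if j: "p + j * s - t \<in> X" for j
  proof (rule ccontr)
    assume nj: "p + (j - 1) * s - t \<notin> X"
    have one: "exc_rise t s X z \<or> exc_rise t s X (s - 1 - z)"
      if "z = p + i * s - t" "p + i * s - t \<in> X" "p + (i - 1) * s - t \<notin> X" for z i
    proof -
      have "z - s = p + (i - 1) * s - t" using that(1) by (simp add: algebra_simps)
      then have z: "z \<in> X" "z - s \<notin> X" using that(2,3) by (simp_all only: that(1) not_False_eq_True)
      have "2 * z + 1 \<noteq> s"
      proof
        assume "2 * z + 1 = s"
        then have "i * s = t" using that p by simp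
        then show False using nst by (metis dvd_triv_right)
      qed
      then show ?thesis using s_rise[OF z] by blast
    qed
    \<comment> \<open>The symmetry of the row turns the \<open>s\<close>-rise at index
      \<open>j\<close> into one at index \<open>- j\<close>.\<close>
    have dj: "p + (- j) * s - t \<in> X" "p + (- j - 1) * s - t \<notin> X"
      using Qsc[of "j - 1"] nj Qsc[of j] j by (auto simp: algebra_simps)
    define z where "z = p + j * s - t"
    define z' where "z' = p + (- j) * s - t"
    have "exc_rise t s X z \<or> exc_rise t s X (s - 1 - z)"
      "exc_rise t s X z' \<or> exc_rise t s X (s - 1 - z')"
      using one[OF z_def j nj] one[OF z'_def dj] by auto
    then have "z' = z \<or> z' = s - 1 - z"
      using rigid_pair.exc_unique[OF swap_rigid] by (smt (verit))
    \<comment> \<open>Since \<open>z + z' = 2 * p - 2 * t = s - 1 - 2 * t\<close>, the two rises are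
      not reflections of each other.\<close>
    moreover have "z' \<noteq> s - 1 - z" using p t1 by (simp add: z_def z'_def)
    ultimately have "z' = z" by blast
    then have "j * s = 0" by (simp add: z_def z'_def)
    then have zz: "z = p - t" by (simp add: z_def)
    have "t dvd 2 * z + 1 \<or> t dvd 2 * (s - 1 - z) + 1"
      using \<open>exc_rise t s X z \<or> _\<close> by (auto simp: exc_rise_def)
    moreover have "2 * z + 1 = s - 2 * t" "2 * (s - 1 - z) + 1 = s + 2 * t" using p zz by simp_all
    ultimately have "t dvd s - 2 * t \<or> t dvd s + 2 * t" by metis
    then show False using nts by (metis dvd_add_left_iff dvd_diff_left_iff dvd_triv_right)
  qed
  have down: "p + i * s - t \<in> X" if "p + j * s - t \<in> X" "i \<le> j" for i j
  proof -
    have "p + (j - int n) * s - t \<in> X" for n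
    proof (induction n)
      case (Suc n)
      have "j - int (Suc n) = j - int n - 1" by simp
      then show ?case using step[OF Suc] by (simp only:)
    qed (use that in simp)
    from this[of "nat (j - i)"] that(2) show ?thesis by simp
  qed
  have "p + 0 * s - t \<notin> X" using down[of 0 "-1"] Qsc[of 0] by auto
  then have "p + (- 1) * s - t \<in> X" using Qsc[of 0] by simp
  have Qj: "p + j * s - t \<in> X \<longleftrightarrow> j < 0" for j
    using down[of j 0] \<open>p + 0 * s - t \<notin> X\<close> down[OF \<open>p + (- 1) * s - t \<in> X\<close>, of j]
    by (metis linorder_not_less zle_diff1_eq diff_0)
  have "- 1 - k < 0" using Q[of "-1 - k"] Qj[of "-1 - k"] by simp
  then have k0: "k \<ge> 0" by simp
  have "p + j * s \<in> X \<longleftrightarrow> j = k \<or> j < 0 \<and> j \<noteq> -1 - k" for j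
    using Q[of j] Qj[of j] Pk by (cases "j = k"; cases "j = - 1 - k") auto
  then show ?thesis using that k k0 Qj by blast
qed

text \<open>For \<open>k > 0\<close> the index \<open>k - 1\<close> is a gap, so \<open>b\<close> is
  an \<open>s\<close>-rise as well and the structure of rises applies with the moduli
  exchanged.\<close>

lemma exc_cases:
  assumes exc: "exc_rise s t X b"
  shows "2 * b + 1 = s \<or> exc_rise t s X b"
proof -
  obtain p where p: "2 * p + 1 = s" using exc_odd[OF exc] by blast
  obtain k where k: "b = p + k * s" "k \<ge> 0"
    and P: "\<And>j. p + j * s \<in> X \<longleftrightarrow> j = k \<or> j < 0 \<and> j \<noteq> -1 - k"
    using row_shape[OF exc p] by blast
  show ?thesis
  proof (cases "k = 0")
    case True
    then show ?thesis using k p by simp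
  next
    case False
    then have "p + k * s \<in> X" "p + (k - 1) * s \<notin> X" using P[of k] P[of "k - 1"] k by auto
    then have "b \<in> X" "b - s \<notin> X" using k by (auto simp: algebra_simps)
    \<comment> \<open>The reflected rise would need a bead at index \<open>k - 2\<close>, which
      forces \<open>k = 1\<close>; then \<open>t\<close> would divide \<open>s\<close>.\<close>
    moreover have "\<not> exc_rise t s X (s - 1 - b)"
    proof
      assume e: "exc_rise t s X (s - 1 - b)"
      define c where "c = s - 1 - b"
      have c: "c = p - k * s" using k p by (simp add: c_def)
      have bc: "bar c = p + (k - 1) * s" using p by (simp add: bar_def c algebra_simps)
      have "t dvd 2 * c + 1" using e by (simp add: exc_rise_def c_def)
      moreover have "bar c - c = - (2 * c + 1)" by (simp add: bar_def)
      ultimately have "[bar c = c] (mod t)" unfolding cong_iff_dvd_diff by (metis dvd_minus_iff)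
      then have "bar c - s \<in> X" using e by (simp add: exc_rise_def c_def)
      moreover have "bar c - s = p + (k - 2) * s" by (simp add: bc algebra_simps)
      ultimately have "k = 1" using P[of "k - 2"] k False by auto
      then have "2 * c + 1 = - s" using p c by simp
      then show False using \<open>t dvd 2 * c + 1\<close> nts by simp
    qed
    ultimately show ?thesis using s_rise[of b] by blast
  qed
qed

text \<open>A rise could then sit only at half its step. Its class for the other modulus contains no
  rise of that modulus, so \<open>X\<close> agrees there with a core, and by
  \<open>not_in_core\<close> the half is not a bead of that core.\<close>

lemma no_exc:
  assumes "\<nexists>b. exc_rise s t X b" "\<nexists>b. exc_rise t s X b"
  shows "X = S" "X = T"
proof -
  have *: "core_set b X" if rp: "rigid_pair a b X A B" 
      and n: "\<nexists>z. exc_rise a b X z" "\<nexists>z. exc_rise b a X z" for a b A B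
  proof -
    interpret R: rigid_pair a b X A B by (rule rp)
    have "z - b \<in> X" if z: "z \<in> X" for z
    proof (rule ccontr)
      assume nz: "z - b \<notin> X"
      then have zb: "2 * z + 1 = b" using R.t_rise[OF z nz] n by blast
      have "y - a \<in> X" if y: "y \<in> X" "[y = z] (mod a)" for y
      proof (rule ccontr)
        assume "y - a \<notin> X"
        then have "2 * y + 1 = a" using R.s_rise[OF y(1)] n by blast
        then have "b = a - 2 * (y - z)" using zb by simp
        then show False using y(2) R.nst unfolding cong_iff_dvd_diff by (metis dvd_diff dvd_mult dvd_refl)
      qed
      then have "z \<in> A" using eqv_no_rise_agree[OF R.XS R.sS, of z z] z R.s1 by auto
      then show False using R.not_in_core(3)[OF zb] by blast
    qed
    then show ?thesis by (simp add: core_set_def)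
  qed
  show "X = S" using eqv_core_eq[OF XS _ sS] *[OF swap_rigid] assms s1 by simp
  show "X = T" using eqv_core_eq[OF XT _ tT] *[OF rigid_pair_axioms] assms t1 by simp
qed

end

section \<open>Recovering the two cores by flipping exceptional rises back\<close>

lemma flip_single:
  assumes "self_conj X" "x \<in> X"
  defines "Y \<equiv> (X - {x}) \<union> {bar x}"
  shows "self_conj Y" "near Y X" "dsum f Y X = f (bar x) - f x"
  using flip[OF assms(1), of "{x}"] assms(2) by (simp_all add: Y_def)

lemma flip_back:
  assumes "self_conj X" "x \<in> X" "Y = (X - {x}) \<union> {bar x}"
  shows "X = (Y - {bar x}) \<union> {x}" "bar x \<in> Y" "x \<notin> Y"
  using assms self_conj_bar[OF assms(1), of x] by auto

lemma double_flip:
  assumes "self_conj M" "p \<notin> M" "r \<notin> M" "p \<noteq> r" and L: "L = (M - {bar p, bar r}) \<union> {p, r}"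
  shows "self_conj L" "near L M" "dsum f L M = f p + f r - f (bar p) - f (bar r)"
proof -
  have sub: "{bar p, bar r} \<subseteq> M" using assms by (auto simp: self_conj_bar)
  have L': "L = (M - {bar p, bar r}) \<union> bar ` {bar p, bar r}" by (simp add: L)
  have "bar p \<noteq> bar r" using assms(4) by (metis bar_bar)
  then show "self_conj L" "near L M" "dsum f L M = f p + f r - f (bar p) - f (bar r)"
    unfolding L' using flip(1,2,3)[OF assms(1) sub] by simp_all
qed

lemma flip_eqv_self_dual:
  assumes "self_conj X" "x \<in> X" "m dvd 2 * x + 1"
  shows "eqv m ((X - {x}) \<union> {bar x}) X"
proof -
  have "x - bar x = 2 * x + 1" by (simp add: bar_def)
  then have "[bar x = x] (mod m)" using assms(3) unfolding cong_iff_dvd_diff by (metis dvd_diff_commute)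
  then have "\<And>h::int\<Rightarrow>int. \<forall>b. h (b + m) = h b \<Longrightarrow> h (bar x) = h x" using periodic_cong by blast
  then show ?thesis using flip_single[OF assms(1,2)] by (simp add: eqv_def)
qed

text \<open>New rises could appear only above the removed bead \<open>x\<close> or at the added bead
  \<open>bar x\<close>. The gap at \<open>x + m\<close> rules out the first and, mirrored, is a bead
  at \<open>bar x - m\<close>, which rules out the second. Rises at \<open>x\<close> and at its
  reflection \<open>m - 1 - x\<close> disappear, which is how a flip repairs a core.\<close>

lemma flip_rises:
  assumes "self_conj X" "x \<in> X" "x + m \<notin> X" "2 * x + 1 \<noteq> - m"
    and Y: "Y = (X - {x}) \<union> {bar x}" and b: "b \<in> Y" "b - m \<notin> Y"
  shows "b \<in> X" "b - m \<notin> X" "b \<noteq> x" "b \<noteq> m - 1 - x"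
proof -
  have "bar x - m \<in> Y"
  proof -
    have "bar (x + m) = bar x - m" by (simp add: bar_def)
    then have "bar x - m \<in> X" using assms(1,3) by (metis self_conj_bar)
    moreover have "bar x - m \<noteq> x" using assms(4) by (auto simp: bar_def)
    ultimately show ?thesis by (simp add: Y)
  qed
  then have "b \<noteq> bar x" using b by auto
  then show "b \<in> X" "b \<noteq> x" using b Y by auto
  then have "b - m \<noteq> x" using assms(3) by (metis diff_add_cancel)
  then show "b - m \<notin> X" using b Y by auto
  have "b - m \<noteq> bar x" using b Y by auto
  then show "b \<noteq> m - 1 - x" by (auto simp: bar_def)
qed

context rigid_pair
begin

lemma s_rise_cases:
  assumes "z \<in> X" "z - s \<notin> X"
  shows "2 * z + 1 = s \<or> (\<exists>c. exc_rise t s X c \<and> (z = c \<or> z = s - 1 - c))"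
  using s_rise[OF assms] by (metis add_diff_cancel_left' diff_add_cancel)

lemma not_cong_bar: "2 * p + 1 = s \<Longrightarrow> \<not> [p = bar p] (mod t)"
proof
  assume p: "2 * p + 1 = s" and "[p = bar p] (mod t)"
  then have "t dvd p - bar p" by (simp add: cong_iff_dvd_diff)
  moreover have "p - bar p = s" using p by (simp add: bar_def)
  ultimately show False using nts by simp
qed

text \<open>Class counts modulo \<open>t\<close> see only the class of a moved bead. So moving
  \<open>bar p\<close> to \<open>p\<close> counts like the flip at the first gap \<open>c\<close>
  congruent to \<open>p\<close>, and the latter stays a \<open>t\<close>-core.\<close>

lemma core_from_flip:
  assumes M: "core_set t M" "self_conj M" "near M {..<0}" and p: "2 * p + 1 = s" "bar p \<in> M"
    and e: "eqv t ((M - {bar p}) \<union> {p}) T"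
  obtains c where "[c = p] (mod t)" "c \<notin> M" "T = (M - {bar c}) \<union> {c}"
proof -
  obtain c where c: "[c = p] (mod t)" "c \<notin> M" "core_set t ((M - {bar c}) \<union> {c})"
    using add_bead[OF M _ not_cong_bar[OF p(1)]] t1 by auto
  define A where "A = (M - {bar p}) \<union> {p}"
  define B where "B = (M - {bar c}) \<union> {c}"
  have bc: "bar c \<in> M" using c(2) M(2) by (simp add: self_conj_bar)
  have A: "near A M" "\<And>f. dsum f A M = f p - f (bar p)"
    using flip_single[OF M(2) p(2)] by (simp_all add: A_def)
  have B: "near B M" "\<And>f. dsum f B M = f c - f (bar c)"
    using flip_single[OF M(2) bc] by (simp_all add: B_def)
  have "eqv t B A"
  proof (rule eqv_common[OF B(1) A(1)])
    fix h :: "int \<Rightarrow> int" assume h: "\<forall>b. h (b + t) = h b"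
    have "[bar c = bar p] (mod t)" using c(1) by (simp add: bar_def cong_iff_dvd_diff dvd_diff_commute)
    then show "dsum h B M = dsum h A M" unfolding A(2) B(2) using c(1) periodic_cong[OF h] by metis
  qed
  then have "eqv t B T" using e eqv_trans[of t B A T] by (simp add: A_def)
  then have "B = T" using eqv_core_eq[of t B T] c(3) tT t1 by (simp add: B_def)
  then show ?thesis using that c by (simp add: B_def)
qed

text \<open>This is the case \<open>k = 0\<close> of \<open>row_shape\<close>.\<close>

lemma both_exc_rows:
  assumes "exc_rise s t X b" "2 * p + 1 = s" "2 * b + 1 = s"
  shows "p \<in> X" "\<And>j. j > 0 \<Longrightarrow> p + j * s \<notin> X" "p + t \<notin> X" "b = p"
proof -
  show "b = p" using assms by simp
  obtain k where k: "b = p + k * s" and Q: "\<And>j. p + j * s - t \<in> X \<longleftrightarrow> j < 0"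
    and P: "\<And>j. p + j * s \<in> X \<longleftrightarrow> j = k \<or> j < 0 \<and> j \<noteq> -1 - k"
    using row_shape[OF assms(1,2)] by blast
  have "k * s = 0" using k assms(2,3) by linarith
  then have "k = 0" using s1 by simp
  then show "p \<in> X" "\<And>j. j > 0 \<Longrightarrow> p + j * s \<notin> X" using P[of 0] P by auto
  have "p - s - t \<in> X" using Q[of "-1"] by simp
  moreover have "bar (p + t) = p - s - t" using assms(2) by (simp add: bar_def)
  ultimately show "p + t \<notin> X" using scX self_conj_bar by metis
qed

text \<open>The only \<open>s\<close>-rise is \<open>p\<close>, and flipping it is invisible modulo
  \<open>s\<close>, so the flipped set is \<open>S\<close>. Modulo \<open>t\<close> the same flip
  leads from \<open>S\<close> to \<open>T\<close>.\<close>

lemma single_exc: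
  assumes exc: "exc_rise s t X b" and no: "\<nexists>c. exc_rise t s X c"
  obtains p c where "2 * p + 1 = s" "bar p \<in> S" "X = (S - {bar p}) \<union> {p}"
    "[c = p] (mod t)" "c \<notin> S" "T = (S - {bar c}) \<union> {c}"
proof -
  obtain p where p: "2 * p + 1 = s" using exc_odd[OF exc] by blast
  have "2 * b + 1 = s" using exc_cases[OF exc] no by blast
  note P = both_exc_rows[OF exc p this]
  have pX: "p \<in> X" "p + s \<notin> X" using P(1) P(2)[of 1] by auto
  define Y where "Y = (X - {p}) \<union> {bar p}"
  have "core_set s Y"
    unfolding core_set_def
  proof (rule, rule ccontr)
    fix z assume z: "z \<in> Y" "z - s \<notin> Y"
    have "2 * p + 1 \<noteq> - s" using p s1 by simp
    note r = flip_rises[OF scX pX this Y_def z]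
    have "2 * z + 1 = s" using s_rise_cases[OF r(1,2)] no by blast
    then show False using r(3) p by simp
  qed
  moreover have "eqv s Y S"
    using flip_eqv_self_dual[OF scX pX(1), of s] p eqv_trans[OF _ XS] by (simp add: Y_def)
  ultimately have YS: "Y = S" using eqv_core_eq[OF _ _ sS] s1 by simp
  have X: "X = (S - {bar p}) \<union> {p}" "bar p \<in> S"
    using flip_back[OF scX pX(1) Y_def] YS by auto
  obtain c where "[c = p] (mod t)" "c \<notin> S" "T = (S - {bar c}) \<union> {c}"
    using core_from_flip[OF tS scS nS p X(2)] XT X(1) by auto
  then show ?thesis using that p X by blast
qed

text \<open>The possible \<open>s\<close>-rises are \<open>p\<close>, \<open>r\<close> and the
  reflection \<open>s - 1 - r\<close>; the flip of \<open>p\<close> removes the first, the flip of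
  \<open>r\<close> the other two.\<close>

lemma core_double_flip:
  assumes e: "exc_rise s t X p" "exc_rise t s X r" and p: "2 * p + 1 = s" and r: "2 * r + 1 = t"
  shows "core_set s ((X - {p, r}) \<union> {bar p, bar r})"
proof -
  have st: "s \<noteq> t" using nst by auto
  have nP: "2 * p + 1 \<noteq> - s" "2 * r + 1 \<noteq> - s" "r \<noteq> p" "r \<noteq> bar p" "p \<noteq> bar r"
    using p r s1 t1 st by (auto simp: bar_def)
  note P = both_exc_rows[OF e(1) p p]
  note R = rigid_pair.both_exc_rows[OF swap_rigid e(2) r r]
  define Y where "Y = (X - {p}) \<union> {bar p}"
  define Z where "Z = (Y - {r}) \<union> {bar r}"
  have scY: "self_conj Y" using flip_single[OF scX P(1)] by (simp add: Y_def)
  have rY: "r \<in> Y" "r + s \<notin> Y"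
    using R nP p r s1 t1 by (auto simp: Y_def bar_def)
  have "core_set s Z"
    unfolding core_set_def
  proof (rule, rule ccontr)
    fix z assume z: "z \<in> Z" "z - s \<notin> Z"
    note a = flip_rises[OF scY rY nP(2) Z_def z]
    note b = flip_rises[OF scX P(1) _ nP(1) Y_def a(1,2)]
    have b': "z \<in> X" "z - s \<notin> X" "z \<noteq> p" using b P(2)[of 1] by auto
    show False
      using s_rise_cases[OF b'(1,2)] b'(3) a(3,4) p rigid_pair.exc_unique[OF swap_rigid e(2)] by auto
  qed
  moreover have "Z = (X - {p, r}) \<union> {bar p, bar r}" using nP by (auto simp: Z_def Y_def)
  ultimately show ?thesis by simp
qed

end

lemma periodic_bar_self:
  fixes h :: "int \<Rightarrow> int"
  assumes "\<forall>b. h (b + m) = h b" "m dvd 2 * x + 1"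
  shows "h (bar x) = h x"
proof -
  have "x - bar x = 2 * x + 1" by (simp add: bar_def)
  then have "[x = bar x] (mod m)" using assms(2) by (simp only: cong_iff_dvd_diff)
  then show ?thesis using periodic_cong[OF assms(1)] by metis
qed

lemma cong_bar: "[a = b] (mod m) \<Longrightarrow> [bar a = bar b] (mod m)"
  by (simp add: bar_def cong_iff_dvd_diff dvd_diff_commute)

context rigid_pair
begin

text \<open>The flip at \<open>r\<close> is invisible modulo \<open>t\<close>, so \<open>T\<close>
  is determined by the flip at \<open>p\<close> alone.\<close>

lemma double_flip_target:
  assumes M: "core_set t M" "self_conj M" "near M {..<0}" and p: "2 * p + 1 = s" and r: "2 * r + 1 = t"
    and in_M: "bar p \<in> M" "bar r \<in> M" and X: "X = (M - {bar p, bar r}) \<union> {p, r}"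
  obtains c where "[c = p] (mod t)" "c \<notin> M" "T = (M - {bar c}) \<union> {c}"
proof -
  define A where "A = (M - {bar p}) \<union> {p}"
  have ne: "p \<noteq> r" "p \<noteq> bar r" using p r s1 t1 nst by (auto simp: bar_def)
  have scA: "self_conj A" using flip_single(1)[OF M(2) in_M(1)] by (simp add: A_def)
  have rA: "bar r \<in> A" using in_M p r nst by (auto simp: A_def bar_def)
  have "2 * bar r + 1 = - t" using r by (simp add: bar_def)
  then have "t dvd 2 * bar r + 1" by simp
  from flip_eqv_self_dual[OF scA rA this] have "eqv t ((A - {bar r}) \<union> {r}) A" by simp
  moreover have "(A - {bar r}) \<union> {r} = X" using ne by (auto simp: A_def X)
  ultimately have "eqv t A X" using eqv_sym by metis
  then have "eqv t A T" using eqv_trans XT by blast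
  then show ?thesis using core_from_flip[OF M p in_M(1)] that unfolding A_def by blast
qed

text \<open>The two cores come from \<open>M\<close> by filling gaps \<open>c\<close> and
  \<open>d\<close>. The work goes into \<open>c \<noteq> d\<close>, without which
  \<open>bar d\<close> and \<open>c\<close> would not be the two beads of a double harpoon.\<close>

lemma double_exc:
  assumes e: "exc_rise s t X p" "exc_rise t s X r" and p: "2 * p + 1 = s" and r: "2 * r + 1 = t"
  obtains M c d where "core_set s M" "core_set t M" "self_conj M" 
    "bar p \<in> M" "bar r \<in> M" "X = (M - {bar p, bar r}) \<union> {p, r}"
    "[d = r] (mod s)" "d \<notin> M" "S = (M - {bar d}) \<union> {d}"
    "[c = p] (mod t)" "c \<notin> M" "T = (M - {bar c}) \<union> {c}" "c \<noteq> d"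
proof -
  define M where "M = (X - {p, r}) \<union> {bar p, bar r}"
  note P = both_exc_rows[OF e(1) p p]
  note R = rigid_pair.both_exc_rows[OF swap_rigid e(2) r r]
  have ne: "p \<noteq> r" "p \<noteq> bar r" using p r s1 t1 nst by (auto simp: bar_def)
  have coreM: "core_set s M" "core_set t M"
    using core_double_flip[OF e p r] rigid_pair.core_double_flip[OF swap_rigid e(2,1) r p]
    by (simp_all add: M_def insert_commute)
  have pr: "{p, r} \<subseteq> X" using P R by simp
  have scM: "self_conj M" and nM: "near M X"
    using flip[OF scX pr] by (simp_all add: M_def)
  have nM': "near M {..<0}" using nM nX near_trans by blast
  have nin: "bar p \<notin> X" "bar r \<notin> X" using pr scX by (auto simp: self_conj_bar)
  have X: "X = (M - {bar p, bar r}) \<union> {p, r}" using pr nin by (auto simp: M_def)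
  have in_M: "bar p \<in> M" "bar r \<in> M" by (simp_all add: M_def)
  obtain c where c: "[c = p] (mod t)" "c \<notin> M" "T = (M - {bar c}) \<union> {c}"
    using double_flip_target[OF coreM(2) scM nM' p r in_M X] by blast
  have X': "X = (M - {bar r, bar p}) \<union> {r, p}" using X by auto
  obtain d where d: "[d = r] (mod s)" "d \<notin> M" "S = (M - {bar d}) \<union> {d}"
    using rigid_pair.double_flip_target[OF swap_rigid coreM(1) scM nM' r p in_M(2,1) X'] by blast
  have "c \<noteq> d"
  proof
    assume cd: "c = d"
    obtain a where a: "c - r = s * a" using d(1) cd by (auto simp: cong_iff_dvd_diff elim: dvdE)
    obtain b where b: "c - p = t * b" using c(1) by (auto simp: cong_iff_dvd_diff elim: dvdE)
    \<comment> \<open>If \<open>c = d\<close>, this bead is congruent to \<open>p\<close> modulo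
      \<open>t\<close> and to \<open>r\<close> modulo \<open>s\<close>, so
      \<open>2 * c + 1 - s - t\<close> is \<open>s * t * m\<close> with \<open>m\<close> nonzero. A
      positive \<open>m\<close> puts \<open>p\<close> into the core \<open>T\<close>; a negative one
      contradicts rigidity.\<close>
    have D: "2 * c + 1 - s - t = s * (2 * a - 1)" "2 * c + 1 - s - t = t * (2 * b - 1)"
      using a b p r by (simp_all add: algebra_simps)
    have nS: "2 * c + 1 \<noteq> x" if "s dvd x" for x
    proof
      assume "2 * c + 1 = x"
      then have "t = x - s * (2 * a - 1) - s" using D(1) by simp
      then show False using that nst by (metis dvd_diff dvd_refl dvd_triv_left)
    qed
    have nT: "2 * c + 1 \<noteq> x" if "t dvd x" for x
    proof
      assume "2 * c + 1 = x"
      then have "s = x - t * (2 * b - 1) - t" using D(2) by simp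
      then show False using that nts by (metis dvd_diff dvd_refl dvd_triv_left)
    qed
    have "t dvd s * (2 * a - 1)" using D by (metis dvd_triv_left)
    then have "t dvd 2 * a - 1" using cop by (simp add: coprime_commute coprime_dvd_mult_right_iff)
    then obtain m where m: "2 * a - 1 = t * m" by (elim dvdE)
    have "t * (2 * b - 1) = t * (s * m)" using D m by (simp add: mult.left_commute)
    then have m': "2 * b - 1 = s * m" using t1 by simp
    have "m \<noteq> 0"
    proof
      assume "m = 0"
      then have "2 * a = 1" using m by simp
      then show False by presburger
    qed
    then consider "m > 0" | "m < 0" by linarith
    then show False
    proof cases
      case 1
      then have "s * m > 0" using s1 by simp
      then have "b \<ge> 0" using m' by linarith
      moreover have "c \<in> T" using c(3) by simp
      ultimately have "c - b * t \<in> T" using core_set_iter[OF tT] by blast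
      moreover have "c - b * t = p" using b by (simp add: algebra_simps)
      ultimately show False using not_in_core(2)[OF p] by simp
    next
      case 2
      then have "t * m < 0" using t1 by (simp add: mult_less_0_iff)
      then have a0: "a < 1" using m by linarith
      moreover have "a \<noteq> 0"
      proof
        assume "a = 0"
        then have "t * m = - 1" using m by simp
        then have "t dvd 1" by (metis dvd_minus_iff dvd_triv_left)
        then show False using t1 by simp
      qed
      ultimately have "- a > 0" by simp
      \<comment> \<open>Chosen so that \<open>2 * w + 1 = - (s * t * m)\<close>: \<open>w\<close> is
        self-dual for both moduli and cancels the excess of \<open>c\<close>, which gives
        \<open>p\<close>, \<open>r\<close>, \<open>bar c\<close>, \<open>bar w\<close> total
        zero.\<close>
      define w where "w = p + (- a) * s"
      have wX: "w \<notin> X" using P(2)[OF \<open>- a > 0\<close>] by (simp add: w_def)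
      have w2: "2 * w + 1 = - (s * t * m)" 
      proof -
        have "2 * w + 1 = - (s * (2 * a - 1))" using p by (simp add: w_def algebra_simps)
        then show ?thesis using m by (simp add: mult.assoc)
      qed
      have wpos: "w > p" using \<open>- a > 0\<close> s1 by (simp add: w_def mult_less_0_iff)
      have rp: "r \<ge> 0" "p \<ge> 0" using p r s1 t1 by auto
      have bX: "bar c \<in> X" "bar w \<in> X"
      proof -
        have "bar c \<in> M" using c(2) scM self_conj_bar by blast
        moreover have "c \<noteq> p" "c \<noteq> r" using nS[of "2 * p + 1"] nT[of "2 * r + 1"] p r by auto
        ultimately show "bar c \<in> X" using X by (metis Diff_iff UnI1 bar_bar insertE singletonD)
        show "bar w \<in> X" using wX scX self_conj_bar by blast
      qed
      have pc: "bar c \<noteq> p" "bar c \<noteq> r"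
        using nS[of "- s"] nT[of "- t"] p r by (auto simp: bar_def)
      have wc: "w \<noteq> c" using nS[of "2 * w + 1"] w2 by auto
      show False
      proof (rule rigidD4[OF rig, of p r "bar c" "bar w"])
        show "p \<in> X" "r \<in> X" "bar c \<in> X" "bar w \<in> X" using pr bX by auto
        have "bar w \<noteq> p" "bar w \<noteq> r" using wpos rp by (auto simp: bar_def)
        moreover have "bar c \<noteq> bar w" using wc by (metis bar_bar)
        ultimately show "distinct [p, r, bar c, bar w]" using ne(1) pc by auto
        have "2 * c + 1 + (2 * w + 1) = s + t" using w2 D(1) m by (simp add: mult.assoc)
        then show "p + r + bar c + bar w = - 2" using p r by (simp add: bar_def)
      next
        fix h :: "int \<Rightarrow> int" assume h: "\<forall>b. h (b + s) = h b"
        have "h (bar p) = h p" using periodic_bar_self[OF h] p by simp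
        moreover have "h (bar w) = h w" using periodic_bar_self[OF h, of w] w2 by simp
        moreover have "h c = h r" "h (bar c) = h (bar r)"
          using d(1) cd cong_bar periodic_cong[OF h] by auto
        ultimately show "h (bar p) + h (bar r) + h (bar (bar c)) + h (bar (bar w)) = h p + h r + h (bar c) + h (bar w)"
          by simp
      next
        fix h :: "int \<Rightarrow> int" assume h: "\<forall>b. h (b + t) = h b"
        have "h (bar r) = h r" using periodic_bar_self[OF h] r by simp
        moreover have "h (bar w) = h w" using periodic_bar_self[OF h, of w] w2 by simp
        moreover have "h c = h p" "h (bar c) = h (bar p)"
          using c(1) cong_bar periodic_cong[OF h] by auto
        ultimately show "h (bar p) + h (bar r) + h (bar (bar c)) + h (bar (bar w)) = h p + h r + h (bar c) + h (bar w)"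
          by simp
      qed
    qed
  qed
  then show ?thesis using that coreM scM in_M X c d by blast
qed

text \<open>Besides \<open>p\<close>, only \<open>b\<close> and its reflection can be
  \<open>s\<close>-rises, and \<open>p\<close> is a gap because \<open>k = 0\<close> would give
  \<open>t dvd s\<close>.\<close>

lemma common_exc_core:
  assumes e: "exc_rise s t X b" "exc_rise t s X b" and p: "2 * p + 1 = s"
  shows "p \<notin> X" "core_set s ((X - {b}) \<union> {bar b})" "b > 0"
proof -
  obtain k where k: "b = p + k * s" "k \<ge> 0"
    and P: "\<And>j. p + j * s \<in> X \<longleftrightarrow> j = k \<or> j < 0 \<and> j \<noteq> -1 - k"
    using row_shape[OF e(1) p] by blast
  have "k \<noteq> 0"
  proof
    assume "k = 0"
    then have "t dvd s" using e(2) k p by (simp add: exc_rise_def)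
    then show False using nts by simp
  qed
  then have k1: "k \<ge> 1" using k by simp
  show pX: "p \<notin> X" using P[of 0] k1 by simp
  have p0: "p \<ge> 0" using p s1 by simp
  show b0: "b > 0" using k1 k p0 s1 by (simp add: add_nonneg_pos)
  have bX: "b \<in> X" "b + s \<notin> X" using P[of k] P[of "k + 1"] k by (auto simp: algebra_simps)
  have "2 * b + 1 \<noteq> - s" using b0 s1 by simp
  show "core_set s ((X - {b}) \<union> {bar b})"
    unfolding core_set_def
  proof (rule, rule ccontr)
    fix z assume z: "z \<in> (X - {b}) \<union> {bar b}" "z - s \<notin> (X - {b}) \<union> {bar b}"
    note a = flip_rises[OF scX bX \<open>2 * b + 1 \<noteq> - s\<close> refl z]
    have "2 * z + 1 \<noteq> s" using a(1) pX p by auto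
    then show False using s_rise_cases[OF a(1,2)] a(3,4) rigid_pair.exc_unique[OF swap_rigid e(2)] by blast
  qed
qed

text \<open>Self-duality for both moduli makes \<open>2 * b + 1\<close> a positive multiple
  \<open>s * t * m\<close> with \<open>m\<close> odd, and \<open>m \<ge> 3\<close> would leave room
  for a forbidden flip inside the row of \<open>p\<close>.\<close>

lemma common_exc_value:
  assumes e: "exc_rise s t X b" "exc_rise t s X b" and p: "2 * p + 1 = s"
  shows "2 * b + 1 = s * t"
proof -
  obtain k where k: "b = p + k * s" "k \<ge> 0"
    and P: "\<And>j. p + j * s \<in> X \<longleftrightarrow> j = k \<or> j < 0 \<and> j \<noteq> -1 - k"
    using row_shape[OF e(1) p] by blast
  have b2: "2 * b + 1 = s * (2 * k + 1)" using k p by (simp add: algebra_simps)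
  have "t dvd s * (2 * k + 1)" using e(2) b2 by (simp add: exc_rise_def)
  then have "t dvd 2 * k + 1" using cop by (simp add: coprime_commute coprime_dvd_mult_right_iff)
  then obtain m where m: "2 * k + 1 = t * m" by (elim dvdE)
  have "t * m > 0" using m k by linarith
  then have m0: "m > 0" using t1 by (simp add: zero_less_mult_iff)
  have tdvd: "\<not> t dvd x" if "x = 1 \<or> x = -1" for x using that t1 by auto
  have "m \<noteq> 2"
  proof
    assume "m = 2"
    then have "2 * k + 1 = 2 * t" using m by simp
    then show False by presburger
  qed
  show ?thesis
  proof (cases "m = 1")
    case True
    then show ?thesis using b2 m by simp
  next
    case False
    then have "m \<ge> 3" using m0 \<open>m \<noteq> 2\<close> by simp
    then have "t * 3 \<le> t * m" using t1 by simp
    then have k3: "2 * k + 1 \<ge> 3 * t" using m by simp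
    have kt: "k \<noteq> t - 1" "k \<noteq> t" "k \<noteq> 2 * t - 1"
    proof -
      have "2 * k + 1 \<noteq> a * t + x" if "x = 1 \<or> x = -1" for a x
      proof
        assume "2 * k + 1 = a * t + x"
        then have "x = t * (m - a)" using m by (simp add: algebra_simps)
        then show False using tdvd[OF that] by simp
      qed
      from this[of "-1" 2] this[of 1 2] this[of "-1" 4]
      show "k \<noteq> t - 1" "k \<noteq> t" "k \<noteq> 2 * t - 1" by auto
    qed
    have barj: "bar (p + j * s) = p + (- 1 - j) * s" for j using p by (simp add: bar_def algebra_simps)
    have inj: "p + i * s = p + j * s \<longleftrightarrow> i = j" for i j using s1 by simp
    have False
    \<comment> \<open>The indices sum to \<open>- 2\<close>, so the total is zero. Modulo
      \<open>s\<close> all four beads are self-dual; modulo \<open>t\<close> the first two are, and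
      flipping exchanges the classes of the last two. By \<open>m \<ge> 3\<close> the index
      \<open>t - 1 - k\<close> is negative.\<close>
    proof (rule rigidD4[OF rig, of "p + k * s" "p + (t - 1 - k) * s" "p + (-1) * s" "p + (-t) * s"])
      show "p + k * s \<in> X" "p + (t - 1 - k) * s \<in> X" "p + (-1) * s \<in> X" "p + (-t) * s \<in> X"
        unfolding P using k3 t1 kt k by auto
      show "distinct [p + k * s, p + (t - 1 - k) * s, p + (-1) * s, p + (-t) * s]"
        unfolding distinct.simps list.set insert_iff inj using k3 t1 kt k by auto
      show "p + k * s + (p + (t - 1 - k) * s) + (p + (-1) * s) + (p + (-t) * s) = - 2"
        using p by (simp add: algebra_simps)
    next
      fix h :: "int \<Rightarrow> int" assume h: "\<forall>b. h (b + s) = h b"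
      have "h (p + j * s) = h p" for j by (rule periodic_cong[OF h]) (simp add: cong_iff_dvd_diff)
      then show "h (bar (p + k * s)) + h (bar (p + (t - 1 - k) * s)) + h (bar (p + (-1) * s)) + h (bar (p + (-t) * s)) =
        h (p + k * s) + h (p + (t - 1 - k) * s) + h (p + (-1) * s) + h (p + (-t) * s)"
        unfolding barj by (simp only:)
    next
      fix h :: "int \<Rightarrow> int" assume h: "\<forall>b. h (b + t) = h b"
      have "t dvd 2 * (p + k * s) + 1" using b2 m k by simp
      then have 1: "h (bar (p + k * s)) = h (p + k * s)" by (rule periodic_bar_self[OF h])
      have "2 * (p + (t - 1 - k) * s) + 1 = t * (2 * s - s * m)"
      proof -
        have "2 * (p + (t - 1 - k) * s) + 1 = s * (2 * t - (2 * k + 1))" using p by (simp add: algebra_simps)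
        then show ?thesis unfolding m by (simp add: algebra_simps)
      qed
      then have "t dvd 2 * (p + (t - 1 - k) * s) + 1" by simp
      then have 2: "h (bar (p + (t - 1 - k) * s)) = h (p + (t - 1 - k) * s)" by (rule periodic_bar_self[OF h])
      have 3: "h (bar (p + (-1) * s)) = h (p + (-t) * s)" "h (bar (p + (-t) * s)) = h (p + (-1) * s)"
        unfolding barj by (rule periodic_cong[OF h], simp add: cong_iff_dvd_diff algebra_simps)+
      show "h (bar (p + k * s)) + h (bar (p + (t - 1 - k) * s)) + h (bar (p + (-1) * s)) + h (bar (p + (-t) * s)) =
        h (p + k * s) + h (p + (t - 1 - k) * s) + h (p + (-1) * s) + h (p + (-t) * s)"
        using 1 2 3 by simp
    qed
    then show ?thesis ..
  qed
qed

text \<open>Flipping \<open>q\<close> is invisible for both moduli and repairs both, so the two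
  cores coincide. The bead \<open>d\<close> prepares the identification with \<open>kappa\<close>,
  whose top bead it is.\<close>

lemma common_exc:
  assumes e: "exc_rise s t X q" "exc_rise t s X q"
  obtains d where "2 * q + 1 = s * t" "bar q \<in> S" "X = (S - {bar q}) \<union> {q}" "T = S"
    "2 * d + 1 = s * t - s - t" "d \<in> S"
proof -
  obtain p where p: "2 * p + 1 = s" using exc_odd[OF e(1)] by blast
  obtain r where r: "2 * r + 1 = t" using rigid_pair.exc_odd[OF swap_rigid e(2)] by blast
  have q: "2 * q + 1 = s * t" using common_exc_value[OF e p] .
  define Y where "Y = (X - {q}) \<union> {bar q}"
  have qX: "q \<in> X" using e by (simp add: exc_rise_def)
  have core: "core_set s Y" "core_set t Y" and pr: "p \<notin> X" "r \<notin> X"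
    using common_exc_core[OF e p] rigid_pair.common_exc_core[OF swap_rigid e(2,1) r] by (simp_all add: Y_def)
  have "eqv s Y X" "eqv t Y X"
    using flip_eqv_self_dual[OF scX qX] q by (simp_all add: Y_def)
  then have "eqv s Y S" "eqv t Y T" using eqv_trans XS XT by blast+
  then have Y: "Y = S" "Y = T" using eqv_core_eq core sS tT s1 t1 by auto
  define d where "d = q - p - r - 1"
  have d: "2 * d + 1 = s * t - s - t" using p q r by (simp add: d_def)
  have d_r: "[d = bar r] (mod s)" 
  proof -
    have "d - bar r = q - p" by (simp add: d_def bar_def)
    moreover have "q - p = s * r"
    proof -
      have "2 * (s * r) = s * (2 * r + 1) - s" by (simp add: algebra_simps)
      then show ?thesis using p q r by simp
    qed
    ultimately show ?thesis by (simp add: cong_iff_dvd_diff)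
  qed
  have d_p: "[d = bar p] (mod t)" 
  proof -
    have "d - bar p = q - r" by (simp add: d_def bar_def)
    moreover have "q - r = t * p"
    proof -
      have "2 * (t * p) = (2 * p + 1) * t - t" by (simp add: algebra_simps)
      then show ?thesis using p q r by simp
    qed
    ultimately show ?thesis by (simp add: cong_iff_dvd_diff)
  qed
  have q0: "q > 0" "p > 0" "r > 0"
    using common_exc_core(3)[OF e p] p r s1 t1 by auto
  have "d \<in> X"
  proof (rule ccontr)
    assume nd: "d \<notin> X"
    have dp: "d \<noteq> p" 
    proof
      assume "d = p"
      then have "s dvd p - bar r" using d_r by (simp add: cong_iff_dvd_diff)
      then have "s dvd 2 * (p - bar r) - s" by (metis dvd_diff dvd_mult dvd_refl)
      moreover have "2 * (p - bar r) - s = t" using p r by (simp add: bar_def)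
      ultimately show False using nst by simp
    qed
    have dr: "d \<noteq> r"
    proof
      assume "d = r"
      then have "t dvd r - bar p" using d_p by (simp add: cong_iff_dvd_diff)
      then have "t dvd 2 * (r - bar p) - t" by (metis dvd_diff dvd_mult dvd_refl)
      moreover have "2 * (r - bar p) - t = s" using p r by (simp add: bar_def)
      ultimately show False using nts by simp
    qed
    show False
    \<comment> \<open>The total vanishes because \<open>d = q - p - r - 1\<close>. Modulo
      \<open>s\<close> the bead \<open>d\<close> is paired with \<open>bar r\<close>, modulo
      \<open>t\<close> with \<open>bar p\<close>, and the other flips are invisible.\<close>
    proof (rule rigidD4[OF rig, of q "bar d" "bar p" "bar r"])
      show "q \<in> X" "bar d \<in> X" "bar p \<in> X" "bar r \<in> X"
        using qX nd pr scX by (auto simp: self_conj_bar)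
      have "bar d \<noteq> q"
      proof
        assume "bar d = q"
        then have "2 * (s * t) = s + t" using d q by (simp add: bar_def)
        moreover have "s * t \<ge> s * 1" "s * t \<ge> 1 * t" using s1 t1 by (auto intro!: mult_left_mono mult_right_mono simp del: mult_1_left mult_1_right)
        moreover have "s * t \<noteq> s" using s1 t1 by simp
        ultimately show False by linarith
      qed
      moreover have "p \<noteq> r" using p r nst by auto
      ultimately show "distinct [q, bar d, bar p, bar r]"
        using dp dr q0 by (auto simp: bar_def)
      show "q + bar d + bar p + bar r = - 2" by (simp add: d_def bar_def)
    next
      fix h :: "int \<Rightarrow> int" assume h: "\<forall>b. h (b + s) = h b"
      have "h (bar p) = h p" "h (bar q) = h q" using periodic_bar_self[OF h] p q by auto
      moreover have "h d = h (bar r)" "h (bar d) = h r"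
        using d_r cong_bar[OF d_r] periodic_cong[OF h] by auto
      ultimately show "h (bar q) + h (bar (bar d)) + h (bar (bar p)) + h (bar (bar r)) = h q + h (bar d) + h (bar p) + h (bar r)"
        by simp
    next
      fix h :: "int \<Rightarrow> int" assume h: "\<forall>b. h (b + t) = h b"
      have "h (bar r) = h r" "h (bar q) = h q" using periodic_bar_self[OF h] r q by auto
      moreover have "h d = h (bar p)" "h (bar d) = h p"
        using d_p cong_bar[OF d_p] periodic_cong[OF h] by auto
      ultimately show "h (bar q) + h (bar (bar d)) + h (bar (bar p)) + h (bar (bar r)) = h q + h (bar d) + h (bar p) + h (bar r)"
        by simp
    qed
  qed
  moreover have "d \<noteq> q" using q0 by (simp add: d_def)
  ultimately have "d \<in> S" using Y by (auto simp: Y_def)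
  then show ?thesis using that q flip_back[OF scX qX Y_def] Y d by metis
qed

end

section \<open>Potentials and uniqueness\<close>

lemma self_conj_diff:
  assumes "self_conj X" "self_conj T"
  shows "T - X = bar ` (X - T)" "X = (T - bar ` (X - T)) \<union> (X - T)"
proof -
  have b: "b \<in> T - X \<longleftrightarrow> bar b \<in> X - T" for b using assms by (auto simp: self_conj_bar)
  have im: "z \<in> bar ` A \<longleftrightarrow> bar z \<in> A" for z A by (metis bar_bar imageE imageI)
  show *: "T - X = bar ` (X - T)" by (intro set_eqI) (simp only: b im)
  show "X = (T - bar ` (X - T)) \<union> (X - T)" unfolding *[symmetric] by blast
qed

lemma dsum_self_conj:
  assumes "self_conj X" "self_conj T"
  shows "dsum f X T = (\<Sum>g\<in>X - T. f g - f (bar g))"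
  unfolding dsum_def self_conj_diff(1)[OF assms]
  by (simp add: sum.reindex[OF inj_bar] sum_subtractf)

lemma dsum_self_conj_id:
  assumes "self_conj X" "self_conj T"
  shows "dsum (\<lambda>b. b) X T = (\<Sum>g\<in>X - T. 2 * g + 1)"
  unfolding dsum_self_conj[OF assms] by (simp add: bar_def)

lemma dsum_eqv_affine:
  assumes "eqv t X T" "\<And>z. f (z + t) = f z"
  shows "dsum (\<lambda>z. a * z + f z) X T = a * dsum (\<lambda>z. z) X T"
  using assms by (simp add: dsum_add dsum_scale eqv_def)

lemma dsum_eqv_affine2:
  assumes "eqv s X T" "eqv t X T" "\<And>z. f (z + t) = f z" "\<And>z. g (z + s) = g z"
  shows "dsum (\<lambda>z. a * z + f z + g z) X T = a * dsum (\<lambda>z. z) X T"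
  using assms dsum_eqv_affine[of t X T f a] by (simp add: dsum_add eqv_def)

text \<open>The potential compares \<open>z\<close> with the first gap \<open>top z\<close> of its
  class in \<open>T\<close>, centred to be at least \<open>t\<close> outside \<open>T\<close> and at
  most \<open>- t\<close> on \<open>T\<close>. Each flip then raises it by at least
  \<open>2 * t\<close>, while the periodic part drops out of the total.\<close>

lemma card_excess_le:
  assumes "eqv t X T" "core_set t T" "self_conj X" "self_conj T" "near T {..<0}" "t > 0"
  shows "t * int (card (X - T)) \<le> dsum (\<lambda>z. z) X T"
proof -
  define top where "top z = (SOME c. [c = z] (mod t) \<and> c \<notin> T \<and> c - t \<in> T)" for z
  have top: "[top z = z] (mod t)" "top z \<notin> T" "top z - t \<in> T" for z
  proof -
    have "\<exists>c. [c = z] (mod t) \<and> c \<notin> T \<and> c - t \<in> T"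
      using first_gap[OF assms(5,6), of z] by metis
    then have "[top z = z] (mod t) \<and> top z \<notin> T \<and> top z - t \<in> T" unfolding top_def by (rule someI_ex)
    then show "[top z = z] (mod t)" "top z \<notin> T" "top z - t \<in> T" by auto
  qed
  have per: "top (z + t) = top z" for z by (simp add: top_def cong_def)
  have cl: "[z = top z] (mod t)" for z using top(1) cong_sym by blast
  have out: "z \<ge> top z" if "z \<notin> T" for z
    using core_set_less_gap[OF assms(2,6) top(2,3) cl] that by simp
  have ins: "z \<le> top z - t" if "z \<in> T" for z
    using core_set_below_gap[OF assms(2,6) that top(2) cl] .
  define f where "f z = 2 * z + (- 2 * top z + t)" for z
  have fin: "finite (X - T)" using assms(1) by (simp add: eqv_def near_def)
  have "dsum f X T = 2 * dsum (\<lambda>z. z) X T"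
    unfolding f_def by (rule dsum_eqv_affine[OF assms(1)]) (simp add: per)
  moreover have "dsum f X T \<ge> (\<Sum>g\<in>X - T. 2 * t)"
    unfolding dsum_self_conj[OF assms(3,4)]
  proof (rule sum_mono)
    fix g assume g: "g \<in> X - T"
    then have "bar g \<in> T" using assms(4) by (simp add: self_conj_bar)
    then show "2 * t \<le> f g - f (bar g)" using out[of g] ins[of "bar g"] g by (simp add: f_def)
  qed
  ultimately show ?thesis by (simp add: mult.commute)
qed

lemma eqv_same_size:
  assumes "eqv t X T" "core_set t T" "self_conj X" "self_conj T" "near T {..<0}" "t > 0"
    and "dsum (\<lambda>z. z) X T = 0"
  shows "X = T"
proof -
  have "t * int (card (X - T)) \<le> 0" using card_excess_le[OF assms(1-6)] assms(7) by simp
  then have "card (X - T) = 0" using assms(6) by (simp add: mult_le_0_iff)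
  then have "X - T = {}" using assms(1) by (simp add: eqv_def near_def)
  then show ?thesis using self_conj_diff(2)[OF assms(3,4)] by auto
qed

text \<open>The bound permits a single flip, and the size then determines its bead by
  \<open>2 * g + 1 = t\<close>.\<close>

lemma eqv_next_size:
  assumes "eqv t X T" "core_set t T" "self_conj X" "self_conj T" "near T {..<0}" "t > 0"
    and "dsum (\<lambda>z. z) X T = t" and r: "2 * r + 1 = t"
  shows "X = (T - {bar r}) \<union> {r}"
proof -
  have "t * int (card (X - T)) \<le> t * 1" using card_excess_le[OF assms(1-6)] assms(7) by simp
  then have "card (X - T) \<le> 1" using assms(6) by (simp only: mult_le_cancel_left) simp
  moreover have "card (X - T) \<noteq> 0"
  proof
    assume "card (X - T) = 0"
    then have "X - T = {}" using assms(1) by (simp add: eqv_def near_def)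
    then have "dsum (\<lambda>z. z) X T = 0" unfolding dsum_self_conj_id[OF assms(3,4)] by (simp only: sum.empty)
    then show False using assms(6,7) by simp
  qed
  ultimately have "card (X - T) = 1" by linarith
  then obtain g where g: "X - T = {g}" by (rule card_1_singletonE)
  then have "2 * g + 1 = t" using dsum_self_conj_id[OF assms(3,4)] assms(7) by simp
  then have "g = r" using r by simp
  then show ?thesis using self_conj_diff(2)[OF assms(3,4)] g by simp
qed

text \<open>Bounding the beads from above suffices: gaps below zero are mirror images of nonnegative
  beads.\<close>

lemma near_negatives_self_conj:
  assumes "self_conj A" "\<And>z. z \<in> A \<Longrightarrow> z \<le> e"
  shows "near A {..<0}"
proof -
  have "A - {..<0} \<subseteq> {0..e}" using assms(2) by auto
  then have f: "finite (A - {..<0})" using finite_subset by blast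
  have "{..<0} - A \<subseteq> bar ` (A - {..<0})"
  proof
    fix z assume "z \<in> {..<0} - A"
    then have "bar z \<in> A - {..<0}" using assms(1) by (auto simp: self_conj_bar) (simp add: bar_def)
    then show "z \<in> bar ` (A - {..<0})" by (metis bar_bar imageI)
  qed
  then show ?thesis using f finite_subset by (auto simp: near_def)
qed

section \<open>Coordinates for both moduli and the semigroup core\<close>

context coprime_pair
begin

text \<open>Chinese remainders: \<open>J z\<close> is \<open>z\<close> times the inverse of
  \<open>s\<close> modulo \<open>t\<close>, \<open>I z\<close> likewise with the moduli exchanged,
  and what is left is a multiple of \<open>s * t\<close>.\<close>

lemma coords:
  obtains J I w :: "int \<Rightarrow> int"
  where "\<And>z. J (z + t) = J z" "\<And>z. 0 \<le> J z" "\<And>z. J z < t"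
    "\<And>z. I (z + s) = I z" "\<And>z. 0 \<le> I z" "\<And>z. I z < s"
    "\<And>z. z = J z * s + I z * t + w z * (s * t)"
    "\<And>z j i v. 0 \<le> j \<Longrightarrow> j < t \<Longrightarrow> 0 \<le> i \<Longrightarrow> i < s \<Longrightarrow> z = j * s + i * t + v * (s * t) \<Longrightarrow>
       J z = j \<and> I z = i \<and> w z = v"
proof -
  have main: "\<exists>J :: int \<Rightarrow> int. (\<forall>z. J (z + t) = J z \<and> 0 \<le> J z \<and> J z < t \<and> t dvd z - J z * s)
      \<and> (\<forall>z j. 0 \<le> j \<longrightarrow> j < t \<longrightarrow> t dvd z - j * s \<longrightarrow> J z = j)"
    if t: "t > 1" and co: "coprime s t" for s t :: int
  proof -
    obtain u where u: "[s * u = 1] (mod t)" using cong_solve_coprime_int[OF co] by auto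
    define J where "J z = (z * u) mod t" for z
    have a: "t dvd z - J z * s" for z
    proof -
      have "[J z * s = (z * u) * s] (mod t)" unfolding J_def by (simp add: cong_def mod_mult_left_eq)
      also have "[(z * u) * s = z * (s * u)] (mod t)" by (simp add: ac_simps)
      also have "[z * (s * u) = z * 1] (mod t)" by (rule cong_scalar_left[OF u])
      finally have "[z = J z * s] (mod t)" by (simp add: cong_sym)
      then show ?thesis by (simp add: cong_iff_dvd_diff)
    qed
    have "J z = j" if j: "0 \<le> j" "j < t" "t dvd z - j * s" for z j
    proof -
      have "t dvd (z - j * s) - (z - J z * s)" using j(3) a by (rule dvd_diff)
      moreover have "(z - j * s) - (z - J z * s) = s * (J z - j)" by (simp add: algebra_simps)
      ultimately have "t dvd J z - j" using \<open>coprime s t\<close> by (simp add: coprime_commute coprime_dvd_mult_right_iff)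
      then have "J z mod t = j mod t" by (simp add: mod_eq_dvd_iff)
      then show ?thesis using j \<open>t > 1\<close> by (simp add: J_def)
    qed
    moreover have "J (z + t) = J z" for z by (simp add: J_def algebra_simps)
    ultimately show ?thesis using a t by (intro exI[of _ J]) (auto simp: J_def)
  qed
  obtain J where J: "\<And>z. J (z + t) = J z \<and> 0 \<le> J z \<and> J z < t \<and> t dvd z - J z * s"
      "\<And>z j. 0 \<le> j \<Longrightarrow> j < t \<Longrightarrow> t dvd z - j * s \<Longrightarrow> J z = j"
    using main[OF t1 cop] by blast
  have "coprime t s" using cop by (simp add: coprime_commute)
  then obtain I where I: "\<And>z. I (z + s) = I z \<and> 0 \<le> I z \<and> I z < s \<and> s dvd z - I z * t"
      "\<And>z i. 0 \<le> i \<Longrightarrow> i < s \<Longrightarrow> s dvd z - i * t \<Longrightarrow> I z = i"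
    using main[OF s1] by blast
  have st: "s * t dvd z - J z * s - I z * t" for z
  proof (rule divides_mult)
    have "s dvd (z - I z * t) - J z * s" by (rule dvd_diff) (use I in auto)
    then show "s dvd z - J z * s - I z * t" by (simp add: algebra_simps)
    have "t dvd (z - J z * s) - I z * t" by (rule dvd_diff) (use J in auto)
    then show "t dvd z - J z * s - I z * t" by simp
  qed (rule cop)
  define w where "w z = (z - J z * s - I z * t) div (s * t)" for z
  have eq: "z = J z * s + I z * t + w z * (s * t)" for z using st[of z] by (simp add: w_def)
  have "J z = j \<and> I z = i \<and> w z = v"
    if "0 \<le> j" "j < t" "0 \<le> i" "i < s" "z = j * s + i * t + v * (s * t)" for z j i v
  proof -
    have "z - j * s = t * (i + v * s)" "z - i * t = s * (j + v * t)"
      using that(5) by (simp_all add: algebra_simps)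
    then have ji: "J z = j" "I z = i" using J(2) I(2) that(1-4) by simp_all
    then have "j * s + i * t + w z * (s * t) = j * s + i * t + v * (s * t)"
      using eq[of z] that(5) by metis
    then show ?thesis using s1 t1 ji by auto
  qed
  then show ?thesis using that[of J I w] J I eq by blast
qed

text \<open>This is \<open>e\<close> minus the numerical semigroup generated by \<open>s\<close> and
  \<open>t\<close>, the smallest simultaneous core with bead \<open>e\<close>.\<close>

definition max_core :: "int \<Rightarrow> int set" where
  "max_core e = {e - a * s - b * t | a b. a \<ge> 0 \<and> b \<ge> 0}"

lemma max_core_core: "core_set s (max_core e)" "core_set t (max_core e)"
proof -
  have "e - a * s - b * t - s = e - (a + 1) * s - b * t" "e - a * s - b * t - t = e - a * s - (b + 1) * t" for a b
    by (simp_all add: algebra_simps)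
  then show "core_set s (max_core e)" "core_set t (max_core e)"
    unfolding core_set_def max_core_def
    by (blast intro: add_nonneg_nonneg zero_le_one)+
qed

lemma max_core_least:
  assumes "core_set s A" "core_set t A" "e \<in> A"
  shows "max_core e \<subseteq> A"
  unfolding max_core_def using core_set_iter[OF assms(2)] core_set_iter[OF assms(1,3)] by blast

text \<open>A number lies in the semigroup exactly when its coordinate \<open>w\<close> is
  nonnegative. For the stated \<open>e\<close>, self-conjugacy is the symmetry of the semigroup
  about its Frobenius number \<open>s * t - s - t\<close>: \<open>bar\<close> complements all three
  coordinates, taking \<open>w\<close> to \<open>- 1 - w\<close>.\<close>

lemma max_core_coord:
  obtains J I w :: "int \<Rightarrow> int"
  where "\<And>z. J (z + t) = J z" "\<And>z. I (z + s) = I z"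
    "\<And>z. e - z = J z * s + I z * t + w z * (s * t)"
    "\<And>z. z \<in> max_core e \<longleftrightarrow> w z \<ge> 0"
    "2 * e + 1 = s * t - s - t \<Longrightarrow> self_conj (max_core e)"
proof -
  obtain J0 I0 w0 :: "int \<Rightarrow> int" where J0: "\<And>z. J0 (z + t) = J0 z" "\<And>z. 0 \<le> J0 z" "\<And>z. J0 z < t"
    and I0: "\<And>z. I0 (z + s) = I0 z" "\<And>z. 0 \<le> I0 z" "\<And>z. I0 z < s"
    and eq0: "\<And>z. z = J0 z * s + I0 z * t + w0 z * (s * t)"
    and u: "\<And>z j i v. 0 \<le> j \<Longrightarrow> j < t \<Longrightarrow> 0 \<le> i \<Longrightarrow> i < s \<Longrightarrow> z = j * s + i * t + v * (s * t) \<Longrightarrow>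
      J0 z = j \<and> I0 z = i \<and> w0 z = v"
    using coords by blast
  define J where "J z = J0 (e - z)" for z
  define I where "I z = I0 (e - z)" for z
  define w where "w z = w0 (e - z)" for z
  have eq: "e - z = J z * s + I z * t + w z * (s * t)" for z
    unfolding J_def I_def w_def by (rule eq0)
  have pJ: "J (z + t) = J z" for z using J0(1)[of "e - z - t"] by (simp add: J_def algebra_simps)
  have pI: "I (z + s) = I z" for z using I0(1)[of "e - z - s"] by (simp add: I_def algebra_simps)
  have wI: "w z = v" if "0 \<le> j" "j < t" "0 \<le> i" "i < s" "e - z = j * s + i * t + v * (s * t)" for z j i v
    using u[OF that] by (simp add: w_def)
  have mem: "z \<in> max_core e \<longleftrightarrow> w z \<ge> 0" for z
  proof
    assume "z \<in> max_core e"
    then obtain a b where ab: "z = e - a * s - b * t" "a \<ge> 0" "b \<ge> 0" by (auto simp: max_core_def)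
    have "w z = a div t + b div s"
    proof (rule wI)
      show "0 \<le> a mod t" "a mod t < t" "0 \<le> b mod s" "b mod s < s" using s1 t1 by auto
      define a1 a2 b1 b2 where "a1 = a mod t" "a2 = a div t" "b1 = b mod s" "b2 = b div s"
      then have "a = a1 + a2 * t" "b = b1 + b2 * s" by simp_all
      then have "e - z = a1 * s + b1 * t + (a2 + b2) * (s * t)"
        unfolding ab by (simp add: algebra_simps)
      then show "e - z = a mod t * s + b mod s * t + (a div t + b div s) * (s * t)"
        by (simp only: a1_a2_b1_b2_def)
    qed
    then show "w z \<ge> 0" using ab s1 t1 by (simp add: pos_imp_zdiv_nonneg_iff)
  next
    assume w: "w z \<ge> 0"
    have "z = e - (J z + w z * t) * s - I z * t" using eq[of z] by (simp add: algebra_simps)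
    moreover have "J z + w z * t \<ge> 0" "I z \<ge> 0" using w J0 I0 t1 by (auto simp: J_def I_def)
    ultimately show "z \<in> max_core e" unfolding max_core_def by blast
  qed
  have "self_conj (max_core e)" if e: "2 * e + 1 = s * t - s - t"
  proof -
    have "w (bar z) = - 1 - w z" for z
    proof (rule wI)
      show "0 \<le> t - 1 - J z" "t - 1 - J z < t" "0 \<le> s - 1 - I z" "s - 1 - I z < s"
        using J0(2,3)[of "e - z"] I0(2,3)[of "e - z"] by (simp_all add: J_def I_def)
      have "e - bar z = (2 * e + 1) - (e - z)" by (simp add: bar_def)
      also have "\<dots> = (t - 1 - J z) * s + (s - 1 - I z) * t + (- 1 - w z) * (s * t)"
        unfolding e eq[of z] by (simp add: algebra_simps)
      finally show "e - bar z = (t - 1 - J z) * s + (s - 1 - I z) * t + (- 1 - w z) * (s * t)" .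
    qed
    then show ?thesis unfolding self_conj_def mem by auto
  qed
  then show ?thesis using that pJ pI eq mem by blast
qed

text \<open>In units of \<open>s * t\<close> the potential is \<open>- 2 * w\<close>, whose sign
  pattern cuts out the core. Each flip raises it by at least 2, so a size excess of
  \<open>s * t\<close> permits only one flip, necessarily at \<open>q\<close>.\<close>

lemma max_core_unique_next:
  assumes e: "2 * e + 1 = s * t - s - t" and X: "self_conj X" "eqv s X (max_core e)" "eqv t X (max_core e)"
    and d: "dsum (\<lambda>z. z) X (max_core e) = s * t" and q: "2 * q + 1 = s * t"
  shows "X = (max_core e - {bar q}) \<union> {q}"
proof -
  obtain J I w :: "int \<Rightarrow> int" where JI: "\<And>z. J (z + t) = J z" "\<And>z. I (z + s) = I z"
    and eq: "\<And>z. e - z = J z * s + I z * t + w z * (s * t)"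
    and mem: "\<And>z. z \<in> max_core e \<longleftrightarrow> w z \<ge> 0"
    and sc: "self_conj (max_core e)"
    using max_core_coord[of e] e by metis
  let ?K = "max_core e"
  have st0: "s * t > 0" using s1 t1 by simp
  define f where "f z = 2 * z + (2 * s * J z - 2 * e) + 2 * t * I z" for z
  have f: "f z = (s * t) * (- 2 * w z)" for z using eq[of z] by (simp add: f_def algebra_simps)
  have "dsum f X ?K = 2 * (s * t)"
    unfolding f_def d[symmetric] by (rule dsum_eqv_affine2[OF X(2,3)]) (simp_all add: JI)
  moreover have "dsum f X ?K = (s * t) * dsum (\<lambda>z. - 2 * w z) X ?K"
    unfolding f by (rule dsum_scale)
  ultimately have two: "dsum (\<lambda>z. - 2 * w z) X ?K = 2" using s1 t1 by auto
  have fin: "finite (X - ?K)" using X(2) by (simp add: eqv_def near_def)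
  have "(\<Sum>g\<in>X - ?K. 2) \<le> dsum (\<lambda>z. - 2 * w z) X ?K"
    unfolding dsum_self_conj[OF X(1) sc]
  proof (rule sum_mono)
    fix g assume "g \<in> X - ?K"
    then have "g \<notin> ?K" "bar g \<in> ?K" using sc by (auto simp: self_conj_bar)
    then have "w g < 0" "w (bar g) \<ge> 0" unfolding mem by auto
    then show "2 \<le> - 2 * w g - - 2 * w (bar g)" by simp
  qed
  then have "card (X - ?K) \<le> 1" using two by simp
  moreover have "card (X - ?K) \<noteq> 0"
  proof
    assume "card (X - ?K) = 0"
    then have "X - ?K = {}" using fin by simp
    then have "dsum (\<lambda>z. z) X ?K = 0" unfolding dsum_self_conj_id[OF X(1) sc] by (simp only: sum.empty)
    then show False using d s1 t1 by auto
  qed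
  ultimately have "card (X - ?K) = 1" by linarith
  then obtain g where g: "X - ?K = {g}" by (rule card_1_singletonE)
  then have "2 * g + 1 = s * t" using dsum_self_conj_id[OF X(1) sc] d by simp
  then have "g = q" using q by simp
  then show ?thesis using self_conj_diff(2)[OF X(1) sc] g by simp
qed

end

context coprime_pair
begin

text \<open>
  Write \<open>z = p + u s + i t\<close> with \<open>0 \<le> i < s\<close> and let \<open>top i\<close> be the largest \<open>u\<close> with \<open>p + u s + i t \<in> M\<close>.
  The potential \<open>f\<close> is \<open>\<ge> 0\<close> outside \<open>M\<close>, \<open>\<le> 0\<close> on \<open>M\<close> and vanishes at \<open>p\<close>, \<open>r\<close> and their mirror images, so it
  vanishes on all beads that \<open>X\<close> adds to \<open>M\<close>. The parity of \<open>B\<close> singles out \<open>p\<close> among these, and one more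
  flip, of size \<open>t\<close>, remains.
\<close>

lemma double_flip_unique:
  assumes M: "core_set s M" "core_set t M" "self_conj M" "near M {..<0}"
    and p: "2 * p + 1 = s" and r: "2 * r + 1 = t" and d: "2 * d + 1 = s * t - s - t" "d \<notin> M"
    and L: "L = (M - {bar p, bar r}) \<union> {p, r}"
    and X: "self_conj X" "eqv s X L" "eqv t X L" "dsum (\<lambda>z. z) X L = 0"
  shows "X = L"
proof -
  have s3: "s \<ge> 3" "t \<ge> 3" using p r s1 t1 by presburger+
  have pr0: "p > 0" "r > 0" using p r s1 t1 by auto
  have nd: "\<not> s dvd t" "\<not> t dvd s"
    using cop s1 t1 by (metis coprime_absorb_left coprime_commute zdvd1_eq abs_of_pos less_trans zero_less_one less_irrefl)+
  have ne: "p \<noteq> r" "p \<noteq> bar r" using nd p r pr0 by (auto simp: bar_def)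
  have prM: "p \<notin> M" "r \<notin> M" using half_notin_core M p r by blast+
  then have barM: "bar p \<in> M" "bar r \<in> M" using M(3) by (auto simp: self_conj_bar)
  note LM = double_flip(2,3)[OF M(3) prM ne(1) L]
  have XL: "near X L" using X(2) by (simp add: eqv_def)
  have nXM: "near X M" using XL LM(1) near_trans by blast
  obtain J0 I0 w0 :: "int \<Rightarrow> int" where J0: "\<And>z. J0 (z + t) = J0 z" "\<And>z. 0 \<le> J0 z" "\<And>z. J0 z < t"
    and I0: "\<And>z. I0 (z + s) = I0 z" "\<And>z. 0 \<le> I0 z" "\<And>z. I0 z < s"
    and eq0: "\<And>z. z = J0 z * s + I0 z * t + w0 z * (s * t)"
    and u: "\<And>z j i v. 0 \<le> j \<Longrightarrow> j < t \<Longrightarrow> 0 \<le> i \<Longrightarrow> i < s \<Longrightarrow> z = j * s + i * t + v * (s * t) \<Longrightarrow>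
      J0 z = j \<and> I0 z = i \<and> w0 z = v"
    using coords by blast
  define J where "J z = J0 (z - p)" for z
  define I where "I z = I0 (z - p)" for z
  define w where "w z = w0 (z - p)" for z
  have eq: "z - p = J z * s + I z * t + w z * (s * t)" for z
    unfolding J_def I_def w_def by (rule eq0)
  have pJ: "J (z + t) = J z" for z using J0(1)[of "z - p"] by (simp add: J_def algebra_simps)
  have pI: "I (z + s) = I z" for z using I0(1)[of "z - p"] by (simp add: I_def algebra_simps)
  have bJ: "0 \<le> J z" "J z < t" "0 \<le> I z" "I z < s" for z using J0 I0 by (simp_all add: J_def I_def)
  have coordI: "J z = j \<and> I z = i \<and> w z = v"
    if "0 \<le> j" "j < t" "0 \<le> i" "i < s" "z - p = j * s + i * t + v * (s * t)" for z j i v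
    using u[OF that] by (simp add: J_def I_def w_def)
  have cp: "J p = 0 \<and> I p = 0 \<and> w p = 0" by (rule coordI) (use s1 t1 in auto)
  have cbp: "J (bar p) = t - 1 \<and> I (bar p) = 0 \<and> w (bar p) = - 1"
    by (rule coordI) (use s1 t1 p in \<open>auto simp: bar_def algebra_simps\<close>)
  have cr: "J r = r \<and> I r = p + 1 \<and> w r = - 1"
  proof (rule coordI)
    show "0 \<le> r" "r < t" "0 \<le> p + 1" "p + 1 < s" using p r s3 by auto
    show "r - p = r * s + (p + 1) * t + - 1 * (s * t)"
      unfolding p[symmetric] r[symmetric] by (simp add: algebra_simps)
  qed
  have cbr: "J (bar r) = r \<and> I (bar r) = p \<and> w (bar r) = - 1"
  proof (rule coordI)
    show "0 \<le> r" "r < t" "0 \<le> p" "p < s" using p r s3 by auto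
    show "bar r - p = r * s + p * t + - 1 * (s * t)"
      unfolding p[symmetric] r[symmetric] bar_def by (simp add: algebra_simps)
  qed
  have Jbar: "J (bar z) = t - 1 - J z" for z
  proof -
    have "bar z - p = - (z - p) - s" using p by (simp add: bar_def)
    also have "\<dots> = (t - 1 - J z) * s + (- I z) mod s * t + ((- I z) div s - w z - 1) * (s * t)"
    proof -
      define a b where "a = (- I z) mod s" and "b = (- I z) div s"
      then have "- I z = a + b * s" by simp
      then have "- (I z * t) = a * t + b * (s * t)" by (metis distrib_right mult.assoc mult_minus_left)
      then show ?thesis unfolding eq[of z] a_def[symmetric] b_def[symmetric] by (simp add: algebra_simps)
    qed
    finally show ?thesis using coordI[of "t - 1 - J z" "(- I z) mod s" "bar z"] bJ[of z] s1 by simp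
  qed
  have Ibar: "I (bar z) = I z \<Longrightarrow> I z = 0" for z
  proof -
    assume a: "I (bar z) = I z"
    have "bar z - p + (z - p) = - s" using p by (simp add: bar_def)
    then have "- s = (J (bar z) * s + I (bar z) * t + w (bar z) * (s * t)) + (J z * s + I z * t + w z * (s * t))"
      using eq[of z] eq[of "bar z"] by simp
    then have "t * (2 * I z) = s * (- 1 - J (bar z) - J z - (w z + w (bar z)) * t)"
      using a by (simp add: algebra_simps)
    then have "s dvd t * (2 * I z)" by simp
    then have "s dvd 2 * I z" using cop by (simp add: coprime_dvd_mult_right_iff)
    moreover have "odd s" using p by presburger
    ultimately have "s dvd I z"
      by (metis coprime_commute coprime_dvd_mult_right_iff coprime_left_2_iff_odd)
    then show "I z = 0" using bJ(3,4)[of z] by (metis mod_pos_pos_trivial dvd_imp_mod_0)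
  qed
  define top where "top i = (SOME j. p + j * s + i * t \<in> M \<and> p + (j + 1) * s + i * t \<notin> M)" for i
  have top: "p + j * s + i * t \<in> M \<longleftrightarrow> j \<le> top i" for i j
  proof -
    obtain c where c: "[c = p + i * t] (mod s)" "c \<notin> M" "c - s \<in> M"
      using first_gap[OF M(4), of s "p + i * t"] s1 by auto
    obtain k where k: "c = p + i * t + s * k" using c(1) by (metis cong_iff_lin cong_sym)
    have "\<exists>j. p + j * s + i * t \<in> M \<and> p + (j + 1) * s + i * t \<notin> M"
      by (rule exI[of _ "k - 1"]) (use c k in \<open>auto simp: algebra_simps\<close>)
    then have T: "p + top i * s + i * t \<in> M \<and> p + (top i + 1) * s + i * t \<notin> M"
      unfolding top_def by (rule someI_ex)
    show ?thesis
    proof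
      assume m: "p + j * s + i * t \<in> M"
      show "j \<le> top i"
      proof (rule ccontr)
        assume "\<not> j \<le> top i"
        then have "p + j * s + i * t - (j - (top i + 1)) * s \<in> M"
          by (intro core_set_iter[OF M(1) m]) simp
        then show False using T by (simp add: algebra_simps)
      qed
    next
      assume "j \<le> top i"
      then have "p + top i * s + i * t - (top i - j) * s \<in> M"
        using T by (intro core_set_iter[OF M(1)]) auto
      then show "p + j * s + i * t \<in> M" by (simp add: algebra_simps)
    qed
  qed
  \<comment> \<open>For \<open>j > top i\<close> the term \<open>j - 1\<close> is at least
    \<open>top i\<close>; for \<open>j \<le> top i\<close> the term \<open>j + 1\<close> is at most
    \<open>top i + 1\<close>. \<open>B\<close> is built from these two bounds, which gives
    \<open>f\<close> its signs. Shifting \<open>j\<close> by \<open>t\<close> adds 2 to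
    \<open>A\<close>, so \<open>f\<close> is affine up to periodic terms.\<close>
  define A where "A j = (j + 1) div t + (j - 1) div t" for j
  define B where "B i = (top i + 1) div t + top i div t" for i
  define u where "u z = J z + w z * t" for z
  have zu: "z = p + u z * s + I z * t" for z using eq[of z] by (simp add: u_def algebra_simps)
  have mem: "z \<in> M \<longleftrightarrow> u z \<le> top (I z)" for z using top[of "u z" "I z"] zu[of z] by simp
  define f where "f z = A (u z) - B (I z)" for z
  have A_shift: "A (j + v * t) = A j + 2 * v" for j v
    using t1 div_mult_self1[of t "j + 1" v] div_mult_self1[of t "j - 1" v]
    by (simp add: A_def algebra_simps)
  have fz: "(s * t) * f z = 2 * z + (s * t * A (J z) - 2 * J z * s - 2 * p) + (- (s * t * B (I z)) - 2 * I z * t)" for z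
  proof -
    have "2 * w z * (s * t) = 2 * z - 2 * p - 2 * J z * s - 2 * I z * t" using eq[of z] by simp
    then show ?thesis unfolding f_def u_def A_shift by (simp add: algebra_simps)
  qed
  have f_out: "f z \<ge> 0" if "z \<notin> M" for z
  proof -
    have "top (I z) + 1 \<le> u z" using that mem[of z] by simp
    then have "(top (I z) + 1) div t \<le> (u z + 1) div t" "top (I z) div t \<le> (u z - 1) div t"
      using t1 by (auto intro: zdiv_mono1)
    then show ?thesis by (simp add: f_def A_def B_def)
  qed
  have f_in: "f z \<le> 0" if "z \<in> M" for z
  proof -
    have "u z \<le> top (I z)" using that mem[of z] by simp
    then have "(u z + 1) div t \<le> (top (I z) + 1) div t" "(u z - 1) div t \<le> top (I z) div t"
      using t1 by (auto intro: zdiv_mono1)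
    then show ?thesis by (simp add: f_def A_def B_def)
  qed
  \<comment> \<open>On residues \<open>A\<close> is odd only at \<open>0\<close> and
    \<open>t - 1\<close>, the classes of \<open>p\<close> and \<open>bar p\<close> modulo
    \<open>t\<close>.\<close>
  have A0: "A 0 = - 1" "A (t - 1) = 1" and Ar: "\<And>j. 0 < j \<Longrightarrow> j < t - 1 \<Longrightarrow> A j = 0"
    using t1 s3 by (auto simp: A_def div_pos_pos_trivial div_eq_minus1)
  have Amid: "A (J z) = 0" if "J z \<noteq> 0" "J z \<noteq> t - 1" for z using Ar[of "J z"] bJ[of z] that by simp
  have f_w: "f z = A (J z) + 2 * w z - B (I z)" for z by (simp add: f_def u_def A_shift)
  have top0: "top 0 = - 1"
  proof -
    have "p + - 1 * s + 0 * t = bar p" using p by (simp add: bar_def)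
    then have "- 1 \<le> top 0" using top[of "-1" 0] barM by metis
    moreover have "\<not> 0 \<le> top 0" using top[of 0 0] prM by simp
    ultimately show ?thesis by simp
  qed
  have B0: "B 0 = - 1" using t1 by (simp add: B_def top0 div_eq_minus1)
  have rt: "r < t - 1" using r pr0 by simp
  \<comment> \<open>These are the rows of \<open>r\<close> and \<open>bar r\<close>. The outer
    bounds \<open>- t \<le> top (p + 1)\<close> and \<open>top p \<le> - 2\<close> express
    \<open>bar d \<in> M\<close> and \<open>d \<notin> M\<close>; this is where the assumption on
    \<open>d\<close> enters.\<close>
  have Bp1: "B (p + 1) = - 2" and Bp: "B p = - 2"
  proof -
    have B2: "B i = - 2" if "- t \<le> top i" "top i \<le> - 2" for i
    proof -
      have "(top i + 1) div t = - 1" by (rule int_div_pos_eq[where r = "top i + 1 + t"]) (use that in simp_all)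
      moreover have "top i div t = - 1" by (rule int_div_pos_eq[where r = "top i + t"]) (use that in simp_all)
      ultimately show ?thesis by (simp add: B_def)
    qed
    have "\<not> r - t \<le> top (p + 1)"
    proof -
      have "p + (r - t) * s + (p + 1) * t = r" using cr zu[of r] by (simp add: u_def)
      then show ?thesis using top[of "r - t" "p + 1"] prM by simp
    qed
    moreover have "- t \<le> top (p + 1)"
    proof -
      have "2 * (p + (- t) * s + (p + 1) * t) + 1 = (2 * p + 1) - 2 * t * s + (2 * p + 1) * t + t" by (simp add: algebra_simps)
      also have "\<dots> = - (2 * d + 1)" unfolding d p by (simp add: algebra_simps)
      finally have "p + (- t) * s + (p + 1) * t = bar d" by (simp add: bar_def)
      then show ?thesis using top[of "- t" "p + 1"] d(2) M(3) self_conj_bar by metis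
    qed
    ultimately show "B (p + 1) = - 2" using rt by (intro B2) auto
    have "r - t \<le> top p"
    proof -
      have "p + (r - t) * s + p * t = bar r" using cbr zu[of "bar r"] by (simp add: u_def)
      then show ?thesis using top[of "r - t" p] barM by simp
    qed
    moreover have "\<not> - 1 \<le> top p"
    proof -
      have "2 * (p + (- 1) * s + p * t) + 1 = (2 * p + 1) - 2 * s + (2 * p + 1) * t - t" by (simp add: algebra_simps)
      also have "\<dots> = 2 * d + 1" unfolding d p by (simp add: algebra_simps)
      finally have "p + (- 1) * s + p * t = d" by simp
      then show ?thesis using top[of "- 1" p] d(2) by simp
    qed
    ultimately show "B p = - 2" using pr0 by (intro B2) auto
  qed
  have f0: "f p = 0" "f (bar p) = 0" "f r = 0" "f (bar r) = 0"
    unfolding f_w using cp cbp cr cbr A0 B0 Bp Bp1 Ar[OF pr0(2) rt] by simp_all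
  have dXM: "dsum h X M = dsum h X L + dsum h L M" for h by (rule dsum_trans[OF XL LM(1)])
  have "(s * t) * dsum f X L = dsum (\<lambda>z. (s * t) * f z) X L" by (simp only: dsum_scale)
  also have "\<dots> = 2 * dsum (\<lambda>z. z) X L"
    unfolding fz by (rule dsum_eqv_affine2[OF X(2,3)]) (simp_all add: pI pJ)
  finally have "dsum f X L = 0" using X(4) s1 t1 by auto
  then have "dsum f X M = 0" using dXM[of f] LM(2)[of f] f0 by simp
  then have sum0: "(\<Sum>g\<in>X - M. f g - f (bar g)) = 0" by (simp only: dsum_self_conj[OF X(1) M(3)])
  define G where "G = X - M"
  have finG: "finite G" using nXM by (simp add: G_def near_def)
  have G: "g \<notin> M" "bar g \<in> M" if "g \<in> G" for g using that M(3) by (auto simp: G_def self_conj_bar)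
  have fG: "f g = 0 \<and> f (bar g) = 0" if "g \<in> G" for g
  proof -
    have "\<forall>g\<in>G. f g - f (bar g) = 0"
    proof (subst sum_nonneg_eq_0_iff[symmetric, OF finG])
      show "(\<Sum>g\<in>G. f g - f (bar g)) = 0" using sum0 by (simp only: G_def)
      show "0 \<le> f g - f (bar g)" if "g \<in> G" for g
        using f_out[OF G(1)[OF that]] f_in[OF G(2)[OF that]] by linarith
    qed
    then show ?thesis using that f_out[OF G(1)[OF that]] f_in[OF G(2)[OF that]] by force
  qed
  \<comment> \<open>A gap at index \<open>(w g + 1) * t - 1\<close> ends its row at
    \<open>(w g + 1) * t - 2\<close> or earlier, so both quotients in \<open>B\<close> are at most
    \<open>w g\<close>; with \<open>A (t - 1) = 1\<close> the potential would be positive.\<close>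
  have noT: "J g \<noteq> t - 1" if "g \<in> G" for g
  proof
    assume J: "J g = t - 1"
    have uT: "u g = (w g + 1) * t - 1" by (simp add: u_def J algebra_simps)
    have "top (I g) \<le> (w g + 1) * t - 2" using G(1)[OF that] mem[of g] uT by simp
    then have "(top (I g) + 1) div t \<le> ((w g + 1) * t - 1) div t" "top (I g) div t \<le> ((w g + 1) * t - 2) div t"
      using t1 by (auto intro: zdiv_mono1)
    moreover have "((w g + 1) * t - 1) div t = w g"
      by (rule int_div_pos_eq[where r = "t - 1"]) (use t1 in \<open>simp_all add: algebra_simps\<close>)
    moreover have "((w g + 1) * t - 2) div t = w g"
      by (rule int_div_pos_eq[where r = "t - 2"]) (use t1 in \<open>simp_all add: algebra_simps\<close>)
    ultimately have "B (I g) \<le> 2 * w g" by (simp add: B_def)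
    then show False using fG[OF that] f_w[of g] J A0 by simp
  qed
  have noT': "J (bar g) \<noteq> 0" if "g \<in> G" for g using noT[OF that] Jbar[of g] by simp
  \<comment> \<open>Counting the class of \<open>p\<close> modulo \<open>t\<close>: \<open>L\<close>
    has one bead more there than \<open>M\<close>, so \<open>X\<close> has too. Mirror images of
    added beads do not lie there, so exactly one added bead does.\<close>
  define h where "h z = (of_bool (J z = 0) :: int)" for z
  have "dsum h X L = 0" using X(3) pJ by (simp add: eqv_def h_def)
  then have "dsum h X M = 1" using dXM[of h] LM(2)[of h] cp cbp cr cbr pr0 t1 by (simp add: h_def)
  then have "(\<Sum>g\<in>G. h g) = 1"
    unfolding dsum_self_conj[OF X(1) M(3)] G_def[symmetric] using noT' by (simp add: h_def)
  moreover have "(\<Sum>g\<in>G. h g) = int (card {g \<in> G. J g = 0})"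
    by (simp add: h_def of_bool_def sum.inter_filter[OF finG, symmetric])
  ultimately have "card {g \<in> G. J g = 0} = 1" by simp
  then obtain g0 where g0: "{g \<in> G. J g = 0} = {g0}" by (rule card_1_singletonE)
  then have g0G: "g0 \<in> G" "J g0 = 0" by auto
  have g0u: "g = g0" if "g \<in> G" "J g = 0" for g using g0 that by blast
  have Bodd: "odd (B (I g0))" 
  proof -
    have "B (I g0) = 2 * w g0 - 1" using fG[OF g0G(1)] f_w[of g0] g0G(2) A0 by simp
    then show ?thesis by simp
  qed
  have Beven: "even (B (I g))" "even (B (I (bar g)))" if "g \<in> G" "g \<noteq> g0" for g
  proof -
    have "J g \<noteq> 0" "J g \<noteq> t - 1" using g0u[OF that(1)] noT[OF that(1)] that(2) by auto
    moreover from this have "J (bar g) \<noteq> 0" "J (bar g) \<noteq> t - 1" using Jbar[of g] by auto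
    ultimately have "B (I g) = 2 * w g" "B (I (bar g)) = 2 * w (bar g)"
      using fG[OF that(1)] f_w[of g] f_w[of "bar g"] Amid by simp_all
    then show "even (B (I g))" "even (B (I (bar g)))" by simp_all
  qed
  \<comment> \<open>Counting the class of \<open>g0\<close> modulo \<open>s\<close>: by parity of
    \<open>B\<close> no other added bead and no mirror image of one lies there, so
    \<open>bar g0\<close> itself must compensate \<open>g0\<close>. Only the self-dual class
    \<open>I = 0\<close> allows this.\<close>
  define k where "k z = (of_bool (I z = I g0) :: int)" for z
  have "dsum k X L = 0" using X(2) pI by (simp add: eqv_def k_def)
  moreover have "k p = k (bar p)" using cp cbp by (simp add: k_def)
  moreover have "k r = 0" "k (bar r) = 0" using cr cbr Bp Bp1 Bodd by (auto simp: k_def)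
  ultimately have "dsum k X M = 0" using dXM[of k] LM(2)[of k] by simp
  then have "(\<Sum>g\<in>G. k g - k (bar g)) = 0" unfolding dsum_self_conj[OF X(1) M(3)] G_def .
  moreover have "(\<Sum>g\<in>G. k g - k (bar g)) = (k g0 - k (bar g0)) + (\<Sum>g\<in>G - {g0}. k g - k (bar g))"
    by (rule sum.remove[OF finG g0G(1)])
  moreover have "(\<Sum>g\<in>G - {g0}. k g - k (bar g)) = 0"
  proof (rule sum.neutral, rule)
    fix g assume "g \<in> G - {g0}"
    then have "I g \<noteq> I g0" "I (bar g) \<noteq> I g0" using Beven[of g] Bodd by auto
    then show "k g - k (bar g) = 0" by (simp add: k_def)
  qed
  ultimately have "k (bar g0) = 1" by (simp add: k_def)
  then have "I (bar g0) = I g0" by (simp add: k_def split: if_splits)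
  then have Ig0: "I g0 = 0" by (rule Ibar)
  have "w g0 = 0" using fG[OF g0G(1)] f_w[of g0] g0G(2) A0 B0 Ig0 by simp
  then have "g0 = p" using eq[of g0] g0G(2) Ig0 by simp
  then have pX: "p \<in> X" using g0G by (simp add: G_def)
  define Y where "Y = (X - {p}) \<union> {bar p}"
  have Y: "self_conj Y" "near Y X" "\<And>f. dsum f Y X = f (bar p) - f p"
    using flip_single[OF X(1) pX] by (simp_all add: Y_def)
  have YM: "dsum h Y M = dsum h X L + h r - h (bar r)" for h
    using dsum_trans[OF Y(2) nXM, of h] Y(3)[of h] dXM[of h] LM(2)[of h] by simp
  have "eqv t Y M"
    unfolding eqv_def
  proof (intro conjI allI impI)
    show "near Y M" using Y(2) nXM near_trans by blast
    fix h :: "int \<Rightarrow> int" assume h: "\<forall>b. h (b + t) = h b"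
    have "h (bar r) = h r" using periodic_bar_self[OF h, of r] r by simp
    moreover have "dsum h X L = 0" using X(3) h by (simp add: eqv_def)
    ultimately show "dsum h Y M = 0" using YM[of h] by simp
  qed
  moreover have "dsum (\<lambda>z. z) Y M = t" using YM[of "\<lambda>z. z"] X(4) r by (simp add: bar_def)
  ultimately have "Y = (M - {bar r}) \<union> {r}"
    using eqv_next_size[OF _ M(2) Y(1) M(3,4) _ _ r] t1 by simp
  moreover have "X = (Y - {bar p}) \<union> {p}" using flip_back(1)[OF X(1) pX Y_def] .
  ultimately show ?thesis using ne prM by (auto simp: L)
qed

end

text \<open>For odd \<open>t\<close> the difference of the two sides is even, so the congruence
  modulo \<open>2 * s\<close> can be halved.\<close>

lemma bar_cong_half: "2 * r + 1 = t \<Longrightarrow> [bar b - b = t] (mod 2 * s) \<longleftrightarrow> [bar b = r] (mod s)"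
proof -
  assume r: "2 * r + 1 = t"
  have "bar b - b - t = 2 * (bar b - r)" using r by (simp add: bar_def)
  then show ?thesis unfolding cong_iff_dvd_diff by (metis dvd_times_left_cancel_iff zero_neq_numeral)
qed

lemma bar_cong_half_neg: "2 * p + 1 = s \<Longrightarrow> [bar c - c = - s] (mod 2 * t) \<longleftrightarrow> [c = p] (mod t)"
proof -
  assume p: "2 * p + 1 = s"
  have "bar c - c - - s = - (2 * (c - p))" using p by (simp add: bar_def)
  then show ?thesis
    unfolding cong_iff_dvd_diff by (metis dvd_minus_iff dvd_times_left_cancel_iff zero_neq_numeral)
qed

section \<open>The intermediate core of a double harpoon\<close>

context core_pair
begin

definition pair_moves :: "int \<Rightarrow> int \<Rightarrow> bool" where
  "pair_moves b c \<longleftrightarrow> b \<noteq> c \<and> b \<in> T - S \<and> c \<in> T - S \<and>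
     [bar b - b = t] (mod 2 * s) \<and> [bar c - c = - s] (mod 2 * t) \<and>
     S = (T - {b, c}) \<union> {bar b, bar c}"

text \<open>Since \<open>p\<close> and \<open>r\<close> are gaps of the cores,
  \<open>z \<le> p - t\<close> and \<open>bar z \<le> r - s\<close>, which is too small for
  \<open>z + bar z = -1\<close>.\<close>

lemma not_both_roles:
  assumes p: "2 * p + 1 = s" and r: "2 * r + 1 = t"
    and z: "z \<in> T" "bar z \<in> S" "[bar z = r] (mod s)" "[z = p] (mod t)"
  shows False
proof -
  have "z \<le> p - t"
    using core_set_below_gap[OF tT _ z(1) not_in_core(2)[OF p] z(4)] t1 by simp
  moreover have "bar z \<le> r - s"
    using core_set_below_gap[OF sS _ z(2) not_in_core(3)[OF r] z(3)] s1 by simp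
  ultimately show False using p r s1 t1 by (simp add: bar_def)
qed

lemma pair_moves_unique:
  assumes p: "2 * p + 1 = s" and r: "2 * r + 1 = t" and m: "pair_moves b c" "pair_moves b' c'"
  shows "c = c'"
proof (rule ccontr)
  assume "c \<noteq> c'"
  have "T - S \<subseteq> {b, c}" using m(1) unfolding pair_moves_def by blast
  moreover have "c' \<in> T - S" using m(2) unfolding pair_moves_def by blast
  ultimately have "c' = b" using \<open>c \<noteq> c'\<close> by blast
  then show False
    using not_both_roles[OF p r, of b] m bar_cong_half[OF r] bar_cong_half_neg[OF p] unfolding pair_moves_def by blast
qed

text \<open>Removing \<open>c\<close> from \<open>T\<close> can create a \<open>t\<close>-rise only
  at \<open>c + t\<close>. The \<open>t\<close>-core \<open>S\<close> lacks \<open>c\<close>, hence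
  also \<open>c + t\<close>, so a bead of \<open>T\<close> there would be \<open>b\<close>, which
  would play both roles. The same argument starting from \<open>S\<close> handles
  \<open>s\<close>.\<close>

lemma pair_moves_middle:
  assumes p: "2 * p + 1 = s" and r: "2 * r + 1 = t" and m: "pair_moves b c" and M: "M = (T - {c}) \<union> {bar c}"
    and d: "2 * d + 1 = s * t - s - t"
  shows "core_set s M" "core_set t M" "self_conj M" "near M {..<0}" "S = (M - {b}) \<union> {bar b}" "b \<in> M"
    "T = (M - {bar c}) \<union> {c}" "bar c \<in> M" "[bar b = r] (mod s)" "[c = p] (mod t)" "d \<notin> M"
proof -
  have bc: "b \<noteq> c" "b \<in> T" "b \<notin> S" "c \<in> T" "c \<notin> S" "S = (T - {b, c}) \<union> {bar b, bar c}"
    using m unfolding pair_moves_def by blast+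
  show br: "[bar b = r] (mod s)" and cp: "[c = p] (mod t)"
    using m bar_cong_half[OF r] bar_cong_half_neg[OF p] unfolding pair_moves_def by blast+
  have bT: "bar b \<notin> T" "bar c \<notin> T" using bc scT by (auto simp: self_conj_bar)
  have bS: "bar b \<in> S" "bar c \<in> S" using bc(6) by auto
  have "bar b \<noteq> bar c" using bc(1) by (metis bar_bar)
  then have MS: "M = (S - {bar b}) \<union> {b}" using bc bT unfolding M by auto
  note fT = flip_single[OF scT bc(4)]
  show scM: "self_conj M" using fT(1) by (simp add: M)
  show "near M {..<0}" using fT(2) nT near_trans by (metis M)
  show SM: "S = (M - {b}) \<union> {bar b}" "b \<in> M" using flip_back[OF scS bS(1)] MS by auto
  show TM: "T = (M - {bar c}) \<union> {c}" "bar c \<in> M" using flip_back[OF scT bc(4) M] by auto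
  have "c + t \<notin> T"
  proof
    assume a: "c + t \<in> T"
    have "c + t \<notin> S" using tS bc(5) by (auto simp: core_set_def) 
    then have "c + t = b" using a bc(6) t1 by auto
    then have "[b = p] (mod t)" using cp by (auto simp: cong_def)
    then show False using not_both_roles[OF p r bc(2) bS(1) br] by blast
  qed
  moreover have "2 * c + 1 \<noteq> - t"
  proof
    assume "2 * c + 1 = - t"
    then have "s = - t - 2 * (c - p)" using p by simp
    then show False using cp nts unfolding cong_iff_dvd_diff by (metis dvd_diff dvd_minus_iff dvd_mult dvd_refl)
  qed
  ultimately show tM: "core_set t M"
    using flip_rises(1,2)[OF scT bc(4) _ _ M] tT unfolding core_set_def by blast
  have bs: "bar b + s \<notin> S"
  proof
    assume a: "bar b + s \<in> S"
    have "bar b + s \<notin> T" using sT bT(1) by (auto simp: core_set_def)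
    then have "bar b + s = bar c" using a bc(6) s1 by auto
    then have "[bar c = r] (mod s)" using br by (metis cong_def mod_add_self2)
    then show False using not_both_roles[OF p r bc(4) bS(2) _ cp] by blast
  qed
  have bs': "2 * bar b + 1 \<noteq> - s"
  proof
    assume "2 * bar b + 1 = - s"
    then have "t = - s - 2 * (bar b - r)" using r by simp
    then show False using br nst unfolding cong_iff_dvd_diff by (metis dvd_diff dvd_minus_iff dvd_mult dvd_refl)
  qed
  have MS': "M = (S - {bar b}) \<union> {bar (bar b)}" using MS by simp
  show sM: "core_set s M"
    using flip_rises(1,2)[OF scS bS(1) bs bs' MS'] sS unfolding core_set_def by blast
  have nM: "p \<notin> M" "r \<notin> M" using half_notin_core sM tM scM p r by auto
  show "d \<notin> M"
  proof
    assume dM: "d \<in> M"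
    have 1: "d + t - r = r * s" "d + s - p = p * t"
    proof -
      have "2 * (d + t - r) = s * (2 * r + 1) - s" "2 * (d + s - p) = (2 * p + 1) * t - t"
        using d p r by (simp_all add: algebra_simps)
      then show "d + t - r = r * s" "d + s - p = p * t" by (simp_all add: algebra_simps)
    qed
    \<comment> \<open>By \<open>d + t = r + r * s\<close> and \<open>d + s = p + p * t\<close>, a
      bead at either place would bring \<open>r\<close> or \<open>p\<close> into the core.\<close>
    have "d + t \<notin> M"
    proof
      assume "d + t \<in> M"
      then have "d + t - r * s \<in> M" using core_set_iter[OF sM] r t1 by auto
      moreover have "d + t - r * s = r" using 1(1) by linarith
      ultimately show False using nM by simp
    qed
    then have dt: "bar d - t \<in> M" using scM self_conj_bar[of M "d + t"] by (simp add: bar_def algebra_simps)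
    have "d + s \<notin> M"
    proof
      assume "d + s \<in> M"
      then have "d + s - p * t \<in> M" using core_set_iter[OF tM] p s1 by auto
      moreover have "d + s - p * t = p" using 1(2) by linarith
      ultimately show False using nM by simp
    qed
    then have ds: "bar d - s \<in> M" using scM self_conj_bar[of M "d + s"] by (simp add: bar_def algebra_simps)
    have dn: "bar d \<notin> M" using dM scM by (simp add: self_conj_bar)
    have bd: "[bar d = p] (mod t)" "[bar d = r] (mod s)"
    proof -
      have "bar d - p = - (d + s - p) + (s - 2 * p - 1)" by (simp add: bar_def)
      then have "bar d - p = - (p * t)" unfolding 1 using p by linarith
      then show "[bar d = p] (mod t)" by (simp add: cong_iff_dvd_diff)
      have "bar d - r = - (d + t - r) + (t - 2 * r - 1)" by (simp add: bar_def)
      then have "bar d - r = - (r * s)" unfolding 1 using r by linarith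
      then show "[bar d = r] (mod s)" by (simp add: cong_iff_dvd_diff)
    qed
    \<comment> \<open>Thus \<open>bar d\<close> is the first gap of \<open>M\<close> both in the
      class of \<open>p\<close> modulo \<open>t\<close>, where \<open>c\<close> is, and in the class
      of \<open>r\<close> modulo \<open>s\<close>, where \<open>bar b\<close> is. But
      \<open>c\<close> and \<open>bar b\<close> differ, as only the latter lies in
      \<open>S\<close>.\<close>
    have "c - t \<in> T" using tT bc(4) by (simp add: core_set_def)
    then have "c - t \<in> M" using t1 by (simp add: M)
    moreover have "c \<notin> M" unfolding M by simp
    ultimately have "c = bar d"
      using core_set_gap_unique[OF tM _ _ _ dn dt] t1 cong_trans[OF cp cong_sym[OF bd(1)]] by simp
    have "bar b - s \<in> S" using sS bS(1) by (simp add: core_set_def)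
    then have "bar b - s \<in> M" using s1 by (simp add: MS)
    moreover have "bar b \<notin> M" unfolding MS by simp
    ultimately have "bar b = bar d"
      using core_set_gap_unique[OF sM _ _ _ dn ds] s1 cong_trans[OF br cong_sym[OF bd(2)]] by simp
    then show False using \<open>c = bar d\<close> bS(1) bc(5) by simp
  qed
qed

end

section \<open>The largest simultaneous core\<close>

lemma sum_periodic_shift:
  fixes M :: "nat \<Rightarrow> int"
  assumes "\<And>v. M (v + n) = M v"
  shows "(\<Sum>v<n. M (v + d)) = (\<Sum>v<n. M v)"
proof (induction d)
  case (Suc d)
  have "(\<Sum>v<n. M (v + Suc d)) = (\<Sum>v<n. M (Suc v + d))" by simp
  also have "\<dots> = (\<Sum>v<Suc n. M (v + d)) - M d"
    by (subst sum.lessThan_Suc_shift) simp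
  also have "\<dots> = (\<Sum>v<n. M (v + d))" using assms[of d] by (simp add: add.commute)
  finally show ?case using Suc by simp
qed simp

text \<open>The linear terms cancel for each \<open>d\<close> by shift invariance, and summing over
  all \<open>d\<close> turns the mixed products \<open>M v * M (v + d)\<close> into the square of
  the total.\<close>

lemma cyclic_square_sum:
  fixes M :: "nat \<Rightarrow> int"
  assumes per: "\<And>v. M (v + n) = M v"
  shows "(\<Sum>d<n. \<Sum>v<n. (a d - (M v - M (v + d))) * ((M v - M (v + d)) + b d))
    = (\<Sum>d<n. int n * (a d * b d)) - 2 * int n * (\<Sum>v<n. (M v)\<^sup>2) + 2 * (\<Sum>v<n. M v)\<^sup>2"
proof -
  define S where "S = (\<Sum>v<n. M v)"
  define Q where "Q = (\<Sum>v<n. (M v)\<^sup>2)"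
  have sh: "(\<Sum>v<n. M (v + d)) = S" for d using sum_periodic_shift[of M n d, OF per] by (simp add: S_def)
  have sh2: "(\<Sum>v<n. (M (v + d))\<^sup>2) = Q" for d
    using sum_periodic_shift[of "\<lambda>v. (M v)\<^sup>2" n d] per by (simp add: Q_def)
  have inner: "(\<Sum>v<n. (a d - (M v - M (v + d))) * ((M v - M (v + d)) + b d))
      = int n * (a d * b d) - 2 * Q + 2 * (\<Sum>v<n. M v * M (v + d))" for d
  proof -
    have "(\<Sum>v<n. (a d - (M v - M (v + d))) * ((M v - M (v + d)) + b d))
      = (\<Sum>v<n. a d * b d + (a d - b d) * M v - (a d - b d) * M (v + d) - (M v)\<^sup>2 - (M (v + d))\<^sup>2 + 2 * (M v * M (v + d)))"
      by (intro sum.cong) (auto simp: algebra_simps power2_eq_square)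
    also have "\<dots> = int n * (a d * b d) + (a d - b d) * S - (a d - b d) * S - Q - Q + 2 * (\<Sum>v<n. M v * M (v + d))"
      by (simp add: sum.distrib sum_subtractf sum_distrib_left[symmetric] sh sh2 S_def[symmetric] Q_def[symmetric])
    finally show ?thesis by simp
  qed
  have "(\<Sum>d<n. \<Sum>v<n. M v * M (v + d)) = (\<Sum>v<n. M v * (\<Sum>d<n. M (v + d)))"
    by (subst sum.swap) (simp add: sum_distrib_left)
  also have "\<dots> = (\<Sum>v<n. M v * S)" using sh by (simp add: add.commute)
  also have "\<dots> = S\<^sup>2" by (simp add: sum_distrib_right[symmetric] S_def power2_eq_square)
  finally have cross: "(\<Sum>d<n. \<Sum>v<n. M v * M (v + d)) = S\<^sup>2" .
  show ?thesis
    unfolding inner by (simp add: sum.distrib sum_subtractf sum_distrib_left[symmetric] cross S_def[symmetric] Q_def[symmetric])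
qed

text \<open>The second bound is the first one, applied to the remaining \<open>n - d\<close> steps
  around the cycle.\<close>

lemma cyclic_steps:
  fixes M :: "nat \<Rightarrow> int"
  assumes per: "\<And>v. M (v + n) = M v" and step: "\<And>v. M (Suc v) \<ge> M v - T" and "d \<le> n"
  shows "M v - M (v + d) \<le> T * int d" "M (v + d) - M v \<le> T * (int n - int d)"
proof -
  have *: "M v - M (v + d) \<le> T * int d" for v d
  proof (induction d)
    case (Suc d)
    then show ?case using step[of "v + d"] by (simp add: algebra_simps)
  qed simp
  show "M v - M (v + d) \<le> T * int d" by (rule *)
  have "v + d + (n - d) = v + n" using assms(3) by simp
  then show "M (v + d) - M v \<le> T * (int n - int d)"
    using *[of "v + d" "n - d"] per[of v] assms(3) by (simp add: of_nat_diff)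
qed

text \<open>Sum \<open>(2 t d - D) (D + 2 t (n - d)) \<ge> 0\<close> over all differences \<open>D = M v - M (v + d)\<close>; for \<open>K\<close>,
  continued periodically, every summand vanishes.\<close>

lemma cyclic_square_bound:
  fixes M :: "nat \<Rightarrow> int"
  assumes per: "\<And>v. M (v + n) = M v" and step: "\<And>v. M (Suc v) \<ge> M v - 2 * t" and "n > 0" "t > 0"
    and zero: "(\<Sum>v<n. M v) = 0"
  defines "K \<equiv> \<lambda>v. t * (int n - 1 - 2 * int v)"
  shows "(\<Sum>v<n. (M v)\<^sup>2) \<le> (\<Sum>v<n. (K v)\<^sup>2)"
    "(\<Sum>v<n. (M v)\<^sup>2) = (\<Sum>v<n. (K v)\<^sup>2) \<Longrightarrow> \<exists>v<n. M v = t * (int n - 1)"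
proof -
  define a b where "a d = 2 * t * int d" and "b d = 2 * t * (int n - int d)" for d
  define L where "L v = K (v mod n)" for v
  have Lper: "L (v + n) = L v" for v by (simp add: L_def)
  have LK: "L v = K v" if "v < n" for v using that by (simp add: L_def)
  have "(\<Sum>v<n. K v) = t * (int n * (int n - 1) - 2 * (\<Sum>v<n. int v))"
    by (simp add: K_def sum_distrib_left[symmetric] sum_subtractf) 
  moreover have "2 * (\<Sum>v<n. int v) = int n * (int n - 1)"
    by (induction n) (auto simp: algebra_simps)
  ultimately have K0: "(\<Sum>v<n. L v) = 0" using LK by simp
  have L_end: "(a d - (L v - L (v + d))) * ((L v - L (v + d)) + b d) = 0" if "v < n" "d < n" for v d
  proof (cases "v + d < n")
    case True
    then have "L v - L (v + d) = a d" using that by (simp add: LK K_def a_def algebra_simps)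
    then show ?thesis by simp
  next
    case False
    then have "(v + d) mod n = v + d - n" using that by (simp add: le_mod_geq)
    then have "L (v + d) = K (v + d - n)" by (simp add: L_def)
    then have "(L v - L (v + d)) + b d = 0" using that False
      by (simp add: LK K_def b_def algebra_simps of_nat_diff)
    then show ?thesis by simp
  qed
  have "(\<Sum>d<n. \<Sum>v<n. (a d - (L v - L (v + d))) * ((L v - L (v + d)) + b d)) = 0"
    using L_end by (intro sum.neutral ballI) auto
  then have A: "2 * int n * (\<Sum>v<n. (K v)\<^sup>2) = (\<Sum>d<n. int n * (a d * b d))"
    using cyclic_square_sum[of L n a b, OF Lper] K0 LK by simp
  let ?g = "\<lambda>d v. (a d - (M v - M (v + d))) * ((M v - M (v + d)) + b d)"
  have g0: "?g d v \<ge> 0" if "d < n" for d v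
    using cyclic_steps[of M n "2 * t" d v, OF per step] that
    by (intro mult_nonneg_nonneg) (auto simp: a_def b_def)
  have sum_g: "(\<Sum>d<n. \<Sum>v<n. ?g d v) = 2 * int n * (\<Sum>v<n. (K v)\<^sup>2) - 2 * int n * (\<Sum>v<n. (M v)\<^sup>2)"
    using cyclic_square_sum[of M n a b, OF per] zero A by simp
  have "(\<Sum>d<n. \<Sum>v<n. ?g d v) \<ge> 0" using g0 by (intro sum_nonneg) auto
  then have "int n * (\<Sum>v<n. (M v)\<^sup>2) \<le> int n * (\<Sum>v<n. (K v)\<^sup>2)" unfolding sum_g by simp
  then show "(\<Sum>v<n. (M v)\<^sup>2) \<le> (\<Sum>v<n. (K v)\<^sup>2)" using assms(3) by simp
  assume eq: "(\<Sum>v<n. (M v)\<^sup>2) = (\<Sum>v<n. (K v)\<^sup>2)"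
  then have "(\<Sum>d<n. \<Sum>v<n. ?g d v) = 0" unfolding sum_g by simp
  then have "\<forall>d\<in>{..<n}. (\<Sum>v<n. ?g d v) = 0"
    using g0 by (subst (asm) sum_nonneg_eq_0_iff) (auto intro!: sum_nonneg)
  then have gz: "?g d v = 0" if "d < n" "v < n" for d v
    using g0 that sum_nonneg_eq_0_iff[of "{..<n}" "?g d"] by auto
  have "\<exists>v<n. \<forall>u<n. M u \<le> M v"
  proof -
    have "Max (M ` {..<n}) \<in> M ` {..<n}" using assms(3) by (intro Max_in) auto
    then obtain v where "v < n" "M v = Max (M ` {..<n})" by auto
    then show ?thesis by (intro exI[of _ v]) auto
  qed
  then obtain v where v: "v < n" "\<And>u. u < n \<Longrightarrow> M u \<le> M v" by blast
  have maxv: "M u \<le> M v" for u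
  proof -
    have "M (u mod n + k * n) = M (u mod n)" for k
    proof (induction k)
      case (Suc k)
      then show ?case using per[of "u mod n + k * n"] by (simp add: algebra_simps)
    qed simp
    from this[of "u div n"] have "M u = M (u mod n)" by simp
    then show ?thesis using v(2)[of "u mod n"] assms(3) by simp
  qed
  \<comment> \<open>At a maximum the difference is nonnegative, so the second factor is positive and
    the first one must vanish. Summing over \<open>d\<close> then gives the value of the
    maximum.\<close>
  have "M v - M (v + d) = a d" if "d < n" for d
  proof -
    have "b d > 0" using that assms(4) by (simp add: b_def)
    moreover have "M v - M (v + d) \<ge> 0" using maxv by simp
    ultimately have "M v - M (v + d) + b d \<noteq> 0" by linarith
    then show ?thesis using gz[OF that v(1)] by simp
  qed
  then have "(\<Sum>d<n. M v - M (v + d)) = (\<Sum>d<n. a d)" by (intro sum.cong) auto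
  moreover have "(\<Sum>d<n. M v - M (v + d)) = int n * M v"
    using sum_periodic_shift[of M n v, OF per] zero by (simp add: sum_subtractf add.commute)
  moreover have "(\<Sum>d<n. a d) = int n * (t * (int n - 1))"
  proof -
    have "2 * (\<Sum>d<n. int d) = int n * (int n - 1)" by (induction n) (auto simp: algebra_simps)
    then have "t * (2 * (\<Sum>d<n. int d)) = t * (int n * (int n - 1))" by simp
    moreover have "(\<Sum>d<n. a d) = 2 * t * (\<Sum>d<n. int d)" by (simp only: a_def sum_distrib_left)
    ultimately show ?thesis by (simp add: algebra_simps)
  qed
  ultimately have "M v = t * (int n - 1)" using assms(3) by simp
  then show "\<exists>v<n. M v = t * (int n - 1)" using v(1) by blast
qed

lemma sum_class_interval:
  fixes F :: "int \<Rightarrow> int"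
  assumes "s > 0" "[a = b] (mod s)" "a \<le> b"
  shows "finite {z. [z = a] (mod s) \<and> a \<le> z \<and> z < b}"
    "(\<Sum>z | [z = a] (mod s) \<and> a \<le> z \<and> z < b. F (z + s) - F z) = F b - F a"
proof -
  obtain k where k: "b = a + s * k" using assms(2) by (metis cong_iff_lin)
  then have k0: "k \<ge> 0" using assms by (simp add: zero_le_mult_iff)
  have eq: "{z. [z = a] (mod s) \<and> a \<le> z \<and> z < b} = (\<lambda>i. a + s * int i) ` {..<nat k}"
  proof (intro set_eqI iffI)
    fix z assume z: "z \<in> {z. [z = a] (mod s) \<and> a \<le> z \<and> z < b}"
    then have "[a = z] (mod s)" by (simp add: cong_sym)
    then obtain j where j: "z = a + s * j" unfolding cong_iff_lin by blast
    have "a \<le> z" "z < b" using z by auto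
    then have "0 \<le> s * j" "s * j < s * k" unfolding j k by linarith+
    then have "j \<ge> 0" "j < k" using assms(1) by (simp_all add: zero_le_mult_iff)
    then show "z \<in> (\<lambda>i. a + s * int i) ` {..<nat k}" using j by (intro image_eqI[of _ _ "nat j"]) auto
  next
    fix z assume "z \<in> (\<lambda>i. a + s * int i) ` {..<nat k}"
    then obtain i where i: "z = a + s * int i" "i < nat k" by blast
    then have "s * int i < s * k" using assms(1) by simp
    then show "z \<in> {z. [z = a] (mod s) \<and> a \<le> z \<and> z < b}"
      using assms(1) k i by (simp add: cong_iff_dvd_diff)
  qed
  show "finite {z. [z = a] (mod s) \<and> a \<le> z \<and> z < b}" unfolding eq by simp
  have inj: "inj_on (\<lambda>i. a + s * int i) A" for A using assms(1) by (auto simp: inj_on_def)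
  have "(\<Sum>i<m. F (a + s * int i + s) - F (a + s * int i)) = F (a + s * int m) - F a" for m
    by (induction m) (auto simp: algebra_simps)
  from this[of "nat k"] show "(\<Sum>z | [z = a] (mod s) \<and> a \<le> z \<and> z < b. F (z + s) - F z) = F b - F a"
    unfolding eq sum.reindex[OF inj] using k k0 by simp
qed

lemma negatives_self_conj: "self_conj {..<0}"
  by (auto simp: self_conj_def bar_def)

lemma self_conj_charge: "self_conj A \<Longrightarrow> dsum (\<lambda>_. 1) A {..<0} = 0"
  by (simp add: dsum_self_conj[OF _ negatives_self_conj])

context coprime_pair
begin

lemma class_cover:
  obtains v where "v < nat s" "[z = e - int v * t] (mod s)"
proof -
  have "coprime t s" using cop by (simp add: coprime_commute)
  then obtain u where u: "[t * u = 1] (mod s)" using cong_solve_coprime_int by blast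
  define x where "x = ((e - z) * u) mod s"
  have x: "0 \<le> x" "x < s" using s1 by (auto simp: x_def)
  have "[x * t = ((e - z) * u) * t] (mod s)" unfolding x_def by (simp add: cong_def mod_mult_left_eq)
  also have "[((e - z) * u) * t = (e - z) * (t * u)] (mod s)" by (simp add: ac_simps)
  also have "[(e - z) * (t * u) = (e - z) * 1] (mod s)" by (rule cong_scalar_left[OF u])
  finally have "s dvd x * t - (e - z)" by (simp add: cong_iff_dvd_diff)
  moreover have "z - (e - x * t) = x * t - (e - z)" by simp
  ultimately have "[z = e - int (nat x) * t] (mod s)" using x by (simp only: cong_iff_dvd_diff nat_0_le)
  then show ?thesis using that[of "nat x"] x by simp
qed

lemma class_inj:
  assumes "v < nat s" "w < nat s" "[e - int v * t = e - int w * t] (mod s)"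
  shows "v = w"
proof -
  have "s dvd (e - int v * t) - (e - int w * t)" using assms(3) by (simp only: cong_iff_dvd_diff)
  moreover have "(e - int v * t) - (e - int w * t) = t * (int w - int v)" by (simp add: algebra_simps)
  ultimately have "s dvd int w - int v" using cop by (simp add: coprime_dvd_mult_right_iff)
  then have "int w mod s = int v mod s" by (simp add: mod_eq_dvd_iff)
  then show ?thesis using assms(1,2) by simp
qed

text \<open>In each class \<open>A - B\<close> is an interval between the two first gaps, over which
  \<open>F (z + s) - F z\<close> telescopes. The enumeration \<open>e - v * t\<close> makes
  subtraction of \<open>t\<close> a step from \<open>v\<close> to \<open>v + 1\<close>.\<close>

lemma sum_core_diff:
  assumes A: "core_set s A" and B: "core_set s B"
    and a: "\<And>v. [a v = e - int v * t] (mod s)" "\<And>v. a v \<notin> A" "\<And>v. a v - s \<in> A"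
    and b: "\<And>v. [b v = e - int v * t] (mod s)" "\<And>v. b v \<notin> B" "\<And>v. b v - s \<in> B"
  shows "(\<Sum>z\<in>A - B. F (z + s) - F z) = (\<Sum>v<nat s. if b v \<le> a v then F (a v) - F (b v) else (0::int))"
proof -
  define C where "C v = {z. [z = b v] (mod s) \<and> b v \<le> z \<and> z < a v}" for v
  have ab: "[b v = a v] (mod s)" for v using a(1) b(1) cong_sym cong_trans by blast
  have zC: "z \<in> A - B \<longleftrightarrow> z \<in> C v" if "[z = e - int v * t] (mod s)" for z v
  proof -
    have "[z = a v] (mod s)" "[z = b v] (mod s)" using that a(1) b(1) cong_sym cong_trans by blast+
    then show ?thesis using core_set_less_gap[OF A _ a(2,3)] core_set_less_gap[OF B _ b(2,3)] s1 by (auto simp: C_def)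
  qed
  have Ccl: "[z = e - int v * t] (mod s)" if "z \<in> C v" for z v
    using that b(1) cong_trans unfolding C_def by blast
  have un: "A - B = (\<Union>v\<in>{..<nat s}. C v)"
  proof (intro set_eqI iffI)
    fix z assume z: "z \<in> A - B"
    obtain v where "v < nat s" "[z = e - int v * t] (mod s)" using class_cover by blast
    then show "z \<in> (\<Union>v\<in>{..<nat s}. C v)" using zC z by blast
  next
    fix z assume "z \<in> (\<Union>v\<in>{..<nat s}. C v)"
    then show "z \<in> A - B" using zC Ccl by blast
  qed
  have C0: "C v = {}" if "\<not> b v \<le> a v" for v using that by (auto simp: C_def)
  have fin: "finite (C v)" for v
    using sum_class_interval(1)[OF _ ab] s1 C0 by (cases "b v \<le> a v") (auto simp: C_def)
  have sumC: "(\<Sum>z\<in>C v. F (z + s) - F z) = (if b v \<le> a v then F (a v) - F (b v) else 0)" for v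
  proof (cases "b v \<le> a v")
    case True
    then show ?thesis using sum_class_interval(2)[OF _ ab True, of F] s1 by (simp add: C_def)
  next
    case False
    then show ?thesis using C0 by simp
  qed
  have disj: "\<forall>v\<in>{..<nat s}. \<forall>w\<in>{..<nat s}. v \<noteq> w \<longrightarrow> C v \<inter> C w = {}"
  proof (intro ballI impI)
    fix v w assume vw: "v \<in> {..<nat s}" "w \<in> {..<nat s}" "v \<noteq> w"
    have False if "z \<in> C v" "z \<in> C w" for z
    proof -
      have "[e - int v * t = e - int w * t] (mod s)" by (rule cong_trans[OF cong_sym[OF Ccl[OF that(1)]] Ccl[OF that(2)]])
      then show False using class_inj vw by auto
    qed
    then show "C v \<inter> C w = {}" by blast
  qed
  show ?thesis unfolding un sumC[symmetric] by (rule sum.UNION_disjoint) (use fin disj in auto)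
qed

lemma dsum_core_diff:
  assumes A: "core_set s A" and B: "core_set s B"
    and a: "\<And>v. [a v = e - int v * t] (mod s)" "\<And>v. a v \<notin> A" "\<And>v. a v - s \<in> A"
    and b: "\<And>v. [b v = e - int v * t] (mod s)" "\<And>v. b v \<notin> B" "\<And>v. b v - s \<in> B"
  shows "dsum (\<lambda>z. F (z + s) - F z) A B = (\<Sum>v<nat s. F (a v) - F (b v))"
  unfolding dsum_def sum_core_diff[OF assms] sum_core_diff[OF B A b a] sum_subtractf[symmetric]
  by (intro sum.cong) auto

lemma max_core_le: "z \<in> max_core e \<Longrightarrow> z \<le> e"
  using s1 t1 by (auto simp: max_core_def) (smt (verit) mult_nonneg_nonneg)

text \<open>A simultaneous core is encoded by its first gaps \<open>g v\<close>. For the centred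
  values \<open>M v = 2 * g v + 1 - s\<close>, zero charge makes the total zero, closure under
  subtracting \<open>t\<close> limits each decrease to \<open>2 * t\<close>, and the size is a sum
  of squares up to constants, so \<open>cyclic_square_bound\<close> applies.\<close>

lemma max_core_largest:
  assumes Z: "core_set s Z" "core_set t Z" "near Z {..<0}" "dsum (\<lambda>_. 1) Z {..<0} = 0"
    and e: "2 * e + 1 = s * t - s - t"
  shows "dsum (\<lambda>z. z) (max_core e) Z \<ge> 0" "dsum (\<lambda>z. z) (max_core e) Z = 0 \<Longrightarrow> Z = max_core e"
proof -
  let ?K = "max_core e"
  define n where "n = nat s"
  have n: "int n = s" "n > 0" using s1 by (auto simp: n_def)
  have scK: "self_conj ?K" using max_core_coord[of e] e by metis
  have nK: "near ?K {..<0}" by (rule near_negatives_self_conj[OF scK max_core_le])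
  have KZ: "near ?K Z" using nK Z(3) near_trans near_sym by blast
  have one: "dsum (\<lambda>_. 1) ?K Z = 0"
    using dsum_trans[OF nK near_sym[OF Z(3)], of "\<lambda>_. 1"] self_conj_charge[OF scK] Z(4) dsum_sym[of "\<lambda>_. 1" "{..<0}" Z] by simp
  define k where "k v = e - int (v mod n) * t + s" for v
  have k: "[k v = e - int v * t] (mod s)" "k v \<notin> ?K" "k v - s \<in> ?K" for v
  proof -
    have "v = v mod n + (v div n) * n" by simp
    then have "int v = int (v mod n) + int (v div n) * s" using n by (metis of_nat_add of_nat_mult)
    then have "k v - (e - int v * t) = s * (1 + int (v div n) * t)" unfolding k_def by (simp add: algebra_simps)
    then show "[k v = e - int v * t] (mod s)" by (simp add: cong_iff_dvd_diff)
    have "k v - s = e - 0 * s - int (v mod n) * t" by (simp add: k_def)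
    moreover have "0 \<le> int (v mod n)" "(0::int) \<le> 0" by simp_all
    ultimately show "k v - s \<in> ?K" unfolding max_core_def by blast
    show "k v \<notin> ?K"
    proof
      assume "k v \<in> ?K"
      \<comment> \<open>Descending from \<open>k v\<close> in steps of \<open>t\<close> would reach
        \<open>bar e\<close>, the mirror image of the bead \<open>e\<close>.\<close>
      then have "k v - (s - 1 - int (v mod n)) * t \<in> ?K" 
      proof (rule core_set_iter[OF max_core_core(2)[of e]])
        have "v mod n < n" using n(2) by simp
        then show "0 \<le> s - 1 - int (v mod n)" using n(1) by linarith
      qed
      moreover have "k v - (s - 1 - int (v mod n)) * t = bar e"
      proof -
        have "bar e = e - (2 * e + 1)" by (simp add: bar_def)
        then show ?thesis unfolding e k_def by (simp add: algebra_simps)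
      qed
      moreover have "e \<in> ?K" unfolding max_core_def by (auto intro!: exI[of _ 0])
      ultimately show False using scK self_conj_bar by metis
    qed
  qed
  define g where "g v = (SOME c. [c = e - int v * t] (mod s) \<and> c \<notin> Z \<and> c - s \<in> Z)" for v
  have g: "[g v = e - int v * t] (mod s)" "g v \<notin> Z" "g v - s \<in> Z" for v
  proof -
    have "\<exists>c. [c = e - int v * t] (mod s) \<and> c \<notin> Z \<and> c - s \<in> Z"
      by (rule first_gap[OF Z(3), of s "e - int v * t"]) (use s1 in auto)
    then have "[g v = e - int v * t] (mod s) \<and> g v \<notin> Z \<and> g v - s \<in> Z" unfolding g_def by (rule someI_ex)
    then show "[g v = e - int v * t] (mod s)" "g v \<notin> Z" "g v - s \<in> Z" by auto
  qed
  define M where "M v = 2 * g v + 1 - s" for v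
  have per: "M (v + n) = M v" for v
  proof -
    have "[e - int (v + n) * t = e - int v * t] (mod s)"
      using n(1) by (simp add: cong_iff_dvd_diff algebra_simps)
    then have "[c = e - int (v + n) * t] (mod s) \<longleftrightarrow> [c = e - int v * t] (mod s)" for c
      using cong_trans cong_sym by blast
    then show ?thesis by (simp only: M_def g_def)
  qed
  have step: "M (Suc v) \<ge> M v - 2 * t" for v
  proof -
    have z: "g v - s - t \<in> Z" using Z(2) g(3) by (simp add: core_set_def)
    have "[g v - s - t = e - int (Suc v) * t] (mod s)"
    proof -
      have "(g v - s - t) - (e - int (Suc v) * t) = (g v - (e - int v * t)) - s" by (simp add: algebra_simps)
      then show ?thesis using g(1)[of v] unfolding cong_iff_dvd_diff by (metis dvd_diff dvd_refl)
    qed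
    then have "[g v - s - t = g (Suc v)] (mod s)" using g(1)[of "Suc v"] cong_sym cong_trans by blast
    then have "g v - s - t \<le> g (Suc v) - s" using core_set_below_gap[OF Z(1) _ z g(2)] s1 by simp
    then show ?thesis by (simp add: M_def)
  qed
  have Kv: "2 * k v + 1 - s = t * (int n - 1 - 2 * int v)" if "v < n" for v
    using that e n by (simp add: k_def algebra_simps)
  have diff: "dsum (\<lambda>z. F (z + s) - F z) ?K Z = (\<Sum>v<n. F (k v) - F (g v))" for F
    unfolding n_def by (rule dsum_core_diff[OF max_core_core(1) Z(1) k g])
  have "dsum (\<lambda>z. s * 1) ?K Z = 0" unfolding dsum_scale one by simp
  then have ones: "dsum (\<lambda>z. s) ?K Z = 0" by simp
  then have "(\<Sum>v<n. k v - g v) = 0" using diff[of "\<lambda>z. z"] by simp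
  then have "(\<Sum>v<n. (2 * k v + 1 - s) - M v) = 0"
  proof -
    assume a: "(\<Sum>v<n. k v - g v) = 0"
    have "(\<Sum>v<n. (2 * k v + 1 - s) - M v) = (\<Sum>v<n. 2 * (k v - g v))" by (intro sum.cong) (auto simp: M_def)
    also have "\<dots> = 2 * (\<Sum>v<n. k v - g v)" by (simp only: sum_distrib_left)
    finally show ?thesis using a by simp
  qed
  moreover have "(\<Sum>v<n. 2 * k v + 1 - s) = 0"
  proof -
    have "(\<Sum>v<n. 2 * k v + 1 - s) = (\<Sum>v<n. t * (int n - 1 - 2 * int v))" using Kv by simp
    also have "\<dots> = t * (int n * (int n - 1) - 2 * (\<Sum>v<n. int v))"
      by (simp add: sum_distrib_left[symmetric] sum_subtractf)
    also have "2 * (\<Sum>v<n. int v) = int n * (int n - 1)"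
      by (induction n) (auto simp: algebra_simps)
    finally show ?thesis by simp
  qed
  ultimately have zero: "(\<Sum>v<n. M v) = 0" by (simp add: sum_subtractf)
  \<comment> \<open>With \<open>F z\<close> the square of \<open>2 * z + 1 - s\<close>, the
    difference \<open>F (z + s) - F z\<close> equals \<open>8 * s * z + 4 * s\<close>; so the
    telescoped sum computes the size.\<close>
  have "dsum (\<lambda>z. (8 * s) * z + (4 * s) * 1) ?K Z = (\<Sum>v<n. (2 * k v + 1 - s)\<^sup>2 - (2 * g v + 1 - s)\<^sup>2)"
    using diff[of "\<lambda>z. (2 * z + 1 - s)\<^sup>2"] by (simp add: power2_eq_square algebra_simps)
  then have size: "8 * s * dsum (\<lambda>z. z) ?K Z = (\<Sum>v<n. (t * (int n - 1 - 2 * int v))\<^sup>2) - (\<Sum>v<n. (M v)\<^sup>2)"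
    using Kv by (simp add: dsum_add dsum_scale ones sum_subtractf M_def)
  note bd = cyclic_square_bound[of M n t, OF per step n(2) _ zero]
  have "8 * s * dsum (\<lambda>z. z) ?K Z \<ge> 0" unfolding size using bd(1) t1 by simp
  then show "dsum (\<lambda>z. z) ?K Z \<ge> 0" using s1 by (simp add: zero_le_mult_iff)
  assume "dsum (\<lambda>z. z) ?K Z = 0"
  then obtain v where v: "v < n" "M v = t * (int n - 1)" using bd(2) t1 size by auto
  \<comment> \<open>The extremal value puts \<open>e\<close> into \<open>Z\<close>, hence all of
    \<open>max_core e\<close>; equal charges leave no further beads.\<close>
  then have "g v = e + s" using e n by (simp add: M_def algebra_simps)
  then have "e \<in> Z" using g(3)[of v] by simp
  then have sub: "?K \<subseteq> Z" using max_core_least[OF Z(1,2)] by blast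
  then have "dsum (\<lambda>_. 1) ?K Z = - int (card (Z - ?K))" by (simp add: dsum_def Diff_eq_empty_iff[THEN iffD2])
  then have "card (Z - ?K) = 0" using one by simp
  then have "Z - ?K = {}" using KZ by (simp add: near_def)
  then show "Z = ?K" using sub by blast
qed

end

section \<open>Beta-sets of partitions\<close>

definition bead :: "(nat \<Rightarrow> nat) \<Rightarrow> nat \<Rightarrow> int" where
  "bead l r = int (l r) - (int r + 1)"

lemma beta_set_bead: "beta_set l = range (bead l)"
  by (auto simp: beta_set_def bead_def)

lemma bead_less:
  assumes "is_partition l" "i < j"
  shows "bead l j < bead l i"
proof -
  have "l j \<le> l i" using assms by (simp add: is_partition_def antimonoD)
  then show ?thesis using assms(2) by (simp add: bead_def)
qed

lemma bead_less_iff: "is_partition l \<Longrightarrow> bead l j < bead l i \<longleftrightarrow> i < j"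
  by (metis bead_less linorder_neqE_nat order_less_asym order_less_irrefl)

lemma bead_inj: "is_partition l \<Longrightarrow> inj (bead l)"
  by (rule injI) (metis bead_less linorder_neqE_nat order_less_irrefl)

lemma partition_support:
  assumes "is_partition l"
  obtains R where "\<And>r. r \<ge> R \<Longrightarrow> l r = 0"
proof -
  have "finite {r. l r \<noteq> 0}" using assms by (simp add: is_partition_def)
  then obtain R where "\<forall>r\<in>{r. l r \<noteq> 0}. r < R" using finite_nat_set_iff_bounded by blast
  then show ?thesis using that[of R] by force
qed

lemma dsum_common_tail:
  assumes "finite A" "finite B" "A \<inter> T = {}" "B \<inter> T = {}"
  shows "dsum f (A \<union> T) (B \<union> T) = sum f A - sum f B" "near (A \<union> T) (B \<union> T)"
proof -
  have eq: "(A \<union> T) - (B \<union> T) = A - B" "(B \<union> T) - (A \<union> T) = B - A" using assms by auto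
  show "near (A \<union> T) (B \<union> T)" using assms by (simp add: near_def eq)
  have "sum f A = sum f (A \<inter> B) + sum f (A - B)" "sum f B = sum f (B \<inter> A) + sum f (B - A)"
    using assms by (simp_all add: sum.Int_Diff)
  then show "dsum f (A \<union> T) (B \<union> T) = sum f A - sum f B" by (simp add: dsum_def eq Int_commute)
qed

lemma beta_set_split:
  assumes "\<And>r. r \<ge> R \<Longrightarrow> l r = 0"
  shows "beta_set l = bead l ` {..<R} \<union> {..< - int R}"
proof (intro set_eqI iffI)
  fix z assume "z \<in> beta_set l"
  then obtain r where r: "z = bead l r" by (auto simp: beta_set_bead)
  show "z \<in> bead l ` {..<R} \<union> {..< - int R}"
    using r assms[of r] by (cases "r < R") (auto simp: bead_def)
next
  fix z assume z: "z \<in> bead l ` {..<R} \<union> {..< - int R}"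
  show "z \<in> beta_set l"
  proof (cases "z < - int R")
    case True
    then have "z = bead l (nat (- z - 1))" using assms[of "nat (- z - 1)"] by (auto simp: bead_def)
    then show ?thesis by (simp add: beta_set_bead)
  next
    case False
    then show ?thesis using z by (auto simp: beta_set_bead)
  qed
qed

lemma psize_sum: "(\<And>r. r \<ge> R \<Longrightarrow> l r = 0) \<Longrightarrow> psize l = (\<Sum>r<R. l r)"
proof -
  assume R: "\<And>r. r \<ge> R \<Longrightarrow> l r = 0"
  have "r < R" if "l r \<noteq> 0" for r using R[of r] that by (cases "r < R") auto
  then show ?thesis unfolding psize_def by (intro sum.mono_neutral_left) auto
qed

lemma beta_set_negatives:
  assumes "is_partition l"
  shows "near (beta_set l) {..<0}" "dsum (\<lambda>_. 1) (beta_set l) {..<0} = 0"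
    "dsum (\<lambda>z. z) (beta_set l) {..<0} = int (psize l)"
proof -
  obtain R where R: "\<And>r. r \<ge> R \<Longrightarrow> l r = 0" using partition_support[OF assms] by blast
  let ?A = "bead l ` {..<R}" and ?B = "bead (\<lambda>_. 0) ` {..<R}"
  have spl: "beta_set l = ?A \<union> {..< - int R}" by (rule beta_set_split) (rule R)
  have psz: "psize l = (\<Sum>r<R. l r)" by (rule psize_sum) (rule R)
  have N: "{..<0} = ?B \<union> {..< - int R}"
    using beta_set_split[of R "\<lambda>_. 0"] beta_set_split[of 0 "\<lambda>_. 0"] by simp
  have d: "?A \<inter> {..< - int R} = {}" "?B \<inter> {..< - int R} = {}" by (auto simp: bead_def)
  note * = dsum_common_tail[OF _ _ d]
  have injA: "inj_on (bead l) {..<R}" using bead_inj[OF assms] inj_on_subset by blast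
  have injB: "inj_on (bead (\<lambda>_. 0)) {..<R}" by (auto simp: inj_on_def bead_def)
  show "near (beta_set l) {..<0}" unfolding spl N by (rule *) auto
  have D: "dsum f (beta_set l) {..<0} = (\<Sum>r<R. f (bead l r)) - (\<Sum>r<R. f (bead (\<lambda>_. 0) r))" for f
    unfolding spl N using *(1)[of f] by (simp add: sum.reindex[OF injA] sum.reindex[OF injB])
  show "dsum (\<lambda>_. 1) (beta_set l) {..<0} = 0" unfolding D by simp
  show "dsum (\<lambda>z. z) (beta_set l) {..<0} = int (psize l)"
    unfolding D psz sum_subtractf[symmetric] by (simp add: bead_def)
qed

lemma psize_dsum:
  assumes "is_partition l" "is_partition m"
  shows "int (psize l) = int (psize m) + dsum (\<lambda>z. z) (beta_set l) (beta_set m)"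
proof -
  note L = beta_set_negatives[OF assms(1)] and M = beta_set_negatives[OF assms(2)]
  show ?thesis using dsum_trans[OF L(1) near_sym[OF M(1)], of "\<lambda>z. z"] L(3) M(3)
      dsum_sym[of "\<lambda>z. z" "{..<0}" "beta_set m"] by simp
qed

lemma beads_above:
  assumes "is_partition l"
  shows "card {b \<in> beta_set l. b > bead l r} = r" "finite {b \<in> beta_set l. b > bead l r}"
proof -
  have "{b \<in> beta_set l. b > bead l r} = bead l ` {..<r}"
    using bead_less_iff[OF assms] by (auto simp: beta_set_bead)
  moreover have "inj_on (bead l) {..<r}" using bead_inj[OF assms] inj_on_subset by blast
  ultimately show "card {b \<in> beta_set l. b > bead l r} = r" "finite {b \<in> beta_set l. b > bead l r}"
    by (simp_all add: card_image)
qed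

text \<open>Exactly \<open>r\<close> beads lie above the bead of row \<open>r\<close>, so the set
  determines the bead of every row.\<close>

lemma beta_set_inject:
  assumes "is_partition l" "is_partition m" "beta_set l = beta_set m"
  shows "l = m"
proof
  fix r
  have *: "\<not> bead l r < bead m r" if l: "is_partition l" "is_partition m" "beta_set l = beta_set m" for l m
  proof
    assume a: "bead l r < bead m r"
    have "insert (bead m r) {b \<in> beta_set m. b > bead m r} \<subseteq> {b \<in> beta_set l. b > bead l r}"
      using a l(3) by (auto simp: beta_set_bead)
    then have "card (insert (bead m r) {b \<in> beta_set m. b > bead m r}) \<le> r"
      using card_mono[OF beads_above(2)[OF l(1), of r]] beads_above(1)[OF l(1), of r] by metis
    then show False using beads_above[OF l(2), of r] by simp
  qed
  have "bead l r = bead m r" using *[of l m] *[of m l] assms by force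
  then show "l r = m r" by (simp add: bead_def)
qed

text \<open>Zero charge means that the window from \<open>- N\<close> to \<open>N - 1\<close> holds
  exactly \<open>N\<close> beads. In decreasing order they are the beads of the first
  \<open>N\<close> rows; all later rows are empty.\<close>

lemma partition_exists:
  assumes "near B {..<0}" "dsum (\<lambda>_. 1) B {..<0} = 0"
  obtains l where "is_partition l" "beta_set l = B"
proof -
  obtain N where N: "N > 0" "\<And>b. b \<ge> N \<Longrightarrow> b \<notin> B" "\<And>b. b < - N \<Longrightarrow> b \<in> B"
    using near_negatives_bound[OF assms(1)] by blast
  define F where "F = B \<inter> {- N..<N}"
  define n where "n = nat N"
  have n: "int n = N" using N by (simp add: n_def)
  have BF: "B = F \<union> {..< - N}"
  proof (intro set_eqI iffI)
    fix z assume "z \<in> B"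
    then show "z \<in> F \<union> {..< - N}" using N(2)[of z] by (cases "z < - N"; cases "z \<ge> N") (auto simp: F_def)
  qed (use N(3) in \<open>auto simp: F_def\<close>)
  have fin: "finite F" by (simp add: F_def)
  have neg: "{..<0} = {- N..<0} \<union> {..< - N}" using N(1) by auto
  have "F \<inter> {..< - N} = {}" "{- N..<0} \<inter> {..< - N} = {}" by (auto simp: F_def)
  then have "dsum (\<lambda>_. 1) (F \<union> {..< - N}) ({- N..<0} \<union> {..< - N}) = sum (\<lambda>_. 1) F - sum (\<lambda>_. 1) {- N..<0}"
    using fin by (intro dsum_common_tail) auto
  then have "dsum (\<lambda>_. 1) B {..<0} = int (card F) - int (card {- N..<0})"
    unfolding BF[symmetric] neg[symmetric] by simp
  then have cF: "card F = n" using assms(2) N(1) by (simp add: n_def)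
  define xs where "xs = sorted_list_of_set F"
  have xs: "length xs = n" "set xs = F" "sorted_wrt (<) xs" using fin cF by (simp_all add: xs_def)
  have mono: "xs ! i < xs ! j" if "i < j" "j < n" for i j using sorted_wrt_nth_less[OF xs(3)] that xs(1) by simp
  have low: "xs ! i \<ge> - N + int i" if "i < n" for i
    using that
  proof (induction i)
    case 0
    then have "xs ! 0 \<in> F" using xs by (metis nth_mem)
    then show ?case by (simp add: F_def)
  next
    case (Suc i)
    then show ?case using mono[of i "Suc i"] by simp
  qed
  define l where "l r = (if r < n then nat (xs ! (n - 1 - r) + int r + 1) else 0)" for r
  have lb: "bead l r = xs ! (n - 1 - r)" if "r < n" for r
    using low[of "n - 1 - r"] that n by (simp add: bead_def l_def of_nat_diff)
  have "l (Suc r) \<le> l r" for r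
  proof (cases "Suc r < n")
    case True
    then have "xs ! (n - 1 - Suc r) < xs ! (n - 1 - r)" by (intro mono) auto
    then show ?thesis using True by (simp add: l_def)
  next
    case False
    then show ?thesis by (simp add: l_def)
  qed
  then have "antimono l" by (simp add: antimono_iff_le_Suc)
  moreover have "{r. l r \<noteq> 0} \<subseteq> {..<n}" by (auto simp: l_def)
  then have "finite {r. l r \<noteq> 0}" using finite_subset by blast
  ultimately have "is_partition l" by (simp add: is_partition_def)
  moreover have "beta_set l = B"
  proof -
    have "beta_set l = bead l ` {..<n} \<union> {..< - int n}" by (rule beta_set_split) (simp add: l_def)
    also have "bead l ` {..<n} = (\<lambda>r. xs ! (n - 1 - r)) ` {..<n}" using lb by simp
    also have "\<dots> = (\<lambda>i. xs ! i) ` ((\<lambda>r. n - 1 - r) ` {..<n})" by (simp add: image_image)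
    also have "(\<lambda>r. n - 1 - r) ` {..<n} = {..<n}"
    proof (intro set_eqI iffI)
      fix i assume "i \<in> {..<n}"
      then show "i \<in> (\<lambda>r. n - 1 - r) ` {..<n}" by (intro image_eqI[of _ _ "n - 1 - i"]) auto
    qed auto
    also have "(\<lambda>i. xs ! i) ` {..<n} = F" using xs(1,2) set_conv_nth[of xs] by auto
    finally show ?thesis using BF n by simp
  qed
  ultimately show ?thesis using that by blast
qed

lemma less_conjugate:
  assumes "is_partition l"
  shows "r < conjugate l c \<longleftrightarrow> c < l r"
proof -
  define A where "A = {r. l r \<ge> Suc c}"
  have "A \<subseteq> {r. l r \<noteq> 0}" by (auto simp: A_def)
  then have fin: "finite A" using assms finite_subset unfolding is_partition_def by blast
  have down: "j \<in> A" if "i \<in> A" "j \<le> i" for i j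
  proof -
    have "l i \<le> l j" using that(2) assms by (simp add: is_partition_def antimonoD)
    then show ?thesis using that(1) by (simp add: A_def)
  qed
  have "A = {..<card A}"
  proof (cases "A = {}")
    case False
    have "A = {..Max A}"
    proof (intro set_eqI iffI)
      fix x assume "x \<in> {..Max A}"
      then show "x \<in> A" using down[OF Max_in[OF fin False]] by simp
    qed (use fin in auto)
    then have "A = {..<Suc (Max A)}" by (simp add: lessThan_Suc_atMost)
    then show ?thesis by (metis card_lessThan)
  qed simp
  moreover have "conjugate l c = card A" by (simp add: conjugate_def A_def)
  ultimately have "r < conjugate l c \<longleftrightarrow> r \<in> A" by (metis lessThan_iff)
  then show ?thesis by (auto simp: A_def)
qed

lemma conjugate_partition:
  assumes "is_partition l"
  shows "is_partition (conjugate l)"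
proof -
  have "antimono (conjugate l)"
  proof (rule antimonoI)
    fix c d :: nat assume "c \<le> d"
    then have "r < conjugate l c" if "r < conjugate l d" for r
      using that less_conjugate[OF assms] by auto
    then show "conjugate l d \<le> conjugate l c" by (meson linorder_not_less order_less_irrefl)
  qed
  moreover have "{c. conjugate l c \<noteq> 0} \<subseteq> {..<l 0}"
  proof
    fix c assume "c \<in> {c. conjugate l c \<noteq> 0}"
    then have "0 < conjugate l c" by simp
    then show "c \<in> {..<l 0}" using less_conjugate[OF assms] by simp
  qed
  then have "finite {c. conjugate l c \<noteq> 0}" using finite_subset by blast
  ultimately show ?thesis by (simp add: is_partition_def)
qed

text \<open>A row and a column cannot give mirror beads, because \<open>c < l r\<close> and
  \<open>r < conjugate l c\<close> are equivalent. Conversely, a gap with \<open>r\<close> beads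
  above it belongs to a column of height \<open>r\<close>.\<close>

lemma beta_set_conjugate:
  assumes "is_partition l"
  shows "b \<in> beta_set (conjugate l) \<longleftrightarrow> bar b \<notin> beta_set l"
proof
  assume "b \<in> beta_set (conjugate l)"
  then obtain c where c: "b = bead (conjugate l) c" by (auto simp: beta_set_bead)
  show "bar b \<notin> beta_set l"
  proof
    assume "bar b \<in> beta_set l"
    then obtain r where r: "bar b = bead l r" by (auto simp: beta_set_bead)
    have "int (l r) - int r - 1 = int c - int (conjugate l c)" using r c by (simp add: bar_def bead_def)
    then show False using less_conjugate[OF assms, of r c] by linarith
  qed
next
  assume n: "bar b \<notin> beta_set l"
  obtain R where R: "\<And>r. r \<ge> R \<Longrightarrow> l r = 0" using partition_support[OF assms] by blast
  define P where "P r \<longleftrightarrow> bead l r < bar b" for r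
  have "P (R + nat \<bar>bar b\<bar>)" using R[of "R + nat \<bar>bar b\<bar>"] by (simp add: P_def bead_def)
  then have L: "P (Least P)" by (rule LeastI)
  \<comment> \<open>This is the number of beads above the gap \<open>bar b\<close>, hence the height
    of the column sought.\<close>
  define r where "r = Least P"
  have up: "bead l i > bar b" if "i < r" for i
  proof -
    have "\<not> P i" using that unfolding r_def by (rule not_less_Least)
    moreover have "bead l i \<noteq> bar b" using n by (metis beta_set_bead rangeI)
    ultimately show ?thesis by (simp add: P_def)
  qed
  define c where "c = bar b + int r"
  have c1: "int (l r) \<le> c" using L by (simp add: P_def r_def[symmetric] bead_def c_def)
  then have c0: "c \<ge> 0" by linarith
  have "conjugate l (nat c) = r"
  proof (rule ccontr)
    assume "conjugate l (nat c) \<noteq> r"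
    then consider "r < conjugate l (nat c)" | "conjugate l (nat c) < r" by linarith
    then show False
    proof cases
      case 1
      then show False using less_conjugate[OF assms] c1 by simp
    next
      case 2
      then have "bead l (r - 1) > bar b" by (intro up) simp
      then have "nat c < l (r - 1)" using 2 c0 by (simp add: bead_def c_def of_nat_diff)
      then have "r - 1 < conjugate l (nat c)" using less_conjugate[OF assms] by simp
      then show False using 2 by simp
    qed
  qed
  then have "bead (conjugate l) (nat c) = b" using c0 by (simp add: bead_def c_def bar_def)
  then show "b \<in> beta_set (conjugate l)" by (metis beta_set_bead rangeI)
qed

lemma conjugate_self_conj:
  assumes "is_partition l"
  shows "conjugate l = l \<longleftrightarrow> self_conj (beta_set l)"
proof
  assume c: "conjugate l = l"
  show "self_conj (beta_set l)" unfolding self_conj_def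
  proof
    fix b show "b \<in> beta_set l \<longleftrightarrow> bar b \<notin> beta_set l" using beta_set_conjugate[OF assms, of b] unfolding c .
  qed
next
  assume "self_conj (beta_set l)"
  then have "beta_set (conjugate l) = beta_set l"
    by (intro set_eqI) (simp add: beta_set_conjugate[OF assms] self_conj_bar)
  then show "conjugate l = l" using beta_set_inject conjugate_partition assms by blast
qed

section \<open>Rim hooks and cores\<close>

lemma psize_card_diagram:
  assumes "is_partition l"
  shows "finite (diagram l)" "card (diagram l) = psize l"
proof -
  obtain R where R: "\<And>r. r \<ge> R \<Longrightarrow> l r = 0" using partition_support[OF assms] by blast
  have "r < R" if "c < l r" for r c using R[of r] that by (cases "r < R") auto
  then have eq: "diagram l = Sigma {..<R} (\<lambda>r. {..<l r})" by (auto simp: diagram_def)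
  have "psize l = (\<Sum>r<R. l r)" by (rule psize_sum) (rule R)
  then show "finite (diagram l)" "card (diagram l) = psize l" unfolding eq by simp_all
qed

lemma diagram_le: "diagram m \<subseteq> diagram l \<longleftrightarrow> (\<forall>r. m r \<le> l r)"
proof
  assume s: "diagram m \<subseteq> diagram l"
  show "\<forall>r. m r \<le> l r"
  proof
    fix r
    have "c < l r" if "c < m r" for c using s that by (auto simp: diagram_def)
    then show "m r \<le> l r" by (meson linorder_not_less order_less_irrefl)
  qed
qed (auto simp: diagram_def intro: less_le_trans)

text \<open>Deleting the bead of row \<open>i\<close> shifts the beads of the rows \<open>i + 1, \<dots>, j\<close> up by one row.\<close>

lemma beta_set_row_shift:
  assumes l: "is_partition l" and m: "is_partition m" and ij: "i \<le> j"
    and out: "\<And>r. r < i \<or> r > j \<Longrightarrow> m r = l r"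
    and shift: "\<And>r. i \<le> r \<Longrightarrow> r < j \<Longrightarrow> m r + 1 = l (r + 1)" and lt: "m j < l j"
  shows "beta_set m = (beta_set l - {bead l i}) \<union> {bead m j}" "bead m j \<notin> beta_set l"
proof -
  have b_out: "bead m r = bead l r" if "r < i \<or> r > j" for r using out[OF that] by (simp add: bead_def)
  have b_shift: "bead m r = bead l (r + 1)" if "i \<le> r" "r < j" for r
    using shift[OF that] by (simp add: bead_def)
  have inj: "bead l x = bead l y \<longleftrightarrow> x = y" for x y using bead_inj[OF l] by (simp add: inj_eq)
  show "bead m j \<notin> beta_set l"
  proof
    assume "bead m j \<in> beta_set l"
    then obtain r where r: "bead m j = bead l r" by (auto simp: beta_set_bead)
    have "bead m j < bead l j" using lt by (simp add: bead_def)
    then have "j < r" using r bead_less_iff[OF l] by simp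
    moreover have "bead l (j + 1) < bead m j" using b_out[of "j + 1"] bead_less[OF m, of j "j + 1"] by simp
    then have "r < j + 1" using r bead_less_iff[OF l] by simp
    ultimately show False by simp
  qed
  show "beta_set m = (beta_set l - {bead l i}) \<union> {bead m j}"
  proof (intro set_eqI iffI)
    fix z assume "z \<in> beta_set m"
    then obtain r where r: "z = bead m r" by (auto simp: beta_set_bead)
    consider "r < i \<or> r > j" | "r = j" | "i \<le> r" "r < j" by linarith
    then show "z \<in> (beta_set l - {bead l i}) \<union> {bead m j}"
    proof cases
      case 1
      then have "r \<noteq> i" using ij by auto
      then show ?thesis using b_out[OF 1] r inj by (auto simp: beta_set_bead)
    next
      case 3
      then show ?thesis using b_shift[OF 3] r inj by (auto simp: beta_set_bead)
    qed (use r in auto)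
  next
    fix z assume "z \<in> (beta_set l - {bead l i}) \<union> {bead m j}"
    then consider "z = bead m j" | r where "z = bead l r" "r \<noteq> i" by (auto simp: beta_set_bead)
    then show "z \<in> beta_set m"
    proof cases
      case 1
      then show ?thesis by (simp add: beta_set_bead)
    next
      case 2
      show ?thesis
      proof (cases "r < i \<or> r > j")
        case True
        then show ?thesis using b_out[OF True] 2 by (metis beta_set_bead rangeI)
      next
        case False
        then have "i \<le> r - 1" "r - 1 < j" "r - 1 + 1 = r" using 2 by auto
        then have "bead m (r - 1) = bead l r" using b_shift[of "r - 1"] by simp
        then show ?thesis using 2 by (metis beta_set_bead rangeI)
      qed
    qed
  qed
qed

text \<open>A path from one side of the boundary below row \<open>i\<close> to the other must
  contain a vertical step.\<close>

lemma connected_crossing: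
  assumes "connected_nodes H" "x \<in> H" "y \<in> H" "fst x \<le> i" "i < fst y"
  obtains c where "(i, c) \<in> H" "(Suc i, c) \<in> H"
proof -
  define Rel where "Rel = {(u, v). u \<in> H \<and> v \<in> H \<and> adjacent u v}"
  have "(x, y) \<in> Rel\<^sup>*" using assms by (simp add: connected_nodes_def Rel_def)
  then have "\<exists>c. (i, c) \<in> H \<and> (Suc i, c) \<in> H" using assms(4,5)
  proof (induction rule: rtrancl_induct)
    case (step u v)
    show ?case
    proof (cases "i < fst u")
      case True
      then show ?thesis using step by blast
    next
      case False
      have uv: "u \<in> H" "v \<in> H" "adjacent u v" using step(2) by (auto simp: Rel_def)
      then have "fst u = i" "fst v = Suc i" "snd u = snd v"
        using False step.prems by (auto simp: adjacent_def)
      then show ?thesis using uv by (metis prod.collapse)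
    qed
  qed simp
  then show ?thesis using that by blast
qed

text \<open>Connectivity makes consecutive rows of the hook share a column, and the rim condition
  allows just one, whence \<open>m r + 1 = l (r + 1)\<close>. How far the bead moves is read off
  from the sizes.\<close>

lemma removes_rim_hook_bead:
  assumes l: "is_partition l" and rem: "removes_rim_hook s l m" and s: "s > 0"
  shows "\<exists>b \<in> beta_set l. b - int s \<notin> beta_set l \<and> beta_set m = (beta_set l - {b}) \<union> {b - int s}"
proof -
  obtain H where m: "is_partition m" and H: "H \<subseteq> rim l" "card H = s" "connected_nodes H"
    and dm: "diagram m = diagram l - H"
    using rem unfolding removes_rim_hook_def rim_hook_def by blast
  have Hl: "H \<subseteq> diagram l" using H(1) by (auto simp: rim_def)
  have H_iff: "(r, c) \<in> H \<longleftrightarrow> m r \<le> c \<and> c < l r" for r c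
  proof -
    have "H = diagram l - diagram m" using Hl dm by blast
    then show ?thesis by (auto simp: diagram_def)
  qed
  have le: "m r \<le> l r" for r using dm diagram_le[of m l] by blast
  have finH: "finite H" using H(2) s by (metis card.infinite less_irrefl)
  define I where "I = {r. m r < l r}"
  have I_fst: "I = fst ` H"
  proof (intro set_eqI iffI)
    fix r assume "r \<in> I"
    then have "(r, m r) \<in> H" by (simp add: H_iff I_def)
    then show "r \<in> fst ` H" by force
  next
    fix r assume "r \<in> fst ` H"
    then show "r \<in> I" using H_iff by (auto simp: I_def)
  qed
  have finI: "finite I" using finH by (simp add: I_fst)
  have "H \<noteq> {}" using H(2) s by auto
  then have "I \<noteq> {}" by (simp add: I_fst)
  define i j where "i = Min I" and "j = Max I"
  have ij: "i \<in> I" "j \<in> I" "i \<le> j" using finI \<open>I \<noteq> {}\<close> by (auto simp: i_def j_def)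
  have out: "m r = l r" if "r < i \<or> r > j" for r
  proof -
    have "i \<le> r \<and> r \<le> j" if "r \<in> I" for r using that finI by (simp add: i_def j_def)
    then have "r \<notin> I" using that by fastforce
    then show ?thesis using le[of r] by (simp add: I_def)
  qed
  have shift: "m r + 1 = l (r + 1)" if r: "i \<le> r" "r < j" for r
  proof -
    have "(i, m i) \<in> H" "(j, m j) \<in> H" using ij by (auto simp: H_iff I_def)
    then obtain c where c: "(r, c) \<in> H" "(Suc r, c) \<in> H"
      using connected_crossing[OF H(3), of "(i, m i)" "(j, m j)" r] r by auto
    then have "m r < l (Suc r)" "(r, m r) \<in> H" using H_iff by auto
    moreover from this have "(Suc r, Suc (m r)) \<notin> diagram l" using H(1) by (auto simp: rim_def)
    ultimately show ?thesis by (simp add: diagram_def)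
  qed
  have lt: "m j < l j" using ij by (simp add: I_def)
  have B: "beta_set m = (beta_set l - {bead l i}) \<union> {bead m j}" "bead m j \<notin> beta_set l"
    by (rule beta_set_row_shift[OF l m ij(3)]; use out shift lt in simp)+
  let ?b = "bead l i"
  have bl: "?b \<in> beta_set l" by (simp add: beta_set_bead)
  have "dsum (\<lambda>z. z) (beta_set m) (beta_set l) = bead m j - ?b"
    unfolding B(1) using dsum_exchange(1)[of "{?b}" "{bead m j}" "beta_set l"] bl B(2) by simp
  then have "int (psize m) = int (psize l) + bead m j - ?b" using psize_dsum[OF m l] by simp
  moreover have "psize l = psize m + s"
  proof -
    have "card (diagram l - H) = card (diagram l) - card H" using finH Hl by (rule card_Diff_subset)
    moreover have "card H \<le> card (diagram l)" using card_mono psize_card_diagram[OF l] Hl by blast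
    ultimately show ?thesis using psize_card_diagram(2)[OF l] psize_card_diagram(2)[OF m] dm H(2) by simp
  qed
  ultimately have "bead m j = ?b - int s" by simp
  then show ?thesis using B bl by (intro bexI[of _ ?b]) auto
qed

text \<open>On its way down to \<open>a = b - s\<close> the bead passes the beads of the rows
  \<open>i + 1\<close> to \<open>j\<close>, each of which moves up one row; the nodes lost form the
  hook.\<close>

lemma bead_removes_rim_hook:
  assumes l: "is_partition l" and s: "s > 0" and b: "b \<in> beta_set l" "b - int s \<notin> beta_set l"
  obtains m where "removes_rim_hook s l m"
proof -
  obtain i where i: "b = bead l i" using b(1) by (auto simp: beta_set_bead)
  define a where "a = b - int s"
  define A where "A = {r. a < bead l r}"
  obtain R where R: "\<And>r. r \<ge> R \<Longrightarrow> l r = 0" using partition_support[OF l] by blast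
  have "A \<subseteq> {..<R + nat \<bar>a\<bar>}"
  proof
    fix r assume "r \<in> A"
    then show "r \<in> {..<R + nat \<bar>a\<bar>}" using R[of r] by (cases "r < R") (auto simp: A_def bead_def)
  qed
  then have finA: "finite A" using finite_subset by blast
  have iA: "i \<in> A" using i s by (simp add: A_def a_def)
  define j where "j = Max A"
  have "A \<noteq> {}" using iA by blast
  then have jA: "j \<in> A" "i \<le> j" using finA iA by (auto simp: j_def)
  have ja: "a < bead l j" using jA by (simp add: A_def)
  have ja': "bead l r < a" if "j < r" for r
  proof -
    have "r \<notin> A" using that finA by (auto simp: j_def dest: Max_ge)
    moreover have "bead l r \<noteq> a" using b(2) by (metis a_def beta_set_bead rangeI)
    ultimately show ?thesis by (simp add: A_def)
  qed
  \<comment> \<open>The last clause puts the bead of row \<open>j\<close> at \<open>a\<close>;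
    adding \<open>int j + 1\<close> undoes the shift in \<open>bead\<close>.\<close>
  define m where "m r = (if r < i \<or> r > j then l r else if r < j then l (Suc r) - 1 else nat (a + int j + 1))" for r
  have l_mono: "l y \<le> l x" if "x \<le> y" for x y using l that by (simp add: is_partition_def antimonoD)
  have a_ge: "a \<ge> - int j - 1"
  proof -
    have "bead l (j + 1) < a" using ja' by simp
    then show ?thesis by (simp add: bead_def)
  qed
  have mj: "int (m j) = a + int j + 1" using jA a_ge by (simp add: m_def)
  have mj_lt: "m j < l j" using ja mj by (simp add: bead_def)
  have l_pos: "l r > 0" if "r \<le> j" for r using l_mono[OF that] mj_lt by linarith
  have lsuc: "l (Suc j) \<le> m j" using ja'[of "Suc j"] mj by (simp add: bead_def)
  have shift: "m r + 1 = l (r + 1)" if "i \<le> r" "r < j" for r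
    using that l_pos[of "Suc r"] by (simp add: m_def)
  have out: "m r = l r" if "r < i \<or> r > j" for r using that by (auto simp: m_def)
  have m_le: "m r \<le> l r" for r
  proof -
    consider "r < i \<or> r > j" | "r = j" | "i \<le> r" "r < j" by linarith
    then show ?thesis
    proof cases
      case 3
      then show ?thesis using shift[OF 3] l_mono[of r "r + 1"] by simp
    qed (use out mj_lt in auto)
  qed
  have m_suc: "m (Suc r) \<le> m r" for r
  proof -
    consider "r < i \<or> r > j" | "r = j" | "i \<le> r" "Suc r < j" | "i \<le> r" "Suc r = j" by linarith
    then show ?thesis
    proof cases
      case 1
      then show ?thesis using out[OF 1] m_le[of "Suc r"] l_mono[of r "Suc r"] by simp
    next
      case 2
      then show ?thesis using out[of "Suc j"] lsuc by simp
    next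
      case 3
      then show ?thesis using shift[of r] shift[of "Suc r"] l_mono[of "Suc r" "Suc (Suc r)"] by simp
    next
      case 4
      then show ?thesis using shift[of r] mj_lt by simp
    qed
  qed
  then have m_anti: "antimono m" by (simp add: antimono_iff_le_Suc)
  have "{r. m r \<noteq> 0} \<subseteq> {r. l r \<noteq> 0}" using m_le by (metis (mono_tags, lifting) Collect_mono le_zero_eq)
  then have m: "is_partition m" using m_anti l finite_subset unfolding is_partition_def by blast
  have B: "beta_set m = (beta_set l - {bead l i}) \<union> {bead m j}" "bead m j \<notin> beta_set l"
    by (rule beta_set_row_shift[OF l m jA(2)]; use out shift mj_lt in simp)+
  define H where "H = diagram l - diagram m"
  have sub: "diagram m \<subseteq> diagram l" using diagram_le m_le by blast
  have H_iff: "(r, c) \<in> H \<longleftrightarrow> m r \<le> c \<and> c < l r" for r c by (auto simp: H_def diagram_def)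
  have H_rows: "i \<le> r \<and> r \<le> j" if "(r, c) \<in> H" for r c
  proof (rule ccontr)
    assume "\<not> (i \<le> r \<and> r \<le> j)"
    then have "m r = l r" by (intro out) auto
    then show False using that H_iff by auto
  qed
  have rim: "H \<subseteq> rim l"
  proof
    fix x assume x: "x \<in> H"
    obtain r c where rc: "x = (r, c)" by (cases x)
    then have h: "m r \<le> c" "c < l r" "i \<le> r" "r \<le> j" using x H_iff H_rows by auto
    have "l (Suc r) \<le> Suc c"
    proof (cases "r = j")
      case True
      then show ?thesis using lsuc h by simp
    next
      case False
      then show ?thesis using shift[of r] h by simp
    qed
    then show "x \<in> rim l" using h rc by (auto simp: rim_def diagram_def)
  qed
  have "bead m j = a" using mj by (simp add: bead_def)
  have "dsum (\<lambda>z. z) (beta_set m) (beta_set l) = a - b"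
    unfolding B(1) using dsum_exchange(1)[of "{bead l i}" "{bead m j}" "beta_set l"] b i B(2) \<open>bead m j = a\<close> by simp
  then have "int (psize m) = int (psize l) - int s" using psize_dsum[OF m l] by (simp add: a_def)
  moreover have "card H = card (diagram l) - card (diagram m)"
    unfolding H_def using psize_card_diagram(1)[OF m] sub by (rule card_Diff_subset)
  ultimately have card: "card H = s" using psize_card_diagram(2)[OF l] psize_card_diagram(2)[OF m] by simp
  define Rel where "Rel = {(u, v). u \<in> H \<and> v \<in> H \<and> adjacent u v}"
  \<comment> \<open>Every node is joined to \<open>(j, m j)\<close>: left to the first hook node of
    its row, then down, since \<open>(r, m r)\<close> and \<open>(Suc r, m r)\<close> both belong to
    the hook.\<close>
  have left: "((r, m r + k), (r, m r)) \<in> Rel\<^sup>*" if "(r, m r + k) \<in> H" for r k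
    using that
  proof (induction k)
    case (Suc k)
    then have "(r, m r + k) \<in> H" using H_iff by auto
    then have "((r, m r + Suc k), (r, m r + k)) \<in> Rel" using Suc.prems by (simp add: Rel_def adjacent_def)
    then show ?case using Suc.IH \<open>(r, m r + k) \<in> H\<close> by (meson converse_rtrancl_into_rtrancl)
  qed simp
  have left': "((r, c), (r, m r)) \<in> Rel\<^sup>*" if "(r, c) \<in> H" for r c
    using left[of r "c - m r"] that H_iff[of r c] by simp
  have target: "((j - k, c), (j, m j)) \<in> Rel\<^sup>*" if "(j - k, c) \<in> H" for k c
    using that
  proof (induction k arbitrary: c)
    case 0
    then show ?case using left' by simp
  next
    case (Suc k)
    show ?case
    proof (cases "j - k = 0")
      case True
      then show ?thesis using Suc.prems Suc.IH[of c] by simp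
    next
      case False
      define r where "r = j - Suc k"
      have r: "Suc r = j - k" "r < j" using False by (auto simp: r_def)
      have "i \<le> r" using H_rows[OF Suc.prems] by (simp add: r_def)
      then have sh: "m r + 1 = l (Suc r)" using shift[of r] r by simp
      have 1: "(r, m r) \<in> H" using Suc.prems H_iff[of r c] H_iff[of r "m r"] by (simp add: r_def)
      have 2: "(Suc r, m r) \<in> H" using sh m_suc[of r] H_iff[of "Suc r" "m r"] by simp
      have "((r, c), (r, m r)) \<in> Rel\<^sup>*" using left' Suc.prems by (simp add: r_def)
      moreover have "((r, m r), (Suc r, m r)) \<in> Rel" using 1 2 by (simp add: Rel_def adjacent_def)
      moreover have "((Suc r, m r), (j, m j)) \<in> Rel\<^sup>*" using Suc.IH[of "m r"] 2 r by simp
      ultimately show ?thesis unfolding r_def[symmetric] by (meson rtrancl.rtrancl_into_rtrancl rtrancl_trans)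
    qed
  qed
  have to_end: "(x, (j, m j)) \<in> Rel\<^sup>*" if "x \<in> H" for x
  proof -
    obtain r c where rc: "x = (r, c)" by (cases x)
    then have "r \<le> j" using H_rows that by blast
    then show ?thesis using target[of "j - r" c] that rc by simp
  qed
  have "sym Rel" by (auto simp: sym_def Rel_def adjacent_def)
  then have "sym (Rel\<^sup>*)" by (rule sym_rtrancl)
  then have "connected_nodes H"
    unfolding connected_nodes_def Rel_def[symmetric] using to_end by (meson rtrancl_trans symD)
  then have "rim_hook s l H" unfolding rim_hook_def using rim card m sub by (auto simp: H_def)
  moreover have "diagram m = diagram l - H" using sub by (auto simp: H_def)
  ultimately have "removes_rim_hook s l m" using m unfolding removes_rim_hook_def by blast
  then show ?thesis by (rule that)
qed

lemma is_core_core_set: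
  assumes "s > 0"
  shows "is_core s l \<longleftrightarrow> is_partition l \<and> core_set (int s) (beta_set l)"
proof -
  have "(\<exists>H. rim_hook s l H) \<longleftrightarrow> (\<exists>m. removes_rim_hook s l m)"
    unfolding removes_rim_hook_def rim_hook_def by blast
  moreover have "(\<exists>m. removes_rim_hook s l m) \<longleftrightarrow> \<not> core_set (int s) (beta_set l)" if "is_partition l"
    using removes_rim_hook_bead[OF that _ assms] bead_removes_rim_hook[OF that assms]
    unfolding core_set_def by metis
  ultimately show ?thesis unfolding is_core_def by blast
qed

lemma removes_rim_hook_eqv:
  assumes "is_partition l" "removes_rim_hook s l m" "s > 0"
  shows "eqv (int s) (beta_set m) (beta_set l)" "psize m < psize l" "is_partition m"
proof -
  obtain b where b: "b \<in> beta_set l" "b - int s \<notin> beta_set l" "beta_set m = (beta_set l - {b}) \<union> {b - int s}"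
    using removes_rim_hook_bead[OF assms] by blast
  have D: "dsum f (beta_set m) (beta_set l) = f (b - int s) - f b" "near (beta_set m) (beta_set l)" for f
    unfolding b(3) using dsum_exchange[of "{b}" "{b - int s}" "beta_set l"] b by simp_all
  have "h (b - int s) = h b" if "\<forall>b. h (b + int s) = h b" for h :: "int \<Rightarrow> int"
    using that[rule_format, of "b - int s"] by simp
  then show "eqv (int s) (beta_set m) (beta_set l)" unfolding eqv_def D(1) using D(2) by simp
  show m: "is_partition m" using assms(2) by (simp add: removes_rim_hook_def)
  show "psize m < psize l" using psize_dsum[OF m assms(1)] D(1)[of "\<lambda>z. z"] assms(3) by simp
qed

lemma core_reachable:
  assumes "s > 0" "is_partition l"
  shows "\<exists>m. (removes_rim_hook s)\<^sup>*\<^sup>* l m \<and> is_core s m"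
  using assms(2)
proof (induction "psize l" arbitrary: l rule: less_induct)
  case less
  show ?case
  proof (cases "is_core s l")
    case True
    then show ?thesis by blast
  next
    case False
    then obtain b where "b \<in> beta_set l" "b - int s \<notin> beta_set l"
      using is_core_core_set[OF assms(1)] less.prems by (auto simp: core_set_def)
    then obtain m where m: "removes_rim_hook s l m" using bead_removes_rim_hook[OF less.prems assms(1)] by blast
    note e = removes_rim_hook_eqv[OF less.prems m assms(1)]
    obtain k where "(removes_rim_hook s)\<^sup>*\<^sup>* m k" "is_core s k" using less.hyps[OF e(2,3)] by blast
    then show ?thesis using m by (meson converse_rtranclp_into_rtranclp)
  qed
qed

lemma reachable_eqv:
  assumes "s > 0" "is_partition l" "(removes_rim_hook s)\<^sup>*\<^sup>* l m"
  shows "is_partition m \<and> eqv (int s) (beta_set l) (beta_set m)"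
  using assms(3)
proof (induction rule: rtranclp_induct)
  case base
  then show ?case using assms by simp
next
  case (step k m)
  then show ?case using removes_rim_hook_eqv[of k s m] assms(1) eqv_trans eqv_sym by blast
qed

text \<open>Hook removal preserves the class counts and a core is determined by them, so the
  description in \<open>core_of\<close> denotes a unique partition.\<close>

lemma core_of_iff:
  assumes "s > 0" "is_partition l" "is_core s m"
  shows "core_of s l = m \<longleftrightarrow> eqv (int s) (beta_set l) (beta_set m)"
proof -
  obtain k where k: "(removes_rim_hook s)\<^sup>*\<^sup>* l k" "is_core s k" using core_reachable[OF assms(1,2)] by blast
  have e: "is_partition x \<and> eqv (int s) (beta_set l) (beta_set x)" if "(removes_rim_hook s)\<^sup>*\<^sup>* l x" for x
    using reachable_eqv[OF assms(1,2) that] .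
  have uniq: "x = y" if "is_core s x" "is_core s y" "eqv (int s) (beta_set l) (beta_set x)" "eqv (int s) (beta_set l) (beta_set y)" for x y
  proof -
    have c: "is_partition x" "core_set (int s) (beta_set x)" "is_partition y" "core_set (int s) (beta_set y)"
      using that is_core_core_set[OF assms(1)] by auto
    have "eqv (int s) (beta_set x) (beta_set y)" using that eqv_sym eqv_trans by blast
    then have "beta_set x = beta_set y" using eqv_core_eq c assms(1) by auto
    then show ?thesis using beta_set_inject c by blast
  qed
  have "core_of s l = k"
    unfolding core_of_def by (rule the_equality) (use k e uniq in blast)+
  then show ?thesis using uniq[OF k(2) assms(3)] e[OF k(1)] by blast
qed

section \<open>Unique self-conjugate partitions\<close>

text \<open>The mirrored complement \<open>S'\<close> of \<open>S\<close> is again an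
  \<open>m\<close>-core, and it has the class counts of \<open>X\<close> because \<open>X\<close> is
  its own mirrored complement.\<close>

lemma self_conj_core:
  assumes "eqv m X S" "self_conj X" "core_set m S" "m > 0"
  shows "self_conj S"
proof -
  define S' where "S' = {b. bar b \<notin> S}"
  have core: "core_set m S'"
    unfolding core_set_def
  proof
    fix b assume "b \<in> S'"
    then have "bar b \<notin> S" by (simp add: S'_def)
    moreover have "bar (b - m) - m = bar b" by (simp add: bar_def)
    ultimately have "bar (b - m) \<notin> S" using assms(3) unfolding core_set_def by metis
    then show "b - m \<in> S'" by (simp add: S'_def)
  qed
  have im: "z \<in> bar ` A \<longleftrightarrow> bar z \<in> A" for z A by (metis bar_bar imageE imageI)
  have d: "S' - X = bar ` (X - S)" "X - S' = bar ` (S - X)"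
    by (intro set_eqI, simp add: im S'_def self_conj_bar[OF assms(2)] conj_commute)+
  have fin: "finite (X - S)" "finite (S - X)" using assms(1) by (auto simp: eqv_def near_def)
  have "eqv m S' X"
    unfolding eqv_def
  proof (intro conjI allI impI)
    show "near S' X" using fin by (simp add: near_def d)
    fix h :: "int \<Rightarrow> int" assume h: "\<forall>b. h (b + m) = h b"
    have "h (bar (b + m)) = h (bar b)" for b
      using h[rule_format, of "bar (b + m)"] by (simp add: bar_def)
    then have "dsum (\<lambda>b. h (bar b)) X S = 0" using assms(1) by (simp add: eqv_def)
    then show "dsum h S' X = 0" by (simp add: dsum_def d sum.reindex[OF inj_bar])
  qed
  then have "eqv m S' S" using assms(1) eqv_trans by blast
  then have "S' = S" using eqv_core_eq[OF _ core assms(3,4)] by blast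
  then show ?thesis unfolding self_conj_def S'_def by blast
qed

lemma self_conj_subset_eq:
  assumes "self_conj A" "self_conj B" "A \<subseteq> B"
  shows "A = B"
proof
  show "B \<subseteq> A"
  proof
    fix z assume "z \<in> B"
    then have "bar z \<notin> A" using assms self_conj_bar by blast
    then show "z \<in> A" using assms(1) self_conj_bar by metis
  qed
qed (rule assms(3))

context core_pair
begin

text \<open>The flip at \<open>r\<close> is invisible modulo \<open>t\<close>, and modulo
  \<open>s\<close> it moves beads congruent to those moved by the flip at \<open>b\<close>.
  Uniqueness is the case of excess \<open>t\<close> in \<open>eqv_next_size\<close>.\<close>

lemma harpoon_solution:
  assumes r: "2 * r + 1 = t" and b: "b \<in> T" "b \<notin> S" "[bar b - b = t] (mod 2 * s)" "S = (T - {b}) \<union> {bar b}"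
  defines "X0 \<equiv> (T - {bar r}) \<union> {r}"
  shows "self_conj X0" "eqv s X0 S" "eqv t X0 T" "dsum (\<lambda>z. z) X0 T = t"
    "\<And>X. self_conj X \<Longrightarrow> eqv t X X0 \<Longrightarrow> dsum (\<lambda>z. z) X X0 = 0 \<Longrightarrow> X = X0"
proof -
  have "r \<notin> T" using not_in_core(4)[OF r] .
  then have rT: "bar r \<in> T" using scT by (simp add: self_conj_bar)
  have X0: "self_conj X0" "near X0 T" "\<And>f. dsum f X0 T = f r - f (bar r)"
    using flip_single[OF scT rT] by (simp_all add: X0_def)
  have ST: "near S T" "\<And>f. dsum f S T = f (bar b) - f b"
    using flip_single[OF scT b(1)] b(4) by simp_all
  have br: "[bar b = r] (mod s)" using bar_cong_half[OF r] b(3) by blast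
  show "self_conj X0" by (rule X0)
  show "eqv s X0 S"
  proof (rule eqv_common[OF X0(2) ST(1)])
    fix h :: "int \<Rightarrow> int" assume h: "\<forall>b. h (b + s) = h b"
    show "dsum h X0 T = dsum h S T"
      unfolding X0(3) ST(2) using periodic_cong[OF h br] periodic_cong[OF h cong_bar[OF br]] by simp
  qed
  have "2 * bar r + 1 = - t" using r by (simp add: bar_def)
  then have "t dvd 2 * bar r + 1" by simp
  from flip_eqv_self_dual[OF scT rT this] show e: "eqv t X0 T" by (simp add: X0_def)
  show d: "dsum (\<lambda>z. z) X0 T = t" using X0(3)[of "\<lambda>z. z"] r by (simp add: bar_def)
  fix X assume X: "self_conj X" "eqv t X X0" "dsum (\<lambda>z. z) X X0 = 0"
  have "near X X0" using X(2) by (simp add: eqv_def)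
  then have "dsum (\<lambda>z. z) X T = t" using dsum_trans[OF _ X0(2), of X "\<lambda>z. z"] X(3) d by simp
  then show "X = X0"
    using eqv_next_size[OF eqv_trans[OF X(2) e] tT X(1) scT nT _ _ r] t1 by (simp add: X0_def)
qed

text \<open>Each modulus sees one of the two flips: modulo \<open>s\<close> the one at
  \<open>r\<close>, which imitates the flip of \<open>b\<close>; modulo \<open>t\<close> the one at
  \<open>p\<close>, which imitates the filling of \<open>c\<close>.\<close>

lemma double_harpoon_solution:
  assumes p: "2 * p + 1 = s" and r: "2 * r + 1 = t" and m: "pair_moves b c"
    and M: "M = (T - {c}) \<union> {bar c}"
  defines "X0 \<equiv> (M - {bar p, bar r}) \<union> {p, r}"
  shows "self_conj M" "near M {..<0}" "self_conj X0" "eqv s X0 S" "eqv t X0 T" "near X0 M"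
    "dsum (\<lambda>z. z) X0 M = s + t"
    "\<And>X. self_conj X \<Longrightarrow> eqv s X X0 \<Longrightarrow> eqv t X X0 \<Longrightarrow> dsum (\<lambda>z. z) X X0 = 0 \<Longrightarrow> X = X0"
proof -
  have "odd (s * t - s - t)" using p r by (metis even_add even_diff even_mult_iff odd_two_times_div_two_succ dvd_triv_left even_plus_one_iff)
  then obtain d where d: "2 * d + 1 = s * t - s - t" by (metis oddE)
  note mm = pair_moves_middle[OF p r m M d]
  have nM: "p \<notin> M" "r \<notin> M" using half_notin_core mm(1-3) p r by auto
  have pr: "p \<noteq> r" using p r nst by auto
  have X0: "self_conj X0" "near X0 M" "\<And>f. dsum f X0 M = f p + f r - f (bar p) - f (bar r)"
    using double_flip[OF mm(3) nM pr] by (simp_all add: X0_def)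
  show "self_conj M" "near M {..<0}" "self_conj X0" "near X0 M" using mm X0 by auto
  show "dsum (\<lambda>z. z) X0 M = s + t" using X0(3)[of "\<lambda>z. z"] p r by (simp add: bar_def)
  have SM: "near S M" "\<And>f. dsum f S M = f (bar b) - f b"
    using flip_single[OF mm(3,6)] mm(5) by simp_all
  have TM: "near T M" "\<And>f. dsum f T M = f c - f (bar c)"
    using flip_single[OF mm(3,8)] mm(7) by simp_all
  show "eqv s X0 S"
  proof (rule eqv_common[OF X0(2) SM(1)])
    fix h :: "int \<Rightarrow> int" assume h: "\<forall>b. h (b + s) = h b"
    show "dsum h X0 M = dsum h S M"
      unfolding X0(3) SM(2) using periodic_cong[OF h mm(9)] periodic_cong[OF h cong_bar[OF mm(9)]]
        periodic_bar_self[OF h, of p] p by simp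
  qed
  show "eqv t X0 T"
  proof (rule eqv_common[OF X0(2) TM(1)])
    fix h :: "int \<Rightarrow> int" assume h: "\<forall>b. h (b + t) = h b"
    show "dsum h X0 M = dsum h T M"
      unfolding X0(3) TM(2) using periodic_cong[OF h mm(10)] periodic_cong[OF h cong_bar[OF mm(10)]]
        periodic_bar_self[OF h, of r] r by simp
  qed
  show "\<And>X. self_conj X \<Longrightarrow> eqv s X X0 \<Longrightarrow> eqv t X X0 \<Longrightarrow> dsum (\<lambda>z. z) X X0 = 0 \<Longrightarrow> X = X0"
    by (rule double_flip_unique[OF mm(1,2,3,4) p r d mm(11)]) (simp_all add: X0_def)
qed

end

text \<open>The comparison runs over all simultaneous cores, self-conjugate or not, and equality of
  size forces equality of cores; so the description in \<open>kappa\<close> is unique.\<close>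

lemma kappa_beta_set:
  assumes "s > 1" "t > 1" "coprime s t" and e: "2 * e + 1 = int s * int t - int s - int t"
  shows "is_core2 s t (kappa s t)" "beta_set (kappa s t) = coprime_pair.max_core (int s) (int t) e"
    "self_conj (coprime_pair.max_core (int s) (int t) e)"
proof -
  interpret coprime_pair "int s" "int t"
    using assms by unfold_locales (auto simp: coprime_int_iff)
  let ?K = "max_core e"
  show scK: "self_conj ?K" using max_core_coord[of e] e by metis
  obtain k where k: "is_partition k" "beta_set k = ?K"
    using partition_exists[OF near_negatives_self_conj[OF scK max_core_le] self_conj_charge[OF scK]] by blast
  have core: "is_core2 s t l \<longleftrightarrow> is_partition l \<and> core_set (int s) (beta_set l) \<and> core_set (int t) (beta_set l)" for l
    using is_core_core_set assms(1,2) by (auto simp: is_core2_def)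
  have k2: "is_core2 s t k" unfolding core using k max_core_core by simp
  have max: "psize l \<le> psize k" "psize l = psize k \<Longrightarrow> l = k" if "is_core2 s t l" for l
  proof -
    have l: "is_partition l" "core_set (int s) (beta_set l)" "core_set (int t) (beta_set l)"
      using that core by auto
    note L = max_core_largest[OF l(2,3) beta_set_negatives(1,2)[OF l(1)] e]
    have sz: "int (psize k) = int (psize l) + dsum (\<lambda>z. z) ?K (beta_set l)"
      using psize_dsum[OF k(1) l(1)] k(2) by simp
    then show "psize l \<le> psize k" using L(1) by simp
    assume "psize l = psize k"
    then show "l = k" using L(2) sz beta_set_inject[OF l(1) k(1)] k(2) by simp
  qed
  have "kappa s t = k"
    unfolding kappa_def
  proof (rule the_equality)
    show "is_core2 s t k \<and> (\<forall>l. is_core2 s t l \<longrightarrow> psize l \<le> psize k)" using k2 max by blast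
    fix x assume x: "is_core2 s t x \<and> (\<forall>l. is_core2 s t l \<longrightarrow> psize l \<le> psize x)"
    then have "psize x = psize k" using max(1)[of x] k2 by (simp add: le_antisym)
    then show "x = k" using max(2) x by blast
  qed
  then show "is_core2 s t (kappa s t)" "beta_set (kappa s t) = ?K" using k2 k by auto
qed

section \<open>From bead sets back to partitions\<close>

locale core_setting =
  fixes s t :: nat and \<sigma> \<tau> :: "nat \<Rightarrow> nat"
  assumes s1: "s > 1" and t1: "t > 1" and cop: "coprime s t"
    and core_\<sigma>: "is_core2 s t \<sigma>" and core_\<tau>: "is_core2 s t \<tau>"
begin

lemma swap: "core_setting t s \<tau> \<sigma>"
  using s1 t1 cop core_\<sigma> core_\<tau> by (simp add: core_setting_def is_core2_def coprime_commute)

lemma parts: "is_partition \<sigma>" "is_partition \<tau>"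
  using core_\<sigma> core_\<tau> by (auto simp: is_core2_def is_core_def)

lemma cores: "core_set (int s) (beta_set \<sigma>)" "core_set (int t) (beta_set \<sigma>)"
  "core_set (int s) (beta_set \<tau>)" "core_set (int t) (beta_set \<tau>)"
  using core_\<sigma> core_\<tau> is_core_core_set s1 t1 by (auto simp: is_core2_def)

definition sols :: "nat \<Rightarrow> (nat \<Rightarrow> nat) set" where
  "sols n = {l. is_partition l \<and> psize l = n \<and> core_of s l = \<sigma> \<and> core_of t l = \<tau> \<and> conjugate l = l}"

lemma sols_iff:
  assumes "is_partition l"
  shows "l \<in> sols n \<longleftrightarrow> psize l = n \<and> self_conj (beta_set l) \<and>
    eqv (int s) (beta_set l) (beta_set \<sigma>) \<and> eqv (int t) (beta_set l) (beta_set \<tau>)"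
  using assms core_of_iff[of s l \<sigma>] core_of_iff[of t l \<tau>] core_\<sigma> core_\<tau> s1 t1 conjugate_self_conj[OF assms]
  by (auto simp: sols_def is_core2_def)

lemma core_pair:
  assumes "conjugate \<sigma> = \<sigma>" "conjugate \<tau> = \<tau>"
  shows "core_pair (int s) (int t) (beta_set \<sigma>) (beta_set \<tau>)"
proof
  show "int s > 1" "int t > 1" "coprime (int s) (int t)" using s1 t1 cop by (auto simp: coprime_int_iff)
  show "self_conj (beta_set \<sigma>)" "self_conj (beta_set \<tau>)"
    using assms conjugate_self_conj parts by auto
  show "near (beta_set \<sigma>) {..<0}" "near (beta_set \<tau>) {..<0}"
    using beta_set_negatives parts by auto
qed (rule cores)+

text \<open>A self-conjugate set near the negatives has charge zero and is therefore a beta-set,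
  which transfers existence and uniqueness to partitions. \<open>m\<close> is the reference against
  which each case measures its size.\<close>

lemma unique_solution:
  assumes X0: "self_conj X0" "eqv (int s) X0 (beta_set \<sigma>)" "eqv (int t) X0 (beta_set \<tau>)"
    and m: "is_partition m" "int n = int (psize m) + dsum (\<lambda>z. z) X0 (beta_set m)"
    and uniq: "\<And>X. self_conj X \<Longrightarrow> eqv (int s) X X0 \<Longrightarrow> eqv (int t) X X0 \<Longrightarrow> dsum (\<lambda>z. z) X X0 = 0 \<Longrightarrow> X = X0"
  shows "\<exists>!l. l \<in> sols n"
proof -
  have n0: "near X0 {..<0}" using X0(2) beta_set_negatives(1)[OF parts(1)] near_trans unfolding eqv_def by blast
  obtain l where l: "is_partition l" "beta_set l = X0"
    using partition_exists[OF n0 self_conj_charge[OF X0(1)]] by blast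
  have "psize l = n" using psize_dsum[OF l(1) m(1)] m(2) l(2) by simp
  then have "l \<in> sols n" using sols_iff[OF l(1)] X0 l(2) by simp
  moreover have "l' = l" if l': "l' \<in> sols n" for l'
  proof -
    have p: "is_partition l'" using l' by (simp add: sols_def)
    note f = sols_iff[OF p, of n, THEN iffD1, OF l']
    have "dsum (\<lambda>z. z) (beta_set l') X0 = 0"
      using psize_dsum[OF p l(1)] l(2) f \<open>psize l = n\<close> by simp
    then have "beta_set l' = X0" using f X0 eqv_sym eqv_trans by (intro uniq) blast+
    then show ?thesis using beta_set_inject[OF p l(1)] l(2) by simp
  qed
  ultimately show ?thesis by blast
qed

text \<open>A nonempty \<open>F\<close> violating rigidity would turn \<open>l\<close> into a second
  element of \<open>sols n\<close>.\<close>

lemma unique_rigid_pair: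
  assumes l: "l \<in> sols n" and uniq: "\<And>l'. l' \<in> sols n \<Longrightarrow> l' = l"
  shows "rigid_pair (int s) (int t) (beta_set l) (beta_set \<sigma>) (beta_set \<tau>)"
proof -
  have p: "is_partition l" using l by (simp add: sols_def)
  let ?X = "beta_set l"
  have f: "psize l = n" "self_conj ?X" "eqv (int s) ?X (beta_set \<sigma>)" "eqv (int t) ?X (beta_set \<tau>)"
    using sols_iff[OF p, of n] l by auto
  have "rigid (int s) (int t) ?X"
    unfolding rigid_def
  proof (intro allI impI)
    fix F assume F: "finite F" "F \<subseteq> ?X" "balanced (int s) F" "balanced (int t) F" "(\<Sum>b\<in>F. 2 * b + 1) = 0"
    define Y where "Y = (?X - F) \<union> bar ` F"
    note fl = flip[OF f(2) F(2,1)]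
    have nY: "near Y {..<0}" using fl(2) beta_set_negatives(1)[OF p] near_trans unfolding Y_def by blast
    have scY: "self_conj Y" using fl(1) by (simp add: Y_def)
    obtain k where k: "is_partition k" "beta_set k = Y"
      using partition_exists[OF nY self_conj_charge[OF scY]] by blast
    have "dsum (\<lambda>z. z) Y ?X = - (\<Sum>b\<in>F. 2 * b + 1)"
      unfolding Y_def fl(3) by (simp add: bar_def sum_negf[symmetric])
    then have "psize k = n" using psize_dsum[OF k(1) p] k(2) F(5) f(1) by simp
    moreover have "eqv (int s) Y (beta_set \<sigma>)" "eqv (int t) Y (beta_set \<tau>)"
      using balanced_eqv[OF f(2) F(2,1)] F(3,4) f(3,4) eqv_trans unfolding Y_def by blast+
    ultimately have "k \<in> sols n" using sols_iff[OF k(1)] k(2) scY by simp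
    then have "Y = ?X" using uniq k(2) by blast
    then show "F = {}" using fl(4) by (auto simp: Y_def)
  qed
  moreover have "self_conj (beta_set \<sigma>)" "self_conj (beta_set \<tau>)"
    using self_conj_core[OF f(3,2) cores(1)] self_conj_core[OF f(4,2) cores(4)] s1 t1 by auto
  ultimately show ?thesis
    using s1 t1 cop f cores beta_set_negatives(1) p parts
    by (simp add: rigid_pair_def rigid_pair_axioms_def core_pair_def core_pair_axioms_def coprime_pair_def coprime_int_iff)
qed

lemma double_harpoon_witness_iff:
  assumes "core_pair (int s) (int t) (beta_set \<sigma>) (beta_set \<tau>)"
  shows "double_harpoon_witness s t \<sigma> \<tau> b c \<longleftrightarrow>
    core_pair.pair_moves (int s) (int t) (beta_set \<sigma>) (beta_set \<tau>) b c"
  unfolding core_pair.pair_moves_def[OF assms] double_harpoon_witness_def by blast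

text \<open>By \<open>pair_moves_unique\<close> the bead \<open>c\<close> does not depend on the
  witness, which resolves the description in \<open>star\<close>.\<close>

lemma star_beta_set:
  assumes cp: "core_pair (int s) (int t) (beta_set \<sigma>) (beta_set \<tau>)"
    and p: "2 * p + 1 = int s" and r: "2 * r + 1 = int t" and w: "double_harpoon_witness s t \<sigma> \<tau> b c"
  shows "is_partition (star s t \<sigma> \<tau>)" "beta_set (star s t \<sigma> \<tau>) = (beta_set \<tau> - {c}) \<union> {bar c}"
proof -
  interpret core_pair "int s" "int t" "beta_set \<sigma>" "beta_set \<tau>" by (rule cp)
  note W = double_harpoon_witness_iff[OF cp]
  define M where "M = (beta_set \<tau> - {c}) \<union> {bar c}"
  note sol = double_harpoon_solution(1,2)[OF p r w[unfolded W] M_def]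
  obtain m where m: "is_partition m" "beta_set m = M"
    using partition_exists[OF sol(2) self_conj_charge[OF sol(1)]] by blast
  have "star s t \<sigma> \<tau> = m"
    unfolding star_def
  proof (rule the_equality)
    show "is_partition m \<and> (\<exists>b c. double_harpoon_witness s t \<sigma> \<tau> b c \<and> beta_set m = (beta_set \<tau> - {c}) \<union> {bar c})"
      using m w unfolding M_def by blast
    fix x assume "is_partition x \<and> (\<exists>b c. double_harpoon_witness s t \<sigma> \<tau> b c \<and> beta_set x = (beta_set \<tau> - {c}) \<union> {bar c})"
    then obtain b' c' where x: "is_partition x" "double_harpoon_witness s t \<sigma> \<tau> b' c'" "beta_set x = (beta_set \<tau> - {c'}) \<union> {bar c'}"
      by blast
    have "c = c'" using pair_moves_unique[OF p r] w x(2) unfolding W by blast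
    then show "x = m" using beta_set_inject[OF x(1) m(1)] x(3) m(2) by (simp add: M_def)
  qed
  then show "is_partition (star s t \<sigma> \<tau>)" "beta_set (star s t \<sigma> \<tau>) = (beta_set \<tau> - {c}) \<union> {bar c}"
    using m by (simp_all add: M_def)
qed

lemma harpoon_unique:
  assumes "conjugate \<sigma> = \<sigma>" "conjugate \<tau> = \<tau>" "odd t" "harpoon s t \<sigma> \<tau>" "n = psize \<tau> + t"
  shows "\<exists>!l. l \<in> sols n"
proof -
  interpret core_pair "int s" "int t" "beta_set \<sigma>" "beta_set \<tau>" by (rule core_pair[OF assms(1,2)])
  obtain r where r: "2 * r + 1 = int t" using assms(3) by (metis even_of_nat oddE)
  obtain b where b: "b \<in> beta_set \<tau>" "b \<notin> beta_set \<sigma>" "[bar b - b = int t] (mod 2 * int s)"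
      "beta_set \<sigma> = (beta_set \<tau> - {b}) \<union> {bar b}"
    using assms(4) unfolding harpoon_def by blast
  note sol = harpoon_solution[OF r b]
  show ?thesis
    by (rule unique_solution[OF sol(1-3) parts(2)]) (use sol(4,5) assms(5) in auto)
qed

lemma equal_cores_unique:
  assumes "conjugate \<sigma> = \<sigma>" "conjugate \<tau> = \<tau>" "\<sigma> = \<tau>" "n = psize \<sigma>"
  shows "\<exists>!l. l \<in> sols n"
proof -
  interpret core_pair "int s" "int t" "beta_set \<sigma>" "beta_set \<tau>" by (rule core_pair[OF assms(1,2)])
  show ?thesis
  proof (rule unique_solution[OF scS _ _ parts(1)])
    fix X assume X: "self_conj X" "eqv (int s) X (beta_set \<sigma>)" "dsum (\<lambda>z. z) X (beta_set \<sigma>) = 0"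
    then show "X = beta_set \<sigma>" using eqv_same_size[OF X(2) sS X(1) scS nS] core_setting.s1[OF core_setting_axioms] by simp
  qed (use assms in auto)
qed

lemma double_harpoon_unique:
  assumes "conjugate \<sigma> = \<sigma>" "conjugate \<tau> = \<tau>" "odd s" "odd t" "double_harpoon s t \<sigma> \<tau>"
    "n = psize (star s t \<sigma> \<tau>) + s + t"
  shows "\<exists>!l. l \<in> sols n"
proof -
  note cp = core_pair[OF assms(1,2)]
  interpret core_pair "int s" "int t" "beta_set \<sigma>" "beta_set \<tau>" by (rule cp)
  obtain p where p: "2 * p + 1 = int s" using assms(3) by (metis even_of_nat oddE)
  obtain r where r: "2 * r + 1 = int t" using assms(4) by (metis even_of_nat oddE)
  obtain b c where w: "double_harpoon_witness s t \<sigma> \<tau> b c" using assms(5) unfolding double_harpoon_def by blast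
  note st = star_beta_set[OF cp p r w]
  note sol = double_harpoon_solution[OF p r w[unfolded double_harpoon_witness_iff[OF cp]] refl, folded st(2)]
  show ?thesis
    by (rule unique_solution[OF sol(3-5) st(1)]) (use sol(7,8) assms(6) in auto)
qed

lemma kappa_unique:
  assumes "odd s" "odd t" "\<sigma> = \<tau>" "\<tau> = kappa s t" "n = psize (kappa s t) + s * t"
  shows "\<exists>!l. l \<in> sols n"
proof -
  interpret coprime_pair "int s" "int t"
    using s1 t1 cop by unfold_locales (auto simp: coprime_int_iff)
  have "odd (int s * int t - int s - int t)" "odd (int s * int t)" using assms(1,2) by simp_all
  then obtain e q where e: "2 * e + 1 = int s * int t - int s - int t" and q: "2 * q + 1 = int s * int t"
    by (metis oddE)
  note K = kappa_beta_set[OF core_setting.s1[OF core_setting_axioms] core_setting.t1[OF core_setting_axioms]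
      core_setting.cop[OF core_setting_axioms] e]
  have "e < q" using q e s1 t1 by linarith
  then have "q \<notin> max_core e" using max_core_le[of q e] by auto
  then have qK: "bar q \<in> max_core e" using K(3) self_conj_bar by blast
  define X0 where "X0 = (max_core e - {bar q}) \<union> {q}"
  have X0: "self_conj X0" "near X0 (max_core e)" "dsum (\<lambda>z. z) X0 (max_core e) = int s * int t"
    using flip_single(1,2)[OF K(3) qK] flip_single(3)[OF K(3) qK, of "\<lambda>z. z"] q by (simp_all add: X0_def bar_def)
  have "2 * bar q + 1 = - (int s * int t)" using q by (simp add: bar_def)
  then have "int s dvd 2 * bar q + 1" "int t dvd 2 * bar q + 1" by simp_all
  from this[THEN flip_eqv_self_dual[OF K(3) qK]]
  have ev: "eqv (int s) X0 (max_core e)" "eqv (int t) X0 (max_core e)" by (simp_all add: X0_def)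
  have bs: "beta_set \<sigma> = max_core e" "beta_set \<tau> = max_core e" using assms K(2) by simp_all
  show ?thesis
  proof (rule unique_solution[OF X0(1) _ _ parts(1)])
    show "eqv (int s) X0 (beta_set \<sigma>)" "eqv (int t) X0 (beta_set \<tau>)" using ev bs by simp_all
    show "int n = int (psize \<sigma>) + dsum (\<lambda>z. z) X0 (beta_set \<sigma>)" using X0(3) bs assms by simp
    fix X assume X: "self_conj X" "eqv (int s) X X0" "eqv (int t) X X0" "dsum (\<lambda>z. z) X X0 = 0"
    have "near X X0" using X(2) by (simp add: eqv_def)
    then have "dsum (\<lambda>z. z) X (max_core e) = int s * int t"
      using dsum_trans[OF _ X0(2), of X "\<lambda>z. z"] X(4) X0(3) by simp
    then show "X = X0"
      using max_core_unique_next[OF e X(1) eqv_trans[OF X(2) ev(1)] eqv_trans[OF X(3) ev(2)] _ q] by (simp add: X0_def)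
  qed
qed

lemma single_exc_harpoon:
  assumes rp: "rigid_pair (int s) (int t) (beta_set l) (beta_set \<sigma>) (beta_set \<tau>)" and l: "is_partition l"
    and e: "exc_rise (int s) (int t) (beta_set l) b" "\<nexists>c. exc_rise (int t) (int s) (beta_set l) c"
  shows "odd s \<and> harpoon t s \<tau> \<sigma> \<and> psize l = psize \<sigma> + s"
proof -
  interpret rigid_pair "int s" "int t" "beta_set l" "beta_set \<sigma>" "beta_set \<tau>" by (rule rp)
  obtain p c where p: "2 * p + 1 = int s" "bar p \<in> beta_set \<sigma>" "beta_set l = (beta_set \<sigma> - {bar p}) \<union> {p}"
    and c: "[c = p] (mod int t)" "c \<notin> beta_set \<sigma>" "beta_set \<tau> = (beta_set \<sigma> - {bar c}) \<union> {c}"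
    using single_exc[OF e] by metis
  have "odd s" using p(1) by presburger
  moreover have "harpoon t s \<tau> \<sigma>"
    unfolding harpoon_def
  proof (intro exI conjI)
    show "bar c \<in> beta_set \<sigma> - beta_set \<tau>" using c scS by (simp add: self_conj_bar)
    show "[bar (bar c) - bar c = int s] (mod 2 * int t)" using bar_cong_half[OF p(1), of "bar c" "int t"] c(1) by simp
    show "beta_set \<tau> = (beta_set \<sigma> - {bar c}) \<union> {bar (bar c)}" using c(3) by simp
  qed
  moreover have "dsum (\<lambda>z. z) (beta_set l) (beta_set \<sigma>) = int s"
    using flip_single(3)[OF scS p(2), of "\<lambda>z. z"] p(1,3) by (simp add: bar_def)
  then have "psize l = psize \<sigma> + s" using psize_dsum[OF l parts(1)] by simp
  ultimately show ?thesis by blast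
qed

text \<open>The bead \<open>d\<close> forces \<open>max_core d\<close> into the core, and one
  self-conjugate set cannot properly contain another.\<close>

lemma common_exc_kappa:
  assumes rp: "rigid_pair (int s) (int t) (beta_set l) (beta_set \<sigma>) (beta_set \<tau>)" and l: "is_partition l"
    and e: "exc_rise (int s) (int t) (beta_set l) b" "exc_rise (int t) (int s) (beta_set l) b"
  shows "odd s \<and> odd t \<and> \<sigma> = \<tau> \<and> \<tau> = kappa s t \<and> psize l = psize (kappa s t) + s * t"
proof -
  interpret rigid_pair "int s" "int t" "beta_set l" "beta_set \<sigma>" "beta_set \<tau>" by (rule rp)
  obtain d where q: "2 * b + 1 = int s * int t" "bar b \<in> beta_set \<sigma>" "beta_set l = (beta_set \<sigma> - {bar b}) \<union> {b}"
    and ts: "beta_set \<tau> = beta_set \<sigma>" and d: "2 * d + 1 = int s * int t - int s - int t" "d \<in> beta_set \<sigma>"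
    using common_exc[OF e] by metis
  have "odd (int s * int t)" unfolding q(1)[symmetric] by simp
  then have odd: "odd s" "odd t" by simp_all
  note K = kappa_beta_set[OF core_setting.s1[OF core_setting_axioms] core_setting.t1[OF core_setting_axioms]
      core_setting.cop[OF core_setting_axioms] d(1)]
  have "max_core d = beta_set \<sigma>"
    by (rule self_conj_subset_eq[OF K(3) scS max_core_least[OF sS tS d(2)]])
  then have k: "\<sigma> = kappa s t" using beta_set_inject[OF parts(1)] K(1,2) by (simp add: is_core2_def is_core_def)
  have st: "\<sigma> = \<tau>" using beta_set_inject parts ts by metis
  have "dsum (\<lambda>z. z) (beta_set l) (beta_set \<sigma>) = int s * int t"
    using flip_single(3)[OF scS q(2), of "\<lambda>z. z"] q(1,3) by (simp add: bar_def)
  then have "int (psize l) = int (psize \<sigma> + s * t)" using psize_dsum[OF l parts(1)] by simp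
  then have "psize l = psize \<sigma> + s * t" by (simp only: of_nat_eq_iff)
  then show ?thesis using odd st k by simp
qed

lemma double_exc_star:
  assumes rp: "rigid_pair (int s) (int t) (beta_set l) (beta_set \<sigma>) (beta_set \<tau>)" and l: "is_partition l"
    and cp: "core_pair (int s) (int t) (beta_set \<sigma>) (beta_set \<tau>)"
    and e: "exc_rise (int s) (int t) (beta_set l) p" "exc_rise (int t) (int s) (beta_set l) r"
    and p: "2 * p + 1 = int s" and r: "2 * r + 1 = int t"
  shows "odd s \<and> odd t \<and> double_harpoon s t \<sigma> \<tau> \<and> psize l = psize (star s t \<sigma> \<tau>) + s + t"
proof -
  interpret rigid_pair "int s" "int t" "beta_set l" "beta_set \<sigma>" "beta_set \<tau>" by (rule rp)
  obtain M c d where M: "core_set (int s) M" "core_set (int t) M" "self_conj M" "bar p \<in> M" "bar r \<in> M"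
      "beta_set l = (M - {bar p, bar r}) \<union> {p, r}"
    and d: "[d = r] (mod int s)" "d \<notin> M" "beta_set \<sigma> = (M - {bar d}) \<union> {d}"
    and c: "[c = p] (mod int t)" "c \<notin> M" "beta_set \<tau> = (M - {bar c}) \<union> {c}" and cd: "c \<noteq> d"
    using double_exc[OF e p r] by metis
  have bM: "bar c \<in> M" "bar d \<in> M" using c(2) d(2) M(3) by (auto simp: self_conj_bar)
  have bcd: "bar c \<noteq> bar d" using cd by (metis bar_bar)
  \<comment> \<open>Passing from \<open>M\<close> to \<open>S\<close> flips \<open>bar d\<close>
    away, passing from \<open>M\<close> to \<open>T\<close> fills \<open>c\<close>; these are the
    two beads of \<open>T\<close> that \<open>S\<close> lacks.\<close>
  have w: "double_harpoon_witness s t \<sigma> \<tau> (bar d) c"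
    unfolding double_harpoon_witness_def
  proof (intro conjI)
    show "bar d \<noteq> c" using bM c(2) by auto
    show "bar d \<in> beta_set \<tau> - beta_set \<sigma>" using bM bcd by (auto simp: c(3) d(3))
    show "c \<in> beta_set \<tau> - beta_set \<sigma>" using c(2) cd by (simp add: c(3) d(3))
    show "[bar (bar d) - bar d = int t] (mod 2 * int s)" using bar_cong_half[OF r, of "bar d" "int s"] d(1) by simp
    show "[bar c - c = - int s] (mod 2 * int t)" using bar_cong_half_neg[OF p] c(1) by blast
    show "beta_set \<sigma> = beta_set \<tau> - {bar d, c} \<union> {bar (bar d), bar c}"
      using bM bcd c(2) by (auto simp: c(3) d(3))
  qed
  note st = star_beta_set[OF cp p r w]
  have "beta_set (star s t \<sigma> \<tau>) = M" using st(2) c(2) bM by (auto simp: c(3))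
  moreover have "dsum (\<lambda>z. z) (beta_set l) M = int s + int t"
  proof -
    have "p \<notin> M" "r \<notin> M" using M(3-5) by (auto simp: self_conj_bar)
    moreover have "p \<noteq> r" using p r nst by auto
    ultimately show ?thesis using double_flip(3)[OF M(3) _ _ _ M(6), of "\<lambda>z. z"] p r by (simp add: bar_def)
  qed
  ultimately have "psize l = psize (star s t \<sigma> \<tau>) + s + t" using psize_dsum[OF l st(1)] by simp
  moreover have "odd s" "odd t" using p r by presburger+
  ultimately show ?thesis using w unfolding double_harpoon_def by blast
qed

end

theorem theorem4p3:
  fixes s t n :: nat and \<sigma> \<tau> :: "nat \<Rightarrow> nat"
  assumes "s > 1" and "t > 1" and "coprime s t"
    and "is_core2 s t \<sigma>" and "is_core2 s t \<tau>"
  shows "(\<exists>!l. l \<in> {l. is_partition l \<and> psize l = n \<and> core_of s l = \<sigma> \<and> core_of t l = \<tau>} \<and>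
               conjugate l = l)
    \<longleftrightarrow>
    conjugate \<sigma> = \<sigma> \<and> conjugate \<tau> = \<tau> \<and>
    ((\<sigma> = \<tau> \<and> n = psize \<sigma>) \<or>
     (odd t \<and> harpoon s t \<sigma> \<tau> \<and> n = psize \<tau> + t) \<or>
     (odd s \<and> harpoon t s \<tau> \<sigma> \<and> n = psize \<sigma> + s) \<or>
     (odd s \<and> odd t \<and> double_harpoon s t \<sigma> \<tau> \<and> n = psize (star s t \<sigma> \<tau>) + s + t) \<or>
     (odd s \<and> odd t \<and> \<sigma> = \<tau> \<and> \<tau> = kappa s t \<and> n = psize (kappa s t) + s * t))" (is "_ \<longleftrightarrow> ?rhs")
proof -
  interpret C: core_setting s t \<sigma> \<tau> using assms by unfold_locales
  interpret D: core_setting t s \<tau> \<sigma> by (rule C.swap)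
  have DC: "D.sols n = C.sols n" by (auto simp: C.sols_def D.sols_def)
  have lhs: "(\<exists>!l. l \<in> {l. is_partition l \<and> psize l = n \<and> core_of s l = \<sigma> \<and> core_of t l = \<tau>} \<and> conjugate l = l)
    \<longleftrightarrow> (\<exists>!l. l \<in> C.sols n)"
    by (simp add: C.sols_def conj_assoc)
  show ?thesis
    unfolding lhs
  proof
    assume "\<exists>!l. l \<in> C.sols n"
    then obtain l where l: "l \<in> C.sols n" "\<And>l'. l' \<in> C.sols n \<Longrightarrow> l' = l" by blast
    have p: "is_partition l" and n: "n = psize l" using l(1) by (auto simp: C.sols_def)
    note rp = C.unique_rigid_pair[OF l]
    interpret R: rigid_pair "int s" "int t" "beta_set l" "beta_set \<sigma>" "beta_set \<tau>" by (rule rp)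
    have sc: "conjugate \<sigma> = \<sigma>" "conjugate \<tau> = \<tau>"
      using conjugate_self_conj C.parts R.scS R.scT by auto
    let ?E = "\<lambda>b. exc_rise (int s) (int t) (beta_set l) b" and ?E' = "\<lambda>b. exc_rise (int t) (int s) (beta_set l) b"
    have cases: "\<And>b. ?E b \<Longrightarrow> 2 * b + 1 = int s \<or> ?E' b" "\<And>b. ?E' b \<Longrightarrow> 2 * b + 1 = int t \<or> ?E b"
      using R.exc_cases rigid_pair.exc_cases[OF R.swap_rigid] by blast+
    \<comment> \<open>If both moduli have exceptional rises and none is common, \<open>cases\<close>
      places them at the halves of \<open>s\<close> and \<open>t\<close>.\<close>
    consider (none) "\<nexists>b. ?E b" "\<nexists>b. ?E' b" | (fst) b where "?E b" "\<nexists>b. ?E' b" | (snd) b where "\<nexists>b. ?E b" "?E' b"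
      | (common) b where "?E b" "?E' b"
      | (both) b c where "?E b" "?E' c" "2 * b + 1 = int s" "2 * c + 1 = int t"
      using cases by blast
    then show ?rhs
    proof cases
      case none
      then have "l = \<sigma>" "l = \<tau>" using R.no_exc beta_set_inject p C.parts by blast+
      then show ?thesis using sc n by blast
    next
      case fst
      then show ?thesis using C.single_exc_harpoon[OF rp p] sc n by blast
    next
      case snd
      then show ?thesis using D.single_exc_harpoon[OF R.swap_rigid p] sc n by blast
    next
      case common
      then show ?thesis using C.common_exc_kappa[OF rp p] sc n by blast
    next
      case both
      then show ?thesis using C.double_exc_star[OF rp p C.core_pair[OF sc]] sc n by blast
    qed
  next
    assume rhs: ?rhs
    then have sc: "conjugate \<sigma> = \<sigma>" "conjugate \<tau> = \<tau>" by blast+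
    from rhs consider (C1) "\<sigma> = \<tau>" "n = psize \<sigma>"
      | (C2) "odd t" "harpoon s t \<sigma> \<tau>" "n = psize \<tau> + t"
      | (C3) "odd s" "harpoon t s \<tau> \<sigma>" "n = psize \<sigma> + s"
      | (C4) "odd s" "odd t" "double_harpoon s t \<sigma> \<tau>" "n = psize (star s t \<sigma> \<tau>) + s + t"
      | (C5) "odd s" "odd t" "\<sigma> = \<tau>" "\<tau> = kappa s t" "n = psize (kappa s t) + s * t"
      by argo
    then show "\<exists>!l. l \<in> C.sols n"
    proof cases
      case C1
      then show ?thesis by (rule C.equal_cores_unique[OF sc])
    next
      case C2
      then show ?thesis by (rule C.harpoon_unique[OF sc])
    next
      case C3
      then have "\<exists>!l. l \<in> D.sols n" by (rule D.harpoon_unique[OF sc(2,1)])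
      then show ?thesis unfolding DC .
    next
      case C4
      then show ?thesis by (rule C.double_harpoon_unique[OF sc])
    next
      case C5
      then show ?thesis by (rule C.kappa_unique)
    qed
  qed
qed

end
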